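(* Let $m\ge1$ and $n:=2m-1$. There exists a $T^\iota$-equivariant isomorphism of projective varieties $$\zeta:\mathrm{Sp}\mathcal{F}l^a_{2m}\xrightarrow{\ \simeq\ }X^\iota_{\sigma_n}\subset Sp_{2n}/Q,$$ where $\sigma_n\in\mathrm{Sym}_{2n}$ is the permutation given by $\sigma_n(2k)=k$ for $1\le k\le n$ and $\sigma_n(2k+1)=n+1+k$ for $0\le k\le n-1$, and $Q=P^\iota$ with $P=P_{\omega_1+\omega_3+\cdots+\omega_{2n-1}}\subset SL_{2n}$.
   Context: All varieties are over $\mathbb{C}$. Degenerate symplectic flag variety. Let $V\simeq\mathbb{C}^{2m}=\mathbb{C}^{n+1}$ with ordered basis $f_1,\dots,f_{2m}$, $\mathrm{pr}_k(\sum_i a_if_i)=\sum_{i\ne k}a_if_i$, and $$\mathcal{F}l^a_{n+1}=\Big\{(V_1,\dots,V_n)\in\prod_{i=1}^n\mathrm{Gr}_i(V)\ \Big|\ \mathrm{pr}_i(V_i)\subset V_{i+1}\ \forall i=1,\dots,n-1\Big\}.$$ Equip $V$ with the non-degenerate skew-symmetric form $b_V$ determined by $b_V[f_k,f_{2m-1-k}]=1$ for $1\le k\le m-1$, $b_V[f_{2m-1},f_{2m}]=1$, and $b_V[f_k,f_l]=0$ for all other pairs $k<l$. The involution $\iota:(V_1,\dots,V_n)\mapsto(V_n^\perp,V_{n-1}^\perp,\dots,V_1^\perp)$ of $\prod_{i=1}^n\mathrm{Gr}_i(V)$ preserves $\mathcal{F}l^a_{n+1}$, and the complete degenerate flag variety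 of $Sp_{2m}$ is the fixed-point set $\mathrm{Sp}\mathcal{F}l^a_{2m}=(\mathcal{F}l^a_{n+1})^\iota$. Symplectic group and Schubert variety. Let $W\simeq\mathbb{C}^{2n}$ with ordered basis $e_1,\dots,e_{2n}$, with the form $b_W$ given by $E=\begin{pmatrix}0&J\\-J&0\end{pmatrix}$, where $J$ is the $n\times n$ anti-diagonal matrix with all anti-diagonal entries $1$ (so $b_W[e_k,e_{2n+1-k}]=1$ for $1\le k\le n$). Define $\iota:SL_{2n}\to SL_{2n}$ by $\iota(A)=E({}^tA)^{-1}E^{-1}$; its fixed-point group is $Sp_{2n}$. Let $B\subset SL_{2n}$ be the upper triangular and $T\subset B$ the diagonal matrices; $B^\iota$ is a Borel subgroup of $Sp_{2n}$ and $T^\iota=T\cap Sp_{2n}$ its maximal torus. $P\supseteq B$ is the parabolic subgroup that is the stabilizer of the weight $\omega_1+\omega_3+\cdots+\omega_{2n-1}$ ($\omega_i$ the fundamental weights); $SL_{2n}/P$ is the variety of partial flags $W_1\subset\cdots\subset W_n$ in $W$ with $\dim W_i=2i-1$. $P$ is $\iota$-stable, $Q=P^\iota=P\cap Sp_{2n}$ is parabolic in $Sp_{2n}$. The involution $\iota:(W_1,\dots,W_n)\mapsto(W_n^\perp,\dots,W_1^\perp)$ (orthogonals with respect to $b_W$) acts on $SL_{2n}/P$, with $(SL_{2n}/P)^\iota=Sp_{2n}/Q$. $X_{\sigma_n}=\overline{B\sigma_nP/P}$ is the closure of the $B$-orbit of the flag with $i$-th subspace $\langle e_{\sigma_n(1)},\dots,e_{\sigma_n(2i-1)}\rangle$;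 it is $\iota$-stable, and its fixed-point set $X_{\sigma_n}^\iota$ is the Schubert variety $\overline{B^\iota\sigma_nQ/Q}$ in $Sp_{2n}/Q$. Torus actions. $\underline\lambda=\mathrm{diag}(\lambda_1,\dots,\lambda_{2n})\in T$ acts on $W$ by $\underline\lambda e_k=\lambda_ke_k$ and on the factor $\mathrm{Gr}_i(V)$ through the linear action on $V$ given by $f_k\mapsto\lambda_kf_k$ if $i\le k\le n+1$ and $f_k\mapsto\lambda_{n+1+k}f_k$ if $1\le k\le i-1$. These induce actions of $T$ on $X_{\sigma_n}$ and $\mathcal{F}l^a_{n+1}$, and of $T^\iota$ on $X_{\sigma_n}^\iota$ and $\mathrm{Sp}\mathcal{F}l^a_{2m}$. *)

theory Defs
  imports
    "HOL-Analysis.Abstract_Topology"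
    "HOL-Combinatorics.Permutations"
    "Jordan_Normal_Form.DL_Submatrix"
    "Jordan_Normal_Form.VS_Connect"
    "Jordan_Normal_Form.Gauss_Jordan_Elimination"
begin

hide_const (open) Real_Vector_Spaces.span Real_Vector_Spaces.dim

text \<open>
  Indices of factors, basis vectors and permutations are 1-based; vectors and matrices
  have 0-based entries, so the basis vector numbered \<open>k\<close> is \<open>unit_vec N (k - 1)\<close>.
  A variety is a reduced, not necessarily irreducible, closed algebraic set.
\<close>

section \<open>Products of Grassmannians as projective varieties\<close>

definition Gr :: "nat \<Rightarrow> nat \<Rightarrow> complex vec set set" where
  "Gr d N = {U. VectorSpace.subspace class_ring U (module_vec TYPE(complex) N) \<and>
     vectorspace.dim class_ring ((module_vec TYPE(complex) N)\<lparr>carrier := U\<rparr>) = d}"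

text \<open>The product of the Grassmannians of \<open>subdim i\<close>-dimensional subspaces of
  \<open>\<complex>\<close>-space of dimension \<open>vdim\<close>, for \<open>i = 1, \<dots>, factors\<close>.\<close>

record gr_product =
  factors :: nat
  subdim :: "nat \<Rightarrow> nat"
  vdim :: nat

type_synonym subspaces = "nat \<Rightarrow> complex vec set"

definition points :: "gr_product \<Rightarrow> subspaces set" where
  "points A = (\<Pi>\<^sub>E i\<in>{1..factors A}. Gr (subdim A i) (vdim A))"

text \<open>The columns of a frame form a basis of \<open>U\<close> (if \<open>U \<in> Gr d N\<close>). Another choice of frame
  multiplies all Pluecker coordinates of \<open>U\<close> by one common nonzero scalar, which affects neither
  the vanishing of a multihomogeneous polynomial nor a quotient of two of equal multidegree.\<close>

definition frame :: "nat \<Rightarrow> nat \<Rightarrow> complex vec set \<Rightarrow> complex mat" where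
  "frame d N U = (SOME M. M \<in> carrier_mat N d \<and> vec_space.col_space N M = U)"

definition pluecker :: "gr_product \<Rightarrow> subspaces \<Rightarrow> nat \<Rightarrow> nat set \<Rightarrow> complex" where
  "pluecker A x i J = det (submatrix (frame (subdim A i) (vdim A) (x i)) J UNIV)"

text \<open>\<open>multihom A \<delta> f\<close>: as a function of the Pluecker coordinates, \<open>f\<close> is a polynomial that is
  homogeneous of degree \<open>\<delta> i\<close> in the coordinates of the \<open>i\<close>-th factor.\<close>

inductive multihom ::
    "gr_product \<Rightarrow> (nat \<Rightarrow> nat) \<Rightarrow> ((nat \<Rightarrow> nat set \<Rightarrow> complex) \<Rightarrow> complex) \<Rightarrow> bool"
  for A where
  const: "multihom A (\<lambda>_. 0) (\<lambda>_. c)"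
| coord: "\<lbrakk>i \<in> {1..factors A}; J \<subseteq> {..<vdim A}; card J = subdim A i\<rbrakk>
    \<Longrightarrow> multihom A ((\<lambda>_. 0)(i := 1)) (\<lambda>p. p i J)"
| add: "\<lbrakk>multihom A \<delta> f; multihom A \<delta> g\<rbrakk> \<Longrightarrow> multihom A \<delta> (\<lambda>p. f p + g p)"
| mult: "\<lbrakk>multihom A \<delta> f; multihom A \<epsilon> g\<rbrakk>
    \<Longrightarrow> multihom A (\<lambda>i. \<delta> i + \<epsilon> i) (\<lambda>p. f p * g p)"

definition zariski_open :: "gr_product \<Rightarrow> subspaces set \<Rightarrow> bool" where
  "zariski_open A U \<longleftrightarrow> (\<exists>S. (\<forall>f\<in>S. \<exists>\<delta>. multihom A \<delta> f) \<and>
     U = {x \<in> points A. \<exists>f\<in>S. f (pluecker A x) \<noteq> 0})"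

definition zariski :: "gr_product \<Rightarrow> subspaces topology" where
  "zariski A = topology (zariski_open A)"

lemma istopology_zariski_open: "istopology (zariski_open A)"
  unfolding istopology_def
proof (intro conjI allI impI)
  fix U V assume "zariski_open A U" "zariski_open A V"
  then obtain S T where S: "\<forall>f\<in>S. \<exists>\<delta>. multihom A \<delta> f" "U = {x \<in> points A. \<exists>f\<in>S. f (pluecker A x) \<noteq> 0}"
    and T: "\<forall>f\<in>T. \<exists>\<delta>. multihom A \<delta> f" "V = {x \<in> points A. \<exists>f\<in>T. f (pluecker A x) \<noteq> 0}"
    unfolding zariski_open_def by (elim exE conjE)
  let ?R = "(\<lambda>(f, g) p. f p * g p) ` (S \<times> T)"
  have "\<exists>\<delta>. multihom A \<delta> h" if h: "h \<in> ?R" for h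
  proof -
    obtain f g where "f \<in> S" "g \<in> T" "h = (\<lambda>p. f p * g p)" using h by auto
    moreover obtain \<delta> \<epsilon> where "multihom A \<delta> f" "multihom A \<epsilon> g"
      using S(1) T(1) \<open>f \<in> S\<close> \<open>g \<in> T\<close> by blast
    ultimately show ?thesis using multihom.mult[of A \<delta> f \<epsilon> g] by auto
  qed
  moreover have "U \<inter> V = {x \<in> points A. \<exists>f\<in>?R. f (pluecker A x) \<noteq> 0}"
    unfolding S(2) T(2) by auto
  ultimately show "zariski_open A (U \<inter> V)"
    unfolding zariski_open_def by (intro exI[of _ ?R] conjI ballI) simp_all
next
  fix \<K> assume K: "\<forall>U\<in>\<K>. zariski_open A U"
  let ?R = "{f. (\<exists>\<delta>. multihom A \<delta> f) \<and> {x \<in> points A. f (pluecker A x) \<noteq> 0} \<subseteq> \<Union>\<K>}"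
  have "\<Union>\<K> \<subseteq> {x \<in> points A. \<exists>f\<in>?R. f (pluecker A x) \<noteq> 0}"
  proof
    fix x assume "x \<in> \<Union>\<K>"
    then obtain U where U: "U \<in> \<K>" "x \<in> U" by auto
    with K obtain S where S: "\<forall>f\<in>S. \<exists>\<delta>. multihom A \<delta> f"
        "U = {x \<in> points A. \<exists>f\<in>S. f (pluecker A x) \<noteq> 0}"
      unfolding zariski_open_def by auto
    with U(2) obtain f where f: "x \<in> points A" "f \<in> S" "f (pluecker A x) \<noteq> 0" by auto
    have "{x \<in> points A. f (pluecker A x) \<noteq> 0} \<subseteq> U" unfolding S(2) using f(2) by auto
    with U(1) have "{x \<in> points A. f (pluecker A x) \<noteq> 0} \<subseteq> \<Union>\<K>" by (rule Sup_upper2)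
    with S(1) f have "f \<in> ?R" by simp
    with f show "x \<in> {x \<in> points A. \<exists>f\<in>?R. f (pluecker A x) \<noteq> 0}" by blast
  qed
  then have "\<Union>\<K> = {x \<in> points A. \<exists>f\<in>?R. f (pluecker A x) \<noteq> 0}" by (intro subset_antisym) auto
  then show "zariski_open A (\<Union>\<K>)"
    unfolding zariski_open_def by (intro exI[of _ ?R] conjI ballI) simp_all
qed

lemma openin_zariski: "openin (zariski A) U \<longleftrightarrow> zariski_open A U"
  unfolding zariski_def topology_inverse'[OF istopology_zariski_open] ..

lemma topspace_zariski: "topspace (zariski A) = points A"
proof
  have "zariski_open A (points A)"
    unfolding zariski_open_def
  proof (intro exI[of _ "{\<lambda>_. 1}"] conjI ballI)
    fix f :: "(nat \<Rightarrow> nat set \<Rightarrow> complex) \<Rightarrow> complex" assume "f \<in> {\<lambda>_. 1}"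
    then show "\<exists>\<delta>. multihom A \<delta> f" using multihom.const[of A 1] by auto
  qed simp
  then show "points A \<subseteq> topspace (zariski A)" unfolding topspace_def openin_zariski by blast
  show "topspace (zariski A) \<subseteq> points A"
    unfolding topspace_def openin_zariski zariski_open_def by auto
qed

definition regular_on ::
    "gr_product \<Rightarrow> subspaces set \<Rightarrow> subspaces set \<Rightarrow> (subspaces \<Rightarrow> complex) \<Rightarrow> bool" where
  "regular_on A X U \<phi> \<longleftrightarrow> openin (subtopology (zariski A) X) U \<and>
     (\<forall>x\<in>U. \<exists>U'. openin (subtopology (zariski A) X) U' \<and> x \<in> U' \<and> U' \<subseteq> U \<and>
        (\<exists>\<delta> f g. multihom A \<delta> f \<and> multihom A \<delta> g \<and>
           (\<forall>y\<in>U'. g (pluecker A y) \<noteq> 0 \<and> \<phi> y = f (pluecker A y) / g (pluecker A y))))"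

definition variety_morphism ::
    "gr_product \<Rightarrow> subspaces set \<Rightarrow> gr_product \<Rightarrow> subspaces set \<Rightarrow> (subspaces \<Rightarrow> subspaces) \<Rightarrow> bool"
  where
  "variety_morphism A X B Y h \<longleftrightarrow>
     continuous_map (subtopology (zariski A) X) (subtopology (zariski B) Y) h \<and>
     (\<forall>U \<phi>. regular_on B Y U \<phi> \<longrightarrow> regular_on A X {x \<in> X. h x \<in> U} (\<phi> \<circ> h))"

definition projective_variety :: "gr_product \<Rightarrow> subspaces set \<Rightarrow> bool" where
  "projective_variety A X \<longleftrightarrow> closedin (zariski A) X"

definition variety_isomorphism ::
    "gr_product \<Rightarrow> subspaces set \<Rightarrow> gr_product \<Rightarrow> subspaces set \<Rightarrow> (subspaces \<Rightarrow> subspaces) \<Rightarrow> bool"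
  where
  "variety_isomorphism A X B Y h \<longleftrightarrow>
     projective_variety A X \<and> projective_variety B Y \<and> bij_betw h X Y \<and>
     variety_morphism A X B Y h \<and> variety_morphism B Y A X (inv_into X h)"

section \<open>Orthogonals and linear actions on tuples of subspaces\<close>

definition bform :: "complex mat \<Rightarrow> complex vec \<Rightarrow> complex vec \<Rightarrow> complex" where
  "bform G v w = v \<bullet> (G *\<^sub>v w)"

definition perp :: "complex mat \<Rightarrow> complex vec set \<Rightarrow> complex vec set" where
  "perp G U = {v \<in> carrier_vec (dim_row G). \<forall>u\<in>U. bform G v u = 0}"

definition iota :: "nat \<Rightarrow> complex mat \<Rightarrow> subspaces \<Rightarrow> subspaces" where
  "iota n G x = (\<lambda>i\<in>{1..n}. perp G (x (n + 1 - i)))"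

definition act :: "nat \<Rightarrow> (nat \<Rightarrow> complex mat) \<Rightarrow> subspaces \<Rightarrow> subspaces" where
  "act n M x = (\<lambda>i\<in>{1..n}. (\<lambda>v. M i *\<^sub>v v) ` x i)"

section \<open>The degenerate symplectic flag variety\<close>

text \<open>Here \<open>n = 2 * m - 1\<close>, so \<open>V\<close> has dimension \<open>2 * m = n + 1\<close>.\<close>

definition ambV :: "nat \<Rightarrow> gr_product" where
  "ambV n = \<lparr>factors = n, subdim = (\<lambda>i. i), vdim = n + 1\<rparr>"

definition pr :: "nat \<Rightarrow> complex vec \<Rightarrow> complex vec" where
  "pr k v = vec (dim_vec v) (\<lambda>j. if j = k - 1 then 0 else v $ j)"

definition deg_flags :: "nat \<Rightarrow> subspaces set" where
  "deg_flags n = {x \<in> points (ambV n). \<forall>i\<in>{1..n - 1}. pr i ` x i \<subseteq> x (i + 1)}"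

definition bV_one :: "nat \<Rightarrow> nat \<Rightarrow> nat \<Rightarrow> bool" where
  "bV_one m k l \<longleftrightarrow> k \<in> {1..m - 1} \<and> l = 2 * m - 1 - k \<or> k = 2 * m - 1 \<and> l = 2 * m"

definition gramV :: "nat \<Rightarrow> complex mat" where
  "gramV m = mat (2 * m) (2 * m) (\<lambda>(i, j).
     if bV_one m (i + 1) (j + 1) then 1 else if bV_one m (j + 1) (i + 1) then - 1 else 0)"

definition SpFl :: "nat \<Rightarrow> subspaces set" where
  "SpFl m = {x \<in> deg_flags (2 * m - 1). iota (2 * m - 1) (gramV m) x = x}"

section \<open>Groups and Schubert varieties\<close>

definition J_mat :: "nat \<Rightarrow> complex mat" where
  "J_mat n = mat n n (\<lambda>(i, j). if i + j = n - 1 then 1 else 0)"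

definition E_mat :: "nat \<Rightarrow> complex mat" where
  "E_mat n = four_block_mat (0\<^sub>m n n) (J_mat n) (- J_mat n) (0\<^sub>m n n)"

abbreviation minv :: "complex mat \<Rightarrow> complex mat" where
  "minv A \<equiv> the (mat_inverse A)"

definition SL :: "nat \<Rightarrow> complex mat set" where
  "SL N = {A \<in> carrier_mat N N. det A = 1}"

definition iota_SL :: "nat \<Rightarrow> complex mat \<Rightarrow> complex mat" where
  "iota_SL n A = E_mat n * minv (transpose_mat A) * minv (E_mat n)"

definition Sp :: "nat \<Rightarrow> complex mat set" where
  "Sp n = {A \<in> SL (2 * n). iota_SL n A = A}"

definition borel_SL :: "nat \<Rightarrow> complex mat set" where
  "borel_SL n = {A \<in> SL (2 * n). upper_triangular A}"

definition torus_SL :: "nat \<Rightarrow> complex mat set" where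
  "torus_SL n = {A \<in> SL (2 * n). diagonal_mat A}"

definition torus_Sp :: "nat \<Rightarrow> complex mat set" where
  "torus_Sp n = torus_SL n \<inter> Sp n"

definition ambW :: "nat \<Rightarrow> gr_product" where
  "ambW n = \<lparr>factors = n, subdim = (\<lambda>i. 2 * i - 1), vdim = 2 * n\<rparr>"

definition SL_mod_P :: "nat \<Rightarrow> subspaces set" where
  "SL_mod_P n = {x \<in> points (ambW n). \<forall>i\<in>{1..n - 1}. x i \<subseteq> x (i + 1)}"

definition coord_flag :: "nat \<Rightarrow> (nat \<Rightarrow> nat) \<Rightarrow> subspaces" where
  "coord_flag n \<sigma> = (\<lambda>i\<in>{1..n}. LinearCombinations.module.span class_ring
     (module_vec TYPE(complex) (2 * n)) {unit_vec (2 * n) (\<sigma> j - 1) | j. j \<in> {1..2 * i - 1}})"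

text \<open>The stabilizer of the weight \<open>\<omega>\<^sub>1 + \<omega>\<^sub>3 + \<dots> + \<omega>\<^sub>2\<^sub>n\<^sub>-\<^sub>1\<close> in \<open>SL\<close> is the stabilizer of its
  highest weight line, spanned by the tensor product of the \<open>e\<^sub>1 \<and> \<dots> \<and> e\<^sub>2\<^sub>i\<^sub>-\<^sub>1\<close>, that is,
  of the standard flag.\<close>

definition P_SL :: "nat \<Rightarrow> complex mat set" where
  "P_SL n = {A \<in> SL (2 * n). act n (\<lambda>_. A) (coord_flag n id) = coord_flag n id}"

definition Q_Sp :: "nat \<Rightarrow> complex mat set" where
  "Q_Sp n = P_SL n \<inter> Sp n"

text \<open>\<open>Sp/Q\<close> is embedded in \<open>SL/P\<close> as the orbit of the standard flag; cf. \<open>Sp_mod_Q_coset\<close>.\<close>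

definition Sp_mod_Q :: "nat \<Rightarrow> subspaces set" where
  "Sp_mod_Q n = (\<lambda>A. act n (\<lambda>_. A) (coord_flag n id)) ` Sp n"

lemma minv_eq:
  assumes "A \<in> carrier_mat N N" "X \<in> carrier_mat N N" "A * X = 1\<^sub>m N"
  shows "minv A = X"
proof -
  have XA: "X * A = 1\<^sub>m N" using assms mat_mult_left_right_inverse by blast
  have "A \<in> Units (ring_mat TYPE(complex) N ())"
    unfolding Units_def ring_mat_def using assms XA
    by (simp only: monoid.simps partial_object.simps mem_Collect_eq) blast
  then obtain B where B: "mat_inverse A = Some B"
    using mat_inverse(1)[OF assms(1), of "()"] by (cases "mat_inverse A") auto
  have AB: "A * B = 1\<^sub>m N" and cB: "B \<in> carrier_mat N N" using mat_inverse(2)[OF assms(1) B] by auto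
  have "B = (X * A) * B" unfolding XA using cB by simp
  also have "\<dots> = X * (A * B)" by (rule assoc_mult_mat[OF assms(2,1) cB])
  also have "\<dots> = X" unfolding AB using assms(2) by simp
  finally show ?thesis using B by simp
qed

lemma E_mat_carrier: "E_mat n \<in> carrier_mat (2 * n) (2 * n)"
  by (rule carrier_matI) (simp_all add: E_mat_def J_mat_def)

lemma J_mat_square: "J_mat n * J_mat n = 1\<^sub>m n"
proof (rule eq_matI)
  fix i j assume ij: "i < dim_row (1\<^sub>m n :: complex mat)" "j < dim_col (1\<^sub>m n :: complex mat)"
  then have "(J_mat n * J_mat n) $$ (i, j) =
      (\<Sum>k\<in>{0..<n}. (if i + k = n - 1 then 1 else 0) * (if k + j = n - 1 then 1 else 0))"
    by (simp add: J_mat_def scalar_prod_def)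
  also have "\<dots> = (\<Sum>k\<in>{0..<n}. if k = n - 1 - i then (if i = j then 1 else 0) else 0)"
  proof (rule sum.cong[OF refl])
    fix k assume k: "k \<in> {0..<n}"
    have "i + k = n - 1 \<longleftrightarrow> k = n - 1 - i" "i + k = n - 1 \<Longrightarrow> k + j = n - 1 \<longleftrightarrow> i = j"
      using ij k by simp_all arith+
    then show "(if i + k = n - 1 then 1 else 0) * (if k + j = n - 1 then 1 else 0 :: complex) =
      (if k = n - 1 - i then (if i = j then 1 else 0) else 0)" by simp
  qed
  also have "\<dots> = 1\<^sub>m n $$ (i, j)"
    using ij by (simp only: sum.delta finite_atLeastLessThan) simp
  finally show "(J_mat n * J_mat n) $$ (i, j) = 1\<^sub>m n $$ (i, j)" .
qed (auto simp: J_mat_def)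

lemma E_mat_inverse: "E_mat n * (- E_mat n) = 1\<^sub>m (2 * n)"
proof -
  have J: "J_mat n \<in> carrier_mat n n" by (simp add: J_mat_def)
  have neg: "- E_mat n = four_block_mat (0\<^sub>m n n) (- J_mat n) (J_mat n) (0\<^sub>m n n)"
    using J unfolding E_mat_def by (intro eq_matI) auto
  have "E_mat n * (- E_mat n) = four_block_mat (1\<^sub>m n) (- 0\<^sub>m n n) (0\<^sub>m n n) (1\<^sub>m n)"
    unfolding neg unfolding E_mat_def
    using J by (subst mult_four_block_mat) (auto simp: J_mat_square)
  also have "\<dots> = 1\<^sub>m (2 * n)" by (rule eq_matI) auto
  finally show ?thesis .
qed

lemma SL_inverse:
  assumes "A \<in> SL N"
  obtains X where "X \<in> carrier_mat N N" "A * X = 1\<^sub>m N"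
proof
  have A: "A \<in> carrier_mat N N" and d: "det A = 1" using assms by (auto simp: SL_def)
  show "adj_mat A \<in> carrier_mat N N" by (rule adj_mat(1)[OF A])
  have "A * adj_mat A = 1 \<cdot>\<^sub>m 1\<^sub>m N" using adj_mat(2)[OF A] d by simp
  also have "\<dots> = 1\<^sub>m N" by (rule eq_matI) auto
  finally show "A * adj_mat A = 1\<^sub>m N" .
qed

lemma Sp_iff: "A \<in> Sp n \<longleftrightarrow> A \<in> SL (2 * n) \<and> A * E_mat n * transpose_mat A = E_mat n"
proof (cases "A \<in> SL (2 * n)")
  case True
  let ?N = "2 * n" and ?E = "E_mat n"
  have A: "A \<in> carrier_mat ?N ?N" using True by (auto simp: SL_def)
  obtain X where X: "X \<in> carrier_mat ?N ?N" "A * X = 1\<^sub>m ?N" using SL_inverse[OF True] .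
  have XA: "X * A = 1\<^sub>m ?N" using A X mat_mult_left_right_inverse by blast
  note E = E_mat_carrier[of n]
  have TX: "transpose_mat A * transpose_mat X = 1\<^sub>m ?N" "transpose_mat X * transpose_mat A = 1\<^sub>m ?N"
    unfolding transpose_mult[OF X(1) A, symmetric] transpose_mult[OF A X(1), symmetric] XA X(2)
    by simp_all
  have mE: "minv ?E = - ?E" using E E_mat_inverse by (intro minv_eq) auto
  have EE: "(- ?E) * ?E = 1\<^sub>m ?N" using E E_mat_inverse mat_mult_left_right_inverse[of ?E ?N "- ?E"] by auto
  have mT: "minv (transpose_mat A) = transpose_mat X" using A X TX by (intro minv_eq) auto
  have *: "iota_SL n A = ?E * transpose_mat X * (- ?E)" by (simp add: iota_SL_def mE mT)
  have "iota_SL n A = A \<longleftrightarrow> ?E * transpose_mat X = A * ?E"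
  proof
    assume "iota_SL n A = A"
    then have "A * ?E = ?E * transpose_mat X * (- ?E) * ?E" using * by simp
    also have "\<dots> = ?E * transpose_mat X * ((- ?E) * ?E)"
      using E X by (intro assoc_mult_mat) auto
    finally show "?E * transpose_mat X = A * ?E" using EE E X by simp
  next
    assume "?E * transpose_mat X = A * ?E"
    then have "iota_SL n A = A * ?E * (- ?E)" using * by simp
    also have "\<dots> = A * (?E * (- ?E))" using E A by (intro assoc_mult_mat) auto
    finally show "iota_SL n A = A" using E_mat_inverse A by simp
  qed
  also have "\<dots> \<longleftrightarrow> A * ?E * transpose_mat A = ?E"
  proof
    assume "?E * transpose_mat X = A * ?E"
    then have "A * ?E * transpose_mat A = ?E * transpose_mat X * transpose_mat A" by simp
    also have "\<dots> = ?E * (transpose_mat X * transpose_mat A)"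
      using E A X by (intro assoc_mult_mat) auto
    finally show "A * ?E * transpose_mat A = ?E" using TX E by simp
  next
    assume "A * ?E * transpose_mat A = ?E"
    then have "?E * transpose_mat X = A * ?E * transpose_mat A * transpose_mat X" by simp
    also have "\<dots> = A * ?E * (transpose_mat A * transpose_mat X)"
      using E A X by (intro assoc_mult_mat) auto
    finally show "?E * transpose_mat X = A * ?E" using TX E A by simp
  qed
  finally show ?thesis using True by (simp add: Sp_def)
qed (simp add: Sp_def)

lemma Sp_carrier: "A \<in> Sp n \<Longrightarrow> A \<in> carrier_mat (2 * n) (2 * n)"
  by (simp add: Sp_def SL_def)

lemma Sp_mult:
  assumes "A \<in> Sp n" "B \<in> Sp n" shows "A * B \<in> Sp n"
proof -
  let ?N = "2 * n" and ?E = "E_mat n"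
  note c = Sp_carrier[OF assms(1)] Sp_carrier[OF assms(2)] E_mat_carrier[of n]
  have "A * B * ?E * transpose_mat (A * B) = A * (B * ?E * transpose_mat B) * transpose_mat A"
    using c by (simp add: transpose_mult[of A ?N ?N B ?N] assoc_mult_mat[of _ ?N ?N _ ?N _ ?N])
  then show ?thesis using assms c by (auto simp: Sp_iff SL_def det_mult)
qed

lemma Sp_inverse:
  assumes "A \<in> Sp n"
  obtains X where "X \<in> Sp n" "A * X = 1\<^sub>m (2 * n)" "X * A = 1\<^sub>m (2 * n)"
proof -
  let ?N = "2 * n" and ?E = "E_mat n"
  have A: "A \<in> carrier_mat ?N ?N" and d: "det A = 1" using assms by (auto simp: Sp_def SL_def)
  obtain X where X: "X \<in> carrier_mat ?N ?N" "A * X = 1\<^sub>m ?N"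
    using SL_inverse[of A ?N] A d by (auto simp: SL_def)
  have XA: "X * A = 1\<^sub>m ?N" using A X mat_mult_left_right_inverse by blast
  have "det X = 1" using det_mult[OF A X(1)] X d by simp
  note c = A X(1) E_mat_carrier[of n]
  have TX: "transpose_mat A * transpose_mat X = 1\<^sub>m ?N"
    unfolding transpose_mult[OF X(1) A, symmetric] XA by simp
  have "X * ?E * transpose_mat X = X * (A * ?E * transpose_mat A) * transpose_mat X"
    using assms by (simp add: Sp_iff)
  also have "\<dots> = (X * A) * ?E * (transpose_mat A * transpose_mat X)"
    using c by (simp add: assoc_mult_mat[of _ ?N ?N _ ?N _ ?N])
  also have "\<dots> = ?E" using XA TX c by simp
  finally have "X \<in> Sp n" using X \<open>det X = 1\<close> by (simp add: Sp_iff SL_def)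
  with X XA that show thesis by blast
qed

lemma coord_flag_carrier:
  assumes "i \<in> {1..n}"
  shows "coord_flag n \<sigma> i \<subseteq> carrier_vec (2 * n)"
proof
  fix v assume "v \<in> coord_flag n \<sigma> i"
  then have v: "v \<in> LinearCombinations.module.span class_ring (module_vec TYPE(complex) (2 * n))
      {unit_vec (2 * n) (\<sigma> j - 1) | j. j \<in> {1..2 * i - 1}}"
    using assms by (simp add: coord_flag_def)
  interpret vec_space "TYPE(complex)" "2 * n" .
  show "v \<in> carrier_vec (2 * n)" by (rule span_closed[OF _ v]) auto
qed

lemma act_mult:
  assumes "A \<in> carrier_mat N N" "B \<in> carrier_mat N N" "\<And>i. i \<in> {1..n} \<Longrightarrow> x i \<subseteq> carrier_vec N"
  shows "act n (\<lambda>_. A) (act n (\<lambda>_. B) x) = act n (\<lambda>_. A * B) x"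
  unfolding act_def
proof (rule restrict_ext)
  fix i assume i: "i \<in> {1..n}"
  have "(A * B) *\<^sub>v v = A *\<^sub>v (B *\<^sub>v v)" if "v \<in> x i" for v
    using assms i that by (intro assoc_mult_mat_vec) auto
  then show "(\<lambda>v. A *\<^sub>v v) ` (\<lambda>i\<in>{1..n}. (\<lambda>v. B *\<^sub>v v) ` x i) i = (\<lambda>v. (A * B) *\<^sub>v v) ` x i"
    using i by (simp add: image_image)
qed

lemma act_one: "act n (\<lambda>_. 1\<^sub>m (2 * n)) (coord_flag n \<sigma>) = coord_flag n \<sigma>"
proof
  fix i
  show "act n (\<lambda>_. 1\<^sub>m (2 * n)) (coord_flag n \<sigma>) i = coord_flag n \<sigma> i"
  proof (cases "i \<in> {1..n}")
    case True
    have "(\<lambda>v. 1\<^sub>m (2 * n) *\<^sub>v v) ` coord_flag n \<sigma> i = id ` coord_flag n \<sigma> i"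
      using coord_flag_carrier[OF True] by (intro image_cong) (auto simp: subset_iff)
    with True show ?thesis by (simp add: act_def)
  next
    case False
    then show ?thesis by (simp only: act_def coord_flag_def restrict_apply if_False)
  qed
qed

lemma Sp_mod_Q_coset:
  assumes g: "g \<in> Sp n" and h: "h \<in> Sp n"
  shows "act n (\<lambda>_. g) (coord_flag n id) = act n (\<lambda>_. h) (coord_flag n id) \<longleftrightarrow>
    (\<exists>q\<in>Q_Sp n. g = h * q)"
proof -
  let ?N = "2 * n" and ?F = "coord_flag n id"
  obtain X where X: "X \<in> Sp n" "h * X = 1\<^sub>m ?N" "X * h = 1\<^sub>m ?N" using Sp_inverse[OF h] .
  note c = Sp_carrier[OF g] Sp_carrier[OF h] Sp_carrier[OF X(1)]
  have am: "act n (\<lambda>_. A) (act n (\<lambda>_. B) ?F) = act n (\<lambda>_. A * B) ?F"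
    if "A \<in> carrier_mat ?N ?N" "B \<in> carrier_mat ?N ?N" for A B
    using that by (rule act_mult) (rule coord_flag_carrier)
  show ?thesis
  proof
    assume "act n (\<lambda>_. g) ?F = act n (\<lambda>_. h) ?F"
    then have "act n (\<lambda>_. X * g) ?F = act n (\<lambda>_. X * h) ?F"
      using am[OF c(3,1)] am[OF c(3,2)] by metis
    then have "X * g \<in> Q_Sp n"
      using Sp_mult[OF X(1) g] X(3) by (simp add: act_one Q_Sp_def P_SL_def Sp_def)
    moreover have "g = h * (X * g)"
      using c X(2) by (simp flip: assoc_mult_mat[of h ?N ?N X ?N g ?N])
    ultimately show "\<exists>q\<in>Q_Sp n. g = h * q" by blast
  next
    assume "\<exists>q\<in>Q_Sp n. g = h * q"
    then obtain q where q: "q \<in> Sp n" "act n (\<lambda>_. q) ?F = ?F" "g = h * q"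
      by (auto simp: Q_Sp_def P_SL_def)
    show "act n (\<lambda>_. g) ?F = act n (\<lambda>_. h) ?F"
      using am[OF c(2) Sp_carrier[OF q(1)]] q by simp
  qed
qed

definition schubert :: "nat \<Rightarrow> (nat \<Rightarrow> nat) \<Rightarrow> subspaces set" where
  "schubert n \<sigma> = Abstract_Topology.closure_of (subtopology (zariski (ambW n)) (SL_mod_P n))
     ((\<lambda>b. act n (\<lambda>_. b) (coord_flag n \<sigma>)) ` borel_SL n)"

definition schubert_iota :: "nat \<Rightarrow> (nat \<Rightarrow> nat) \<Rightarrow> subspaces set" where
  "schubert_iota n \<sigma> = {x \<in> schubert n \<sigma>. iota n (E_mat n) x = x}"

definition sigma :: "nat \<Rightarrow> nat \<Rightarrow> nat" where
  "sigma n j = (if j \<in> {1..2 * n} then (if even j then j div 2 else n + 1 + j div 2) else j)"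

lemma sigma_permutes: "sigma n permutes {1..2 * n}"
proof (rule inj_imp_permutes)
  show "inj_on (sigma n) {1..2 * n}"
    by (rule inj_onI) (auto simp: sigma_def split: if_splits elim!: evenE oddE)
qed (auto simp: sigma_def elim!: evenE oddE)

section \<open>Torus actions\<close>

definition torus_mat_V :: "nat \<Rightarrow> complex mat \<Rightarrow> nat \<Rightarrow> complex mat" where
  "torus_mat_V n t i = mat_diag (n + 1) (\<lambda>j. let k = j + 1; entry = (\<lambda>l. t $$ (l - 1, l - 1)) in
     if i \<le> k then entry k else entry (n + 1 + k))"

definition torus_act_V :: "nat \<Rightarrow> complex mat \<Rightarrow> subspaces \<Rightarrow> subspaces" where
  "torus_act_V n t = act n (torus_mat_V n t)"

definition torus_act_W :: "nat \<Rightarrow> complex mat \<Rightarrow> subspaces \<Rightarrow> subspaces" where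
  "torus_act_W n t = act n (\<lambda>_. t)"

end

theory Submission
  imports Defs "Jordan_Normal_Form.DL_Rank"
begin

text \<open>The factor \<open>V\<^sub>i\<close> of a degenerate flag is moved into \<open>W\<close> by sending \<open>f\<^sub>k\<close> to \<open>\<plusminus>e\<^sub>k\<close> for \<open>k \<ge> i\<close> and to
\<open>\<plusminus>e\<^sub>n\<^sub>+\<^sub>1\<^sub>+\<^sub>k\<close> for \<open>k < i\<close>: the coordinates of \<open>V\<close> become the window \<open>i, \<dots>, n + i\<close> of the coordinates of
\<open>W\<close>. Write \<open>E\<^sub>k\<close> for the span of the first \<open>k\<close> basis vectors of \<open>W\<close>, and let \<open>W\<^sub>i\<close> be the sum of \<open>E\<^sub>i\<^sub>-\<^sub>1\<close> and
the image of \<open>V\<^sub>i\<close>. Passing from window \<open>i\<close> to window \<open>i + 1\<close> drops exactly the coordinate that is killed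
by \<open>pr\<^sub>i\<close>, so the condition \<open>pr\<^sub>i V\<^sub>i \<subseteq> V\<^sub>i\<^sub>+\<^sub>1\<close> becomes the honest inclusion \<open>W\<^sub>i \<subseteq> W\<^sub>i\<^sub>+\<^sub>1\<close>, and the
degenerate flags become the flags in \<open>W\<close> with \<open>E\<^sub>i\<^sub>-\<^sub>1 \<subseteq> W\<^sub>i \<subseteq> E\<^sub>n\<^sub>+\<^sub>i\<close> (\<open>zeta_flags\<close>, \<open>zeta_inv_flags\<close>).
The windows \<open>i\<close> and \<open>n + 1 - i\<close> are dual to each other under \<open>b\<^sub>W\<close>. The signs can be chosen so that
\<open>b\<^sub>W\<close> restricts to \<open>b\<^sub>V\<close> (\<open>bform_compat\<close>); then the map commutes with the two involutions (\<open>zeta_iota\<close>).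
With all signs positive it would not as soon as \<open>m \<ge> 2\<close>.

It remains to see that these flags are the Schubert variety (\<open>schubert_eq\<close>). The condition is closed
and contains the Borel orbit of \<open>\<sigma>\<^sub>n\<close>, so the point is density. A flag lies in the orbit as soon as
\<open>W\<^sub>i \<inter> E\<^sub>n = E\<^sub>i\<^sub>-\<^sub>1\<close> for all \<open>i\<close>: lifts of the last \<open>n\<close> basis vectors are the columns of a unitriangular
matrix (\<open>big_cell\<close>). Otherwise there are a functional \<open>l\<close> and a vector \<open>c\<close> such that applying
\<open>1 + t c l\<close> to the \<open>W\<^sub>i\<close> in one interval of indices, and nothing to the others, gives for all small
\<open>t \<noteq> 0\<close> a flag of the same kind with smaller intersections with \<open>E\<^sub>n\<close> (\<open>deformation_step\<close>). By induction
that flag lies in the closure of the orbit, and the original flag is its limit for \<open>t \<rightarrow> 0\<close>, where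
a multihomogeneous polynomial in the minors of continuously varying frames is continuous
(\<open>closedin_deformation\<close>).

Regularity is checked through frames. Near each point the subspaces have bases whose entries are
quotients of Pluecker coordinates, by Cramer's rule (\<open>local_frames\<close>). Hence incidences and
orthogonality are closed conditions, and a map is a morphism if its components are, locally, column
spaces of matrices of regular functions (\<open>variety_morphismI\<close>). Both the comparison map and its inverse
are linear in the frames.

Finally, a flag fixed by the involution consists of an isotropic flag up to the Lagrangian \<open>W\<^sub>m\<close> and of
orthogonals of its members. Products of transvections move it to the standard flag
(\<open>isotropic_flag_to_standard\<close>), so it is a point of \<open>Sp/Q\<close>.\<close>

section \<open>Frames of subspaces and dimension\<close>

definition img :: "complex mat \<Rightarrow> complex vec set" where
  "img M = (\<lambda>v. M *\<^sub>v v) ` carrier_vec (dim_col M)"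

definition inj_mat :: "complex mat \<Rightarrow> bool" where
  "inj_mat M \<longleftrightarrow> (\<forall>v\<in>carrier_vec (dim_col M). M *\<^sub>v v = 0\<^sub>v (dim_row M) \<longrightarrow> v = 0\<^sub>v (dim_col M))"

definition lin_sub :: "nat \<Rightarrow> complex vec set \<Rightarrow> bool" where
  "lin_sub N U \<longleftrightarrow> U \<subseteq> carrier_vec N \<and> 0\<^sub>v N \<in> U \<and> (\<forall>u\<in>U. \<forall>v\<in>U. u + v \<in> U) \<and>
     (\<forall>c. \<forall>u\<in>U. c \<cdot>\<^sub>v u \<in> U)"

lemma lin_subI:
  assumes "U \<subseteq> carrier_vec N" "0\<^sub>v N \<in> U" "\<And>u v. u \<in> U \<Longrightarrow> v \<in> U \<Longrightarrow> u + v \<in> U"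
    "\<And>c u. u \<in> U \<Longrightarrow> c \<cdot>\<^sub>v u \<in> U"
  shows "lin_sub N U"
  using assms by (auto simp: lin_sub_def)

lemma lin_subD:
  assumes "lin_sub N U"
  shows "U \<subseteq> carrier_vec N" "0\<^sub>v N \<in> U" "u \<in> U \<Longrightarrow> v \<in> U \<Longrightarrow> u + v \<in> U"
    "u \<in> U \<Longrightarrow> c \<cdot>\<^sub>v u \<in> U"
  using assms by (auto simp: lin_sub_def)

lemma lin_sub_minus:
  assumes "lin_sub N U" "u \<in> U" "v \<in> U" shows "u - v \<in> U"
proof -
  have "u \<in> carrier_vec N" "v \<in> carrier_vec N" using assms lin_subD(1) by blast+
  then have "u - v = u + (-1) \<cdot>\<^sub>v v" by (intro eq_vecI) auto
  then show ?thesis using assms lin_subD by metis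
qed

lemma subspace_iff_lin_sub:
  "VectorSpace.subspace class_ring U (module_vec TYPE(complex) N) \<longleftrightarrow> lin_sub N U"
proof -
  interpret vec_space "TYPE(complex)" N .
  show ?thesis
    unfolding subspace_def submodule_def lin_sub_def
    using vec_vs[of N] vec_module[of N] by (auto simp: class_ring_simps)
qed

lemma img_carrier: "M \<in> carrier_mat N d \<Longrightarrow> img M \<subseteq> carrier_vec N"
  by (auto simp: img_def)

lemma lin_sub_img:
  assumes M: "M \<in> carrier_mat N d" shows "lin_sub N (img M)"
proof (rule lin_subI)
  show "img M \<subseteq> carrier_vec N" using M by (rule img_carrier)
  show "0\<^sub>v N \<in> img M" using M unfolding img_def by (intro image_eqI[of _ _ "0\<^sub>v d"]) auto
  fix u v c assume u: "u \<in> img M" 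
  then obtain x where x: "x \<in> carrier_vec d" "u = M *\<^sub>v x" using M by (auto simp: img_def)
  have "c \<cdot>\<^sub>v u = M *\<^sub>v (c \<cdot>\<^sub>v x)" using M x by (simp add: mult_mat_vec)
  then show "c \<cdot>\<^sub>v u \<in> img M" using M x unfolding img_def by (intro image_eqI[of _ _ "c \<cdot>\<^sub>v x"]) auto
  assume "v \<in> img M"
  then obtain y where y: "y \<in> carrier_vec d" "v = M *\<^sub>v y" using M by (auto simp: img_def)
  have "u + v = M *\<^sub>v (x + y)" using M x y by (simp add: mult_add_distrib_mat_vec)
  then show "u + v \<in> img M" using M x y unfolding img_def by (intro image_eqI[of _ _ "x + y"]) auto
qed

lemma col_space_img:
  assumes "M \<in> carrier_mat N d" shows "vec_space.col_space N M = img M"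
  using assms vec_space.col_space_eq[OF assms] by (auto simp: img_def image_iff)

text \<open>A maximal independent subset of the subspace, which exists because independent sets have at most \<open>N\<close> elements, is a basis; its vectors are the columns.\<close>

lemma subspace_frame:
  assumes U: "lin_sub N U"
  shows "\<exists>M \<in> carrier_mat N (vectorspace.dim class_ring ((module_vec TYPE(complex) N)\<lparr>carrier := U\<rparr>)).
    inj_mat M \<and> img M = U"
proof -
  interpret vec_space "TYPE(complex)" N .
  have sub: "VectorSpace.subspace class_ring U V" using U subspace_iff_lin_sub by simp
  have subm: "submodule class_ring U V" using sub by (simp add: subspace_def)
  let ?P = "\<lambda>S. S \<subseteq> U \<and> lin_indpt S"
  have "\<exists>B. finite B \<and> maximal B ?P"
  proof (rule maximal_exists[where ?N = "N" and ?B = "{}"])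
    fix A assume "?P A"
    then show "finite A \<and> card A \<le> N" using U li_le_dim[of A] dim_is_n by (auto simp: lin_sub_def)
  next
    show "?P {}" by (auto simp: lin_dep_def)
  qed
  then obtain B where B: "finite B" "maximal B ?P" by blast
  have BU: "B \<subseteq> U" "lin_indpt B" using B(2) by (auto simp: maximal_def)
  have BV: "B \<subseteq> carrier_vec N" using BU U by (auto simp: lin_sub_def)
  let ?W = "V\<lparr>carrier := U\<rparr>"
  interpret W: vectorspace class_ring ?W by (rule subspace_is_vs[OF sub])
  have "W.basis B"
  proof (rule W.max_li_is_basis)
    have li: "LinearCombinations.module.lin_dep class_ring ?W S \<longleftrightarrow> lin_dep S" if "S \<subseteq> U" for S
      by (rule span_li_not_depend(2)[OF that subm])
    show "maximal B (\<lambda>S. S \<subseteq> carrier ?W \<and> \<not> W.lin_dep S)"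
      using B(2) li unfolding maximal_def by auto
  qed
  then have dim: "W.dim = card B" and sp: "W.span B = U" using W.dim_basis B(1) by (auto simp: W.basis_def)
  have spU: "span B = U" using sp span_li_not_depend(1)[OF BU(1) subm] by simp
  obtain bs where bs: "distinct bs" "set bs = B" using B(1) finite_distinct_list by blast
  define M where "M = mat_of_cols N bs"
  have M: "M \<in> carrier_mat N (card B)" using bs by (auto simp: M_def distinct_card)
  have cols: "cols M = bs" using bs BV by (auto simp: M_def intro!: cols_mat_of_cols)
  have "inj_mat M" unfolding inj_mat_def using lin_depI[OF M] cols bs BU(2) M by auto
  moreover have "img M = U" using col_space_img[OF M] cols bs spU by (simp add: col_space_def)
  ultimately show ?thesis using M dim by auto
qed


lemma inj_matD: "inj_mat M \<Longrightarrow> M \<in> carrier_mat N d \<Longrightarrow> v \<in> carrier_vec d \<Longrightarrow> M *\<^sub>v v = 0\<^sub>v N \<Longrightarrow> v = 0\<^sub>v d"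
  by (auto simp: inj_mat_def)

lemma inj_matI:
  assumes "M \<in> carrier_mat N d" "\<And>v. v \<in> carrier_vec d \<Longrightarrow> M *\<^sub>v v = 0\<^sub>v N \<Longrightarrow> v = 0\<^sub>v d"
  shows "inj_mat M"
  using assms by (auto simp: inj_mat_def)

lemma imgI: "M \<in> carrier_mat N d \<Longrightarrow> v \<in> carrier_vec d \<Longrightarrow> M *\<^sub>v v \<in> img M"
  by (auto simp: img_def)

lemma imgE:
  assumes "x \<in> img M" "M \<in> carrier_mat N d"
  obtains v where "v \<in> carrier_vec d" "x = M *\<^sub>v v"
  using assms by (auto simp: img_def)

lemma mult_unit_vec:
  assumes "(M :: complex mat) \<in> carrier_mat N d" "j < d" shows "M *\<^sub>v unit_vec d j = col M j"
  using assms by (intro eq_vecI) auto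

lemma mult_zero_vec [simp]:
  assumes "(M :: complex mat) \<in> carrier_mat N d" shows "M *\<^sub>v 0\<^sub>v d = 0\<^sub>v N"
  using assms by (intro eq_vecI) auto

text \<open>More unknowns than equations: padding the matrix with zero rows makes it square and singular.\<close>

lemma kernel_nonzero:
  fixes A :: "complex mat"
  assumes A: "A \<in> carrier_mat r k" and rk: "r < k"
  shows "\<exists>v\<in>carrier_vec k. v \<noteq> 0\<^sub>v k \<and> A *\<^sub>v v = 0\<^sub>v r"
proof -
  define B where "B = mat k k (\<lambda>(i, j). if i < r then A $$ (i, j) else 0)"
  have B: "B \<in> carrier_mat k k" by (simp add: B_def)
  have "row B (k - 1) = 0\<^sub>v k" using rk by (intro eq_vecI) (auto simp: B_def)
  then have "transpose_mat B *\<^sub>v unit_vec k (k - 1) = 0\<^sub>v k"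
    using rk B mult_unit_vec[of "transpose_mat B" k k "k - 1"] by simp
  then have "det (transpose_mat B) = 0"
    using B rk det_0_iff_vec_prod_zero_field[of "transpose_mat B" k] unit_vec_carrier[of k "k - 1"]
      unit_vec_nonzero[of k "k - 1"] by fastforce
  then have "det B = 0" using det_transpose[OF B] by simp
  then obtain v where v: "v \<in> carrier_vec k" "v \<noteq> 0\<^sub>v k" "B *\<^sub>v v = 0\<^sub>v k"
    using det_0_iff_vec_prod_zero_field[OF B] by blast
  have "A *\<^sub>v v = 0\<^sub>v r"
  proof (rule eq_vecI)
    fix i assume i: "i < dim_vec (0\<^sub>v r :: complex vec)"
    then have "row B i = row A i" using rk A by (intro eq_vecI) (auto simp: B_def)
    then have "(A *\<^sub>v v) $ i = (B *\<^sub>v v) $ i" using i rk A B by simp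
    then show "(A *\<^sub>v v) $ i = 0\<^sub>v r $ i" using v(3) i rk by simp
  qed (use A in auto)
  then show ?thesis using v by blast
qed

text \<open>Over the complex numbers the Gram matrix of the columns is invertible, because the Hermitian norm of \<open>M *\<^sub>v v\<close> vanishes only if \<open>M *\<^sub>v v\<close> does.\<close>

lemma inj_left_inverse:
  assumes M: "M \<in> carrier_mat N d" and inj: "inj_mat M"
  shows "\<exists>L\<in>carrier_mat d N. L * M = 1\<^sub>m d"
proof -
  \<comment> \<open>The conjugate transpose of \<open>M\<close>.\<close>
  define H where "H = mat d N (\<lambda>(i, j). cnj (M $$ (j, i)))"
  have H: "H \<in> carrier_mat d N" by (simp add: H_def)
  have HM: "H * M \<in> carrier_mat d d" using H M by simp
  have "det (H * M) \<noteq> 0"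
  proof
    assume "det (H * M) = 0"
    then obtain v where v: "v \<in> carrier_vec d" "v \<noteq> 0\<^sub>v d" "H * M *\<^sub>v v = 0\<^sub>v d"
      using det_0_iff_vec_prod_zero_field[OF HM] by blast
    define w where "w = M *\<^sub>v v"
    have w: "w \<in> carrier_vec N" using M v by (simp add: w_def)
    have Hw: "H *\<^sub>v w = 0\<^sub>v d" using v H M by (simp add: w_def)
    have cw: "conjugate w = transpose_mat H *\<^sub>v conjugate v"
      using M v by (intro eq_vecI) (auto simp: w_def H_def scalar_prod_def)
    have "conjugate w \<bullet> w = conjugate v \<bullet> (H *\<^sub>v w)"
      unfolding cw using transpose_vec_mult_scalar[OF H w] v by simp
    then have "conjugate w \<bullet> w = 0" using Hw v by simp
    then have "w \<bullet>c w = 0" using w comm_scalar_prod[of w N "conjugate w"] by simp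
    then have "w = 0\<^sub>v N" using w conjugate_square_eq_0_vec by blast
    then show False using inj_matD[OF inj M v(1)] v(2) by (simp add: w_def)
  qed
  then obtain X where X: "X \<in> carrier_mat d d" "X * (H * M) = 1\<^sub>m d"
    using det_non_zero_imp_unit[OF HM] unfolding Units_def ring_mat_def by auto
  then show ?thesis using H M by (intro bexI[of _ "X * H"]) auto
qed

lemma cols_in_img:
  assumes M: "M \<in> carrier_mat N k" and F: "F \<in> carrier_mat N d" and c: "\<And>j. j < k \<Longrightarrow> col M j \<in> img F"
  shows "\<exists>X\<in>carrier_mat d k. M = F * X"
proof -
  have "\<forall>j. \<exists>v. j < k \<longrightarrow> v \<in> carrier_vec d \<and> col M j = F *\<^sub>v v" using imgE[OF c F] by metis
  then obtain f where f: "\<And>j. j < k \<Longrightarrow> f j \<in> carrier_vec d \<and> col M j = F *\<^sub>v f j" by metis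
  define X where "X = mat_of_cols d (map f [0..<k])"
  have X: "X \<in> carrier_mat d k" by (auto simp: X_def)
  have "M = F * X"
  proof (rule mat_col_eqI)
    fix j assume "j < dim_col (F * X)"
    then have j: "j < k" using X by simp
    have "col X j = f j" using j f by (simp add: X_def)
    then show "col M j = col (F * X) j" using f[OF j] j F X by (simp add: col_mult2)
  qed (use M F X in auto)
  then show ?thesis using X by blast
qed

lemma invertible_if_inj:
  assumes X: "(X :: complex mat) \<in> carrier_mat d d" and "\<And>v. v \<in> carrier_vec d \<Longrightarrow> X *\<^sub>v v = 0\<^sub>v d \<Longrightarrow> v = 0\<^sub>v d"
  shows "\<exists>Y\<in>carrier_mat d d. X * Y = 1\<^sub>m d \<and> Y * X = 1\<^sub>m d"
proof -
  have "det X \<noteq> 0" using det_0_iff_vec_prod_zero_field[OF X] assms(2) by blast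
  then show ?thesis using det_non_zero_imp_unit[OF X] unfolding Units_def ring_mat_def by auto
qed

text \<open>All comparisons of dimensions rest on this one: the columns of \<open>M\<close> are combinations of those of \<open>F\<close>, and the matrix of coefficients is again injective.\<close>

lemma frames_mono:
  assumes M: "M \<in> carrier_mat N k" "inj_mat M" and F: "F \<in> carrier_mat N d" and sub: "img M \<subseteq> img F"
  shows "k \<le> d" "k = d \<Longrightarrow> img M = img F"
proof -
  have "col M j \<in> img F" if "j < k" for j
  proof -
    have "col M j = M *\<^sub>v unit_vec k j" using mult_unit_vec[OF M(1) that] by simp
    then have "col M j \<in> img M" using imgI[OF M(1) unit_vec_carrier] by simp
    then show ?thesis using sub by blast
  qed
  then obtain X where X: "X \<in> carrier_mat d k" "M = F * X" using cols_in_img[OF M(1) F] by blast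
  have inj: "v = 0\<^sub>v k" if v: "v \<in> carrier_vec k" "X *\<^sub>v v = 0\<^sub>v d" for v
  proof -
    have "M *\<^sub>v v = F *\<^sub>v (X *\<^sub>v v)" using X F v by simp
    also have "\<dots> = 0\<^sub>v N" unfolding v(2) by (rule mult_zero_vec[OF F])
    finally show ?thesis using inj_matD[OF M(2,1)] v by simp
  qed
  show "k \<le> d" using kernel_nonzero[OF X(1)] inj by (meson not_le)
  assume kd: "k = d"
  have "X \<in> carrier_mat d d" using X(1) kd by simp
  then obtain Y where Y: "Y \<in> carrier_mat d d" "X * Y = 1\<^sub>m d"
    using invertible_if_inj[of X d] inj unfolding kd by blast
  have "M * Y = F * (X * Y)" unfolding X(2) using X(1) Y(1) F kd by simp
  then have FY: "F = M * Y" using Y(2) F by simp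
  show "img M = img F"
  proof
    show "img F \<subseteq> img M"
    proof
      fix x assume "x \<in> img F"
      then obtain v where v: "v \<in> carrier_vec d" "x = F *\<^sub>v v" using imgE[OF _ F] by metis
      have "x = M *\<^sub>v (Y *\<^sub>v v)" unfolding v(2) FY using v Y M kd by simp
      moreover have "Y *\<^sub>v v \<in> carrier_vec k" using Y v kd by simp
      ultimately show "x \<in> img M" using imgI[OF M(1)] by metis
    qed
  qed (rule sub)
qed

lemma Gr_img:
  assumes M: "M \<in> carrier_mat N d" "inj_mat M"
  shows "img M \<in> Gr d N"
proof -
  let ?d = "vectorspace.dim class_ring ((module_vec TYPE(complex) N)\<lparr>carrier := img M\<rparr>)"
  obtain M' where M': "M' \<in> carrier_mat N ?d" "inj_mat M'" "img M' = img M"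
    using subspace_frame[OF lin_sub_img[OF M(1)]] by blast
  have "d \<le> ?d" using frames_mono(1)[OF M M'(1)] M'(3) by simp
  moreover have "?d \<le> d" using frames_mono(1)[OF M'(1,2) M(1)] M'(3) by simp
  ultimately show ?thesis using lin_sub_img[OF M(1)] by (simp add: Gr_def subspace_iff_lin_sub)
qed

lemma Gr_lin_sub: "U \<in> Gr d N \<Longrightarrow> lin_sub N U"
  by (simp add: Gr_def subspace_iff_lin_sub)

lemma Gr_carrier: "U \<in> Gr d N \<Longrightarrow> U \<subseteq> carrier_vec N"
  using Gr_lin_sub lin_subD(1) by blast

lemma lin_sub_Gr: "lin_sub N U \<Longrightarrow> \<exists>d. U \<in> Gr d N"
  by (simp add: Gr_def subspace_iff_lin_sub)

lemma Gr_frame: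
  assumes "U \<in> Gr d N"
  obtains M where "M \<in> carrier_mat N d" "inj_mat M" "img M = U"
  using subspace_frame[OF Gr_lin_sub[OF assms]] assms that by (auto simp: Gr_def)

lemma Gr_mono:
  assumes "U \<in> Gr k N" "U' \<in> Gr d N" "U \<subseteq> U'"
  shows "k \<le> d" "k = d \<Longrightarrow> U = U'"
proof -
  obtain M where M: "M \<in> carrier_mat N k" "inj_mat M" "img M = U" using Gr_frame[OF assms(1)] .
  obtain F where F: "F \<in> carrier_mat N d" "inj_mat F" "img F = U'" using Gr_frame[OF assms(2)] .
  show "k \<le> d" "k = d \<Longrightarrow> U = U'" using frames_mono[OF M(1,2) F(1)] assms(3) M(3) F(3) by blast+
qed

lemma Gr_unique: "U \<in> Gr k N \<Longrightarrow> U \<in> Gr d N \<Longrightarrow> k = d"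
  using Gr_mono(1) by (simp add: dual_order.antisym)

lemma Gr_full: "carrier_vec N \<in> Gr N N"
proof -
  have "img (1\<^sub>m N) = carrier_vec N" by (auto simp: img_def image_iff)
  moreover have "inj_mat (1\<^sub>m N)" by (auto simp: inj_mat_def)
  ultimately show ?thesis using Gr_img[of "1\<^sub>m N" N N] by simp
qed

lemma Gr_le: "U \<in> Gr d N \<Longrightarrow> d \<le> N"
  using Gr_mono(1)[OF _ Gr_full] Gr_carrier by blast

lemma Gr_zero: "{0\<^sub>v N} \<in> Gr 0 N"
proof -
  have "0\<^sub>m N 0 *\<^sub>v x = 0\<^sub>v N" if "x \<in> carrier_vec 0" for x :: "complex vec"
    using that by (intro eq_vecI) (auto simp: scalar_prod_def)
  then have "img (0\<^sub>m N 0) = {0\<^sub>v N}" unfolding img_def by (auto simp: image_iff intro!: exI[of _ "0\<^sub>v 0"])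
  moreover have "inj_mat (0\<^sub>m N 0)" by (auto simp: inj_mat_def)
  ultimately show ?thesis using Gr_img[of "0\<^sub>m N 0" N 0] by simp
qed

text \<open>Avoids sums of vectors: the coefficients of the columns with respect to a frame of \<open>U\<close> form a matrix.\<close>

lemma img_subset:
  assumes U: "lin_sub N U" and M: "M \<in> carrier_mat N k" and c: "\<And>j. j < k \<Longrightarrow> col M j \<in> U"
  shows "img M \<subseteq> U"
proof -
  obtain F d where F: "F \<in> carrier_mat N d" "img F = U" using lin_sub_Gr[OF U] Gr_frame by blast
  obtain X where X: "X \<in> carrier_mat d k" "M = F * X" using cols_in_img[OF M F(1)] c F(2) by blast
  show ?thesis
  proof
    fix x assume "x \<in> img M"
    then obtain v where v: "v \<in> carrier_vec k" "x = M *\<^sub>v v" using imgE[OF _ M] by metis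
    have "x = F *\<^sub>v (X *\<^sub>v v)" using X F v by simp
    moreover have "X *\<^sub>v v \<in> carrier_vec d" using X v by simp
    ultimately show "x \<in> U" using imgI[OF F(1)] F(2) by metis
  qed
qed

definition join_cols :: "complex mat \<Rightarrow> complex mat \<Rightarrow> complex mat" where
  "join_cols K R = mat (dim_row K) (dim_col K + dim_col R)
     (\<lambda>(a, b). if b < dim_col K then K $$ (a, b) else R $$ (a, b - dim_col K))"

lemma join_cols_mult:
  assumes K: "K \<in> carrier_mat N k" and R: "R \<in> carrier_mat N j" and v: "v \<in> carrier_vec k" and w: "w \<in> carrier_vec j"
  shows "join_cols K R \<in> carrier_mat N (k + j)" "join_cols K R *\<^sub>v (v @\<^sub>v w) = K *\<^sub>v v + R *\<^sub>v w"
proof -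
  show c: "join_cols K R \<in> carrier_mat N (k + j)" using K R by (simp add: join_cols_def)
  have "row (join_cols K R) i = row K i @\<^sub>v row R i" if "i < N" for i
    using that K R by (intro eq_vecI) (auto simp: join_cols_def)
  then show "join_cols K R *\<^sub>v (v @\<^sub>v w) = K *\<^sub>v v + R *\<^sub>v w"
    using c K R v w by (intro eq_vecI) (auto simp: scalar_prod_append[of _ k _ j])
qed

lemma lin_sub_kernel:
  assumes "lin_sub N U" "T \<in> carrier_mat r N"
  shows "lin_sub N {u \<in> U. T *\<^sub>v u = 0\<^sub>v r}"
proof (rule lin_subI)
  note U = lin_subD[OF assms(1)]
  fix u v c assume u: "u \<in> {u \<in> U. T *\<^sub>v u = 0\<^sub>v r}"
  then have uc: "u \<in> carrier_vec N" using U by blast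
  then show "c \<cdot>\<^sub>v u \<in> {u \<in> U. T *\<^sub>v u = 0\<^sub>v r}" using u U assms(2) by (auto simp: mult_mat_vec)
  assume v: "v \<in> {u \<in> U. T *\<^sub>v u = 0\<^sub>v r}"
  then have "v \<in> carrier_vec N" using U by blast
  then show "u + v \<in> {u \<in> U. T *\<^sub>v u = 0\<^sub>v r}" using u v uc U assms(2) by (auto simp: mult_add_distrib_mat_vec)
qed (use assms lin_subD[OF assms(1)] in auto)

lemma lin_sub_image:
  assumes "lin_sub N U" "T \<in> carrier_mat r N"
  shows "lin_sub r ((\<lambda>v. T *\<^sub>v v) ` U)"
proof (rule lin_subI)
  note U = lin_subD[OF assms(1)]
  show "(\<lambda>v. T *\<^sub>v v) ` U \<subseteq> carrier_vec r" using U assms(2) by auto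
  show "0\<^sub>v r \<in> (\<lambda>v. T *\<^sub>v v) ` U" using U(2) assms(2) by (intro image_eqI[of _ _ "0\<^sub>v N"]) auto
  fix u v c assume u: "u \<in> (\<lambda>v. T *\<^sub>v v) ` U"
  then obtain x where x: "x \<in> U" "u = T *\<^sub>v x" by blast
  then have xc: "x \<in> carrier_vec N" using U by blast
  then show "c \<cdot>\<^sub>v u \<in> (\<lambda>v. T *\<^sub>v v) ` U" using x U assms(2) by (intro image_eqI[of _ _ "c \<cdot>\<^sub>v x"]) (auto simp: mult_mat_vec)
  assume "v \<in> (\<lambda>v. T *\<^sub>v v) ` U"
  then obtain y where y: "y \<in> U" "v = T *\<^sub>v y" by blast
  then have "y \<in> carrier_vec N" using U by blast
  then show "u + v \<in> (\<lambda>v. T *\<^sub>v v) ` U"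
    using x y xc U assms(2) by (intro image_eqI[of _ _ "x + y"]) (auto simp: mult_add_distrib_mat_vec)
qed

text \<open>A frame of the kernel and lifts of a frame of the image together form a frame of \<open>U\<close>.\<close>

lemma rank_nullity:
  assumes U: "U \<in> Gr d N" and T: "T \<in> carrier_mat r N"
    and K: "{u \<in> U. T *\<^sub>v u = 0\<^sub>v r} \<in> Gr k N" and I: "(\<lambda>v. T *\<^sub>v v) ` U \<in> Gr j r"
  shows "d = k + j"
proof -
  obtain F where F: "F \<in> carrier_mat N k" "inj_mat F" "img F = {u \<in> U. T *\<^sub>v u = 0\<^sub>v r}" using Gr_frame[OF K] .
  obtain R0 where R0: "R0 \<in> carrier_mat r j" "inj_mat R0" "img R0 = (\<lambda>v. T *\<^sub>v v) ` U" using Gr_frame[OF I] .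
  note Us = lin_subD[OF Gr_lin_sub[OF U]]
  have "\<exists>u\<in>U. col R0 b = T *\<^sub>v u" if "b < j" for b
  proof -
    have "col R0 b \<in> img R0" using mult_unit_vec[OF R0(1) that] imgI[OF R0(1) unit_vec_carrier] by metis
    then show ?thesis using R0(3) by blast
  qed
  then obtain f where f: "\<And>b. b < j \<Longrightarrow> f b \<in> U \<and> col R0 b = T *\<^sub>v f b" by metis
  define R where "R = mat_of_cols N (map f [0..<j])"
  have R: "R \<in> carrier_mat N j" by (auto simp: R_def)
  have colR: "col R b = f b" if "b < j" for b using that f[OF that] Us(1) by (auto simp: R_def col_mat_of_cols subset_iff)
  have TR: "T * R = R0"
  proof (rule mat_col_eqI)
    fix b assume "b < dim_col R0"
    then have b: "b < j" using R0 by simp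
    show "col (T * R) b = col R0 b" using f[OF b] colR[OF b] b T R by (simp add: col_mult2)
  qed (use T R R0 in auto)
  have RU: "img R \<subseteq> U" using img_subset[OF Gr_lin_sub[OF U] R] colR f by simp
  let ?C = "join_cols F R"
  note C = join_cols_mult[OF F(1) R]
  have Cc: "?C \<in> carrier_mat N (k + j)" using C(1)[of "0\<^sub>v k" "0\<^sub>v j"] by simp
  have TRw: "T *\<^sub>v (R *\<^sub>v w) = R0 *\<^sub>v w" if "w \<in> carrier_vec j" for w
    using that T R by (simp flip: TR)
  have FK: "F *\<^sub>v v \<in> U" "T *\<^sub>v (F *\<^sub>v v) = 0\<^sub>v r" if "v \<in> carrier_vec k" for v
    using F(3) imgI[OF F(1) that] by blast+
  have "inj_mat ?C"
  proof (rule inj_matI[OF Cc])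
    fix x assume x: "x \<in> carrier_vec (k + j)" "?C *\<^sub>v x = 0\<^sub>v N"
    obtain v w where vw: "v \<in> carrier_vec k" "w \<in> carrier_vec j" "x = v @\<^sub>v w"
      using vec_first_last_append[OF x(1)] by (metis vec_first_carrier vec_last_carrier)
    have e: "F *\<^sub>v v + R *\<^sub>v w = 0\<^sub>v N" using C(2)[OF vw(1,2)] vw(3) x(2) by simp
    then have "T *\<^sub>v (F *\<^sub>v v + R *\<^sub>v w) = 0\<^sub>v r" using T by simp
    then have "R0 *\<^sub>v w = 0\<^sub>v r"
      using FK[OF vw(1)] TRw[OF vw(2)] T F R R0 vw by (simp add: mult_add_distrib_mat_vec[of T r N])
    then have w0: "w = 0\<^sub>v j" using inj_matD[OF R0(2,1)] vw by simp
    then have "F *\<^sub>v v = 0\<^sub>v N" using e F R vw by simp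
    then have "v = 0\<^sub>v k" using inj_matD[OF F(2,1)] vw by simp
    then show "x = 0\<^sub>v (k + j)" using vw w0 by auto
  qed
  moreover have "img ?C = U"
  proof
    show "img ?C \<subseteq> U"
    proof
      fix y assume "y \<in> img ?C"
      then obtain x where x: "x \<in> carrier_vec (k + j)" "y = ?C *\<^sub>v x" using imgE[OF _ Cc] by metis
      obtain v w where vw: "v \<in> carrier_vec k" "w \<in> carrier_vec j" "x = v @\<^sub>v w"
        using vec_first_last_append[OF x(1)] by (metis vec_first_carrier vec_last_carrier)
      have "R *\<^sub>v w \<in> U" using RU imgI[OF R vw(2)] by blast
      then show "y \<in> U" using x vw C(2)[OF vw(1,2)] FK(1)[OF vw(1)] Us(3) by simp
    qed
    show "U \<subseteq> img ?C"
    proof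
      fix u assume u: "u \<in> U"
      then obtain w where w: "w \<in> carrier_vec j" "T *\<^sub>v u = R0 *\<^sub>v w"
        using R0(3) imgE[OF _ R0(1)] by (metis imageI)
      have uc: "u \<in> carrier_vec N" using u Us by blast
      have RwU: "R *\<^sub>v w \<in> U" using RU imgI[OF R w(1)] by blast
      have "T *\<^sub>v (u - R *\<^sub>v w) = T *\<^sub>v u - T *\<^sub>v (R *\<^sub>v w)"
        using T uc R w by (intro mult_minus_distrib_mat_vec) auto
      also have "\<dots> = 0\<^sub>v r" using TRw[OF w(1)] w(2) R0 w(1) by auto
      finally have "u - R *\<^sub>v w \<in> img F" using F(3) lin_sub_minus[OF Gr_lin_sub[OF U] u RwU] by auto
      then obtain v where v: "v \<in> carrier_vec k" "u - R *\<^sub>v w = F *\<^sub>v v" using imgE[OF _ F(1)] by metis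
      have "u = F *\<^sub>v v + R *\<^sub>v w" using v(2)[symmetric] uc R w by (intro eq_vecI) auto
      then have "u = ?C *\<^sub>v (v @\<^sub>v w)" using C(2)[OF v(1) w(1)] by simp
      then show "u \<in> img ?C" using imgI[OF Cc, of "v @\<^sub>v w"] v w by simp
    qed
  qed
  ultimately have "U \<in> Gr (k + j) N" using Gr_img[OF Cc] by simp
  then show ?thesis using Gr_unique[OF U] by simp
qed

lemma Gr_inj_image:
  assumes U: "U \<in> Gr d N" and T: "T \<in> carrier_mat r N" and inj: "\<And>u. u \<in> U \<Longrightarrow> T *\<^sub>v u = 0\<^sub>v r \<Longrightarrow> u = 0\<^sub>v N"
  shows "(\<lambda>v. T *\<^sub>v v) ` U \<in> Gr d r"
proof -
  have "{u \<in> U. T *\<^sub>v u = 0\<^sub>v r} = {0\<^sub>v N}"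
    using inj lin_subD(2)[OF Gr_lin_sub[OF U]] mult_zero_vec[OF T] by blast
  then have K: "{u \<in> U. T *\<^sub>v u = 0\<^sub>v r} \<in> Gr 0 N" using Gr_zero by simp
  obtain j where j: "(\<lambda>v. T *\<^sub>v v) ` U \<in> Gr j r"
    using lin_sub_Gr[OF lin_sub_image[OF Gr_lin_sub[OF U] T]] by blast
  show ?thesis using rank_nullity[OF U T K j] j by simp
qed

text \<open>Append \<open>e\<close> to a frame of \<open>S\<close>; the last row of a left inverse is the functional.\<close>

lemma separating_functional:
  assumes S: "lin_sub N S" and e: "e \<in> carrier_vec N" "e \<notin> S"
  shows "\<exists>l\<in>carrier_vec N. l \<bullet> e = 1 \<and> (\<forall>s\<in>S. l \<bullet> s = 0)"
proof -
  obtain k F where F: "F \<in> carrier_mat N k" "inj_mat F" "img F = S" using lin_sub_Gr[OF S] Gr_frame by blast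
  define R where "R = mat_of_cols N [e]"
  have R: "R \<in> carrier_mat N 1" by (auto simp: R_def)
  have Rw: "R *\<^sub>v w = w $ 0 \<cdot>\<^sub>v e" if "w \<in> carrier_vec 1" for w
    using that e by (intro eq_vecI) (auto simp: R_def mat_of_cols_def scalar_prod_def)
  let ?C = "join_cols F R"
  note C = join_cols_mult[OF F(1) R]
  have Cc: "?C \<in> carrier_mat N (k + 1)" using C(1)[of "0\<^sub>v k" "0\<^sub>v 1"] by simp
  have "inj_mat ?C"
  proof (rule inj_matI[OF Cc])
    fix x assume x: "x \<in> carrier_vec (k + 1)" "?C *\<^sub>v x = 0\<^sub>v N"
    obtain v w where vw: "v \<in> carrier_vec k" "w \<in> carrier_vec 1" "x = v @\<^sub>v w"
      using vec_first_last_append[OF x(1)] by (metis vec_first_carrier vec_last_carrier)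
    have eq: "F *\<^sub>v v + w $ 0 \<cdot>\<^sub>v e = 0\<^sub>v N" using C(2)[OF vw(1,2)] vw(3) x(2) Rw[OF vw(2)] by simp
    have FS: "F *\<^sub>v v \<in> S" using imgI[OF F(1) vw(1)] F(3) by simp
    have w0: "w $ 0 = 0"
    proof (rule ccontr)
      assume nz: "w $ 0 \<noteq> 0"
      have "e = (- 1 / w $ 0) \<cdot>\<^sub>v (F *\<^sub>v v)"
      proof (rule eq_vecI)
        fix i assume "i < dim_vec ((- 1 / w $ 0) \<cdot>\<^sub>v (F *\<^sub>v v))"
        then have i: "i < N" using F by simp
        then have "(F *\<^sub>v v + w $ 0 \<cdot>\<^sub>v e) $ i = 0" using eq by simp
        then have "(F *\<^sub>v v) $ i + w $ 0 * e $ i = 0" using i e F by simp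
        then show "e $ i = ((- 1 / w $ 0) \<cdot>\<^sub>v (F *\<^sub>v v)) $ i"
          using i e F nz by (simp add: field_simps add_eq_0_iff2)
      qed (use e F in auto)
      then show False using FS lin_subD(4)[OF S FS] e by metis
    qed
    then have "F *\<^sub>v v = 0\<^sub>v N" using eq F e vw by (auto simp: vec_eq_iff)
    then have "v = 0\<^sub>v k" using inj_matD[OF F(2,1)] vw by simp
    then show "x = 0\<^sub>v (k + 1)" using vw w0 by auto
  qed
  then obtain L where L: "L \<in> carrier_mat (k + 1) N" "L * ?C = 1\<^sub>m (k + 1)" using inj_left_inverse[OF Cc] by blast
  have LC: "L *\<^sub>v (F *\<^sub>v v + R *\<^sub>v w) = v @\<^sub>v w" if "v \<in> carrier_vec k" "w \<in> carrier_vec 1" for v w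
  proof -
    have vw: "v @\<^sub>v w \<in> carrier_vec (k + 1)" using that by (rule append_carrier_vec)
    have "L *\<^sub>v (?C *\<^sub>v (v @\<^sub>v w)) = (L * ?C) *\<^sub>v (v @\<^sub>v w)"
      by (rule assoc_mult_mat_vec[OF L(1) Cc vw, symmetric])
    also have "\<dots> = v @\<^sub>v w" unfolding L(2) by (rule one_mult_mat_vec[OF vw])
    finally show ?thesis unfolding C(2)[OF that] .
  qed
  define l where "l = row L k"
  have l: "l \<in> carrier_vec N" using L by (auto simp: l_def)
  have lv: "l \<bullet> (F *\<^sub>v v + R *\<^sub>v w) = w $ 0" if "v \<in> carrier_vec k" "w \<in> carrier_vec 1" for v w
  proof -
    have "l \<bullet> (F *\<^sub>v v + R *\<^sub>v w) = (L *\<^sub>v (F *\<^sub>v v + R *\<^sub>v w)) $ k" using L by (simp add: l_def)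
    then show ?thesis using LC[OF that] that by simp
  qed
  have "l \<bullet> e = 1"
    using lv[of "0\<^sub>v k" "vec 1 (\<lambda>_. 1)"] Rw[of "vec 1 (\<lambda>_. 1)"] e F by simp
  moreover have "l \<bullet> s = 0" if "s \<in> S" for s
  proof -
    have "s \<in> img F" using that F(3) by simp
    then obtain v where v: "v \<in> carrier_vec k" "s = F *\<^sub>v v" by (rule imgE[OF _ F(1)])
    have "F *\<^sub>v v + R *\<^sub>v 0\<^sub>v 1 = s"
      unfolding mult_zero_vec[OF R] v(2) by (rule right_zero_vec[OF mult_mat_vec_carrier[OF F(1) v(1)]])
    moreover have "(0\<^sub>v 1 :: complex vec) $ 0 = 0" by simp
    ultimately show ?thesis using lv[OF v(1) zero_carrier_vec] by metis
  qed
  ultimately show ?thesis using l by blast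
qed

section \<open>Minors of frames\<close>

text \<open>The rows \<open>f 0, \<dots>, f (d - 1)\<close>, in this order and possibly with repetitions, as needed for Cramer's rule. The submatrices in Pluecker coordinates have their rows in increasing order.\<close>

definition rowsel :: "nat \<Rightarrow> (nat \<Rightarrow> nat) \<Rightarrow> complex mat \<Rightarrow> complex mat" where
  "rowsel d f M = mat d d (\<lambda>(a, b). M $$ (f a, b))"

definition minor :: "complex mat \<Rightarrow> nat set \<Rightarrow> complex" where
  "minor M J = det (submatrix M J UNIV)"

lemma rowsel_carrier [simp]: "rowsel d f M \<in> carrier_mat d d"
  by (simp add: rowsel_def)

lemma pick_bij:
  assumes "finite J" shows "bij_betw (pick J) {0..<card J} J"
proof -
  have inj: "inj_on (pick J) {0..<card J}"
    by (intro linorder_inj_onI) (auto dest: pick_mono_le)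
  have "pick J ` {0..<card J} \<subseteq> J" using pick_in_set_le by auto
  then have "pick J ` {0..<card J} = J" using card_image[OF inj] assms by (intro card_subset_eq) auto
  then show ?thesis using inj by (simp add: bij_betw_def)
qed

lemma submatrix_rowsel:
  assumes M: "M \<in> carrier_mat N d" and J: "J \<subseteq> {..<N}" "card J = d"
  shows "submatrix M J UNIV = rowsel d (pick J) M"
proof -
  have "{i. i < N \<and> i \<in> J} = J" using J by auto
  then show ?thesis using M J by (auto simp: submatrix_def rowsel_def pick_UNIV)
qed

lemma minor_rowsel:
  assumes "M \<in> carrier_mat N d" "J \<subseteq> {..<N}" "card J = d"
  shows "minor M J = det (rowsel d (pick J) M)"
  using submatrix_rowsel[OF assms] by (simp add: minor_def)

lemma rowsel_mult:
  assumes F: "F \<in> carrier_mat N d" and X: "X \<in> carrier_mat d d" and f: "\<And>a. a < d \<Longrightarrow> f a < N"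
  shows "rowsel d f (F * X) = rowsel d f F * X"
proof (rule eq_matI)
  fix i j assume "i < dim_row (rowsel d f F * X)" "j < dim_col (rowsel d f F * X)"
  then have ij: "i < d" "j < d" using X by (auto simp: rowsel_def)
  have "row (rowsel d f F) i = row F (f i)"
    using ij f[OF ij(1)] F by (intro eq_vecI) (auto simp: rowsel_def)
  then show "rowsel d f (F * X) $$ (i, j) = (rowsel d f F * X) $$ (i, j)"
    using ij f[OF ij(1)] F X by (simp add: rowsel_def)
qed (use X in \<open>auto simp: rowsel_def\<close>)

lemma pick_less:
  assumes "J \<subseteq> {..<N}" "card J = d" "a < d" shows "pick J a < N"
  using assms pick_in_set_le[of a J] by auto

lemma minor_mult:
  assumes F: "F \<in> carrier_mat N d" and X: "X \<in> carrier_mat d d" and J: "J \<subseteq> {..<N}" "card J = d"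
  shows "minor (F * X) J = det X * minor F J"
proof -
  have FX: "F * X \<in> carrier_mat N d" using F X by simp
  have "rowsel d (pick J) (F * X) = rowsel d (pick J) F * X"
    using rowsel_mult[OF F X] pick_less[OF J] by blast
  then show ?thesis
    unfolding minor_rowsel[OF F J] minor_rowsel[OF FX J] using det_mult[OF rowsel_carrier X] by simp
qed

text \<open>Repeated rows give \<open>0\<close>, and sorting distinct rows costs a sign. What matters is that \<open>s\<close> and \<open>J\<close> depend on \<open>f\<close> alone, so that the determinant is one Pluecker coordinate up to a constant.\<close>

lemma rowsel_minor:
  assumes f: "\<And>a. a < d \<Longrightarrow> f a < N" and dN: "d \<le> N"
  shows "\<exists>s J. J \<subseteq> {..<N} \<and> card J = d \<and> (\<forall>M\<in>carrier_mat N d. det (rowsel d f M) = s * minor M J)"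
proof (cases "inj_on f {0..<d}")
  case False
  then obtain a b where ab: "a < d" "b < d" "a \<noteq> b" "f a = f b" by (auto simp: inj_on_def)
  have "det (rowsel d f M) = 0 * minor M {..<d}" for M
  proof -
    have "row (rowsel d f M) a = row (rowsel d f M) b" using ab by (intro eq_vecI) (auto simp: rowsel_def)
    then show ?thesis using det_identical_rows[OF rowsel_carrier ab(3,1,2)] by simp
  qed
  then show ?thesis using dN by (intro exI[of _ 0] exI[of _ "{..<d}"]) auto
next
  case True
  define J where "J = f ` {0..<d}"
  have J: "J \<subseteq> {..<N}" "card J = d" "finite J" using f card_image[OF True] by (auto simp: J_def)
  \<comment> \<open>The permutation that sorts the rows; \<open>pick J\<close> lists \<open>J\<close> increasingly.\<close>
  define p where "p a = (if a < d then card {b \<in> J. b < f a} else a)" for a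
  have pick_p: "pick J (p a) = f a" "p a < d" if "a < d" for a
  proof -
    have fJ: "f a \<in> J" using that by (auto simp: J_def)
    then show "pick J (p a) = f a" using that pick_card_in_set by (simp add: p_def)
    have "{b \<in> J. b < f a} \<subset> J" using fJ by auto
    then show "p a < d" using that J psubset_card_mono[of J] by (auto simp: p_def)
  qed
  have "inj_on p {0..<d}"
    using pick_p True by (metis (no_types, lifting) atLeastLessThan_iff inj_on_def)
  then have p: "p permutes {0..<d}"
    using pick_p(2) by (intro inj_imp_permutes) (auto simp: p_def)
  have "det (rowsel d f M) = signof p * minor M J" if M: "M \<in> carrier_mat N d" for M
  proof -
    have "mat d d (\<lambda>(i, j). rowsel d (pick J) M $$ (p i, j)) = rowsel d f M"
      using pick_p by (intro eq_matI) (auto simp: rowsel_def)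
    then show ?thesis
      using det_permute_rows[OF rowsel_carrier p, of "pick J" M] minor_rowsel[OF M J(1,2)] by simp
  qed
  then show ?thesis using J by blast
qed

text \<open>Expanding \<open>det (L * M)\<close> multilinearly in the rows of \<open>L * M\<close>, which are combinations of the rows of \<open>M\<close>, writes it as a combination of the determinants \<open>det (rowsel d f M)\<close>.\<close>

lemma nonzero_rowsel:
  assumes L: "L \<in> carrier_mat d N" and M: "M \<in> carrier_mat N d" and LM: "det (L * M) \<noteq> 0"
  shows "\<exists>f. (\<forall>a<d. f a < N) \<and> det (rowsel d f M) \<noteq> 0"
proof (rule ccontr)
  assume neg: "\<not> ?thesis"
  have Mc: "row M k \<in> carrier_vec d" for k using M by (auto simp: row_def)
  have "det (L * M) = (\<Sum>f\<in>{f. (\<forall>i\<in>{0..<d}. f i \<in> {0..<N}) \<and> (\<forall>i. i \<notin> {0..<d} \<longrightarrow> f i = i)}.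
      det (mat\<^sub>r d d (\<lambda>i. L $$ (i, f i) \<cdot>\<^sub>v row M (f i))))"
    unfolding mat_mul_finsum_alt[OF L M]
    by (rule det_linear_rows_sum) (use Mc in auto)
  also have "\<dots> = 0"
  proof (rule sum.neutral, intro ballI)
    fix f assume "f \<in> {f. (\<forall>i\<in>{0..<d}. f i \<in> {0..<N}) \<and> (\<forall>i. i \<notin> {0..<d} \<longrightarrow> f i = i)}"
    then have f: "\<forall>a<d. f a < N" by auto
    have "mat\<^sub>r d d (\<lambda>i. row M (f i)) = rowsel d f M"
      using f M by (intro eq_matI) (auto simp: rowsel_def)
    then have "det (mat\<^sub>r d d (\<lambda>i. row M (f i))) = 0" using neg f by auto
    then show "det (mat\<^sub>r d d (\<lambda>i. L $$ (i, f i) \<cdot>\<^sub>v row M (f i))) = 0"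
      using det_rows_mul[of "\<lambda>i. row M (f i)" d "\<lambda>i. L $$ (i, f i)"] Mc by auto
  qed
  finally show False using LM by simp
qed

lemma nonzero_minor:
  assumes M: "M \<in> carrier_mat N d" "inj_mat M"
  shows "\<exists>J\<subseteq>{..<N}. card J = d \<and> minor M J \<noteq> 0"
proof -
  obtain L where L: "L \<in> carrier_mat d N" "L * M = 1\<^sub>m d" using inj_left_inverse[OF M] by blast
  then obtain f where f: "\<forall>a<d. f a < N" "det (rowsel d f M) \<noteq> 0"
    using nonzero_rowsel[OF L(1) M(1)] by auto
  have "d \<le> N" using Gr_le[OF Gr_img[OF M]] .
  then obtain s J where "J \<subseteq> {..<N}" "card J = d" "det (rowsel d f M) = s * minor M J"
    using rowsel_minor[of d f N] f(1) M(1) by blast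
  then show ?thesis using f(2) by auto
qed

lemma minor_nonzero_inj:
  assumes M: "M \<in> carrier_mat N d" and f: "\<And>a. a < d \<Longrightarrow> f a < N" and nz: "det (rowsel d f M) \<noteq> 0"
  shows "inj_mat M"
proof (rule inj_matI[OF M])
  fix v assume v: "v \<in> carrier_vec d" "M *\<^sub>v v = 0\<^sub>v N"
  have "rowsel d f M *\<^sub>v v = 0\<^sub>v d"
  proof (rule eq_vecI)
    fix i assume "i < dim_vec (0\<^sub>v d :: complex vec)"
    then have i: "i < d" by simp
    have "row (rowsel d f M) i = row M (f i)" using i f[OF i] M by (intro eq_vecI) (auto simp: rowsel_def)
    then have "(rowsel d f M *\<^sub>v v) $ i = (M *\<^sub>v v) $ f i" using i f[OF i] M by (simp add: rowsel_def)
    then show "(rowsel d f M *\<^sub>v v) $ i = 0\<^sub>v d $ i" using v(2) i f[OF i] by simp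
  qed (simp add: rowsel_def)
  then show "v = 0\<^sub>v d" using det_0_iff_vec_prod_zero_field[OF rowsel_carrier] nz v(1) by blast
qed

text \<open>Two frames of one subspace differ by an invertible matrix. Only the column spaces are assumed to agree: that \<open>M\<close> is injective follows from the number of its columns, which is what makes this applicable to a frame chosen by \<open>SOME\<close>.\<close>

lemma frame_change:
  assumes M: "M \<in> carrier_mat N d" and F: "F \<in> carrier_mat N d" and eq: "img M = img F" and G: "img F \<in> Gr d N"
  shows "\<exists>X\<in>carrier_mat d d. F = M * X \<and> det X \<noteq> 0"
proof -
  have key: "\<exists>X\<in>carrier_mat d d. A = C * X \<and> det X \<noteq> 0"
    if A: "A \<in> carrier_mat N d" "inj_mat A" and C: "C \<in> carrier_mat N d" "img C = img A" for A C
  proof -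
    have "col A j \<in> img C" if j: "j < d" for j
      using mult_unit_vec[OF A(1) j] imgI[OF A(1) unit_vec_carrier] C(2) by metis
    then obtain X where X: "X \<in> carrier_mat d d" "A = C * X" using cols_in_img[OF A(1) C(1)] by blast
    have "v = 0\<^sub>v d" if v: "v \<in> carrier_vec d" "X *\<^sub>v v = 0\<^sub>v d" for v
    proof -
      have "A *\<^sub>v v = C *\<^sub>v (X *\<^sub>v v)" unfolding X(2) by (rule assoc_mult_mat_vec[OF C(1) X(1) v(1)])
      then have "A *\<^sub>v v = 0\<^sub>v N" unfolding v(2) mult_zero_vec[OF C(1)] .
      then show ?thesis using inj_matD[OF A(2,1) v(1)] by simp
    qed
    then have "det X \<noteq> 0" using det_0_iff_vec_prod_zero_field[OF X(1)] by blast
    then show ?thesis using X by blast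
  qed
  obtain B where B: "B \<in> carrier_mat N d" "inj_mat B" "img B = img F" using Gr_frame[OF G] .
  have injM: "inj_mat C" if C: "C \<in> carrier_mat N d" "img C = img B" for C
  proof -
    obtain X where X: "X \<in> carrier_mat d d" "B = C * X" "det X \<noteq> 0" using key[OF B(1,2) C] by blast
    obtain L where L: "L \<in> carrier_mat d N" "L * B = 1\<^sub>m d" using inj_left_inverse[OF B(1,2)] by blast
    have "(L * C) * X = 1\<^sub>m d" using L X C by simp
    then have XL: "X * (L * C) = 1\<^sub>m d" using mat_mult_left_right_inverse[of "L * C" d X] L C X by auto
    show ?thesis
    proof (rule inj_matI[OF C(1)])
      fix v assume v: "v \<in> carrier_vec d" "C *\<^sub>v v = 0\<^sub>v N"
      have XLc: "X * L \<in> carrier_mat d N" using X(1) L(1) by simp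
      have "v = (X * (L * C)) *\<^sub>v v" unfolding XL using v(1) by simp
      also have "\<dots> = (X * L) *\<^sub>v (C *\<^sub>v v)"
        using assoc_mult_mat[OF X(1) L(1) C(1)] assoc_mult_mat_vec[OF XLc C(1) v(1)] by simp
      also have "\<dots> = 0\<^sub>v d" unfolding v(2) by (rule mult_zero_vec[OF XLc])
      finally show "v = 0\<^sub>v d" .
    qed
  qed
  show ?thesis using key[OF F injM[OF F] M] B(3) eq by simp
qed

section \<open>Multihomogeneous polynomials and rational functions\<close>

abbreviation coords :: "gr_product \<Rightarrow> (nat \<times> nat set) set" where
  "coords A \<equiv> {(i, J). i \<in> {1..factors A} \<and> J \<subseteq> {..<vdim A} \<and> card J = subdim A i}"

lemma multihom_cong:
  assumes "multihom A \<delta> f" "\<And>i J. (i, J) \<in> coords A \<Longrightarrow> p i J = q i J"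
  shows "f p = f q"
  using assms by (induction rule: multihom.induct) auto

lemma multihom_scale:
  assumes "multihom A \<delta> f" "\<And>i J. (i, J) \<in> coords A \<Longrightarrow> q i J = c i * p i J"
  shows "f q = (\<Prod>i\<in>{1..factors A}. c i ^ \<delta> i) * f p"
  using assms
proof (induction rule: multihom.induct)
  case (coord i J)
  have "(\<Prod>j\<in>{1..factors A}. c j ^ ((\<lambda>_. 0)(i := 1)) j) = (\<Prod>j\<in>{1..factors A}. if j = i then c i else 1)"
    by (intro prod.cong) auto
  also have "\<dots> = c i" using coord by (subst prod.delta) auto
  finally show ?case using coord by simp
qed (auto simp: algebra_simps power_add prod.distrib)

lemma multihom_smult:
  assumes "multihom A \<delta> f" shows "multihom A \<delta> (\<lambda>p. c * f p)"
  using multihom.mult[OF multihom.const assms, of c] by simp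

lemma frame_spec:
  assumes x: "x \<in> points A" and i: "i \<in> {1..factors A}"
  shows "x i \<in> Gr (subdim A i) (vdim A)"
    "frame (subdim A i) (vdim A) (x i) \<in> carrier_mat (vdim A) (subdim A i)"
    "img (frame (subdim A i) (vdim A) (x i)) = x i"
proof -
  let ?N = "vdim A" and ?d = "subdim A i"
  show G: "x i \<in> Gr ?d ?N" using x i by (auto simp: points_def)
  obtain M where M: "M \<in> carrier_mat ?N ?d" "inj_mat M" "img M = x i" using Gr_frame[OF G] .
  then have "\<exists>M. M \<in> carrier_mat ?N ?d \<and> vec_space.col_space ?N M = x i"
    using col_space_img[OF M(1)] by blast
  then have *: "frame ?d ?N (x i) \<in> carrier_mat ?N ?d \<and> vec_space.col_space ?N (frame ?d ?N (x i)) = x i"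
    unfolding frame_def by (rule someI_ex)
  then show "frame ?d ?N (x i) \<in> carrier_mat ?N ?d" "img (frame ?d ?N (x i)) = x i"
    using col_space_img by auto
qed

lemma pluecker_scale:
  assumes x: "x \<in> points A" and i: "i \<in> {1..factors A}"
    and M: "M \<in> carrier_mat (vdim A) (subdim A i)" "img M = x i"
  shows "\<exists>c. c \<noteq> 0 \<and> (\<forall>J. J \<subseteq> {..<vdim A} \<longrightarrow> card J = subdim A i \<longrightarrow> pluecker A x i J = c * minor M J)"
proof -
  note F = frame_spec[OF x i]
  obtain X where X: "X \<in> carrier_mat (subdim A i) (subdim A i)"
    "frame (subdim A i) (vdim A) (x i) = M * X" "det X \<noteq> 0"
    using frame_change[OF M(1) F(2)] M(2) F(3) F(1) by auto
  have "pluecker A x i J = det X * minor M J" if J: "J \<subseteq> {..<vdim A}" "card J = subdim A i" for J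
    unfolding pluecker_def X(2) using minor_mult[OF M(1) X(1) J] by (simp add: minor_def)
  then show ?thesis using X(3) by blast
qed

text \<open>The frames that define Pluecker coordinates are arbitrary choices. This replaces them by any frames at hand, at the cost of a factor that depends on the multidegree alone and hence cancels in quotients of equal multidegree.\<close>

lemma multihom_minors:
  assumes x: "x \<in> points A"
    and M: "\<And>i. i \<in> {1..factors A} \<Longrightarrow> M i \<in> carrier_mat (vdim A) (subdim A i) \<and> img (M i) = x i"
  shows "\<exists>c. (\<forall>i. c i \<noteq> 0) \<and> (\<forall>\<delta> f. multihom A \<delta> f \<longrightarrow>
    f (pluecker A x) = (\<Prod>i\<in>{1..factors A}. c i ^ \<delta> i) * f (\<lambda>i. minor (M i)))"
proof -
  have "\<forall>i. \<exists>c. c \<noteq> 0 \<and> (i \<in> {1..factors A} \<longrightarrow> (\<forall>J. J \<subseteq> {..<vdim A} \<longrightarrow> card J = subdim A i \<longrightarrow>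
      pluecker A x i J = c * minor (M i) J))"
  proof
    fix i show "\<exists>c. c \<noteq> 0 \<and> (i \<in> {1..factors A} \<longrightarrow> (\<forall>J. J \<subseteq> {..<vdim A} \<longrightarrow> card J = subdim A i \<longrightarrow>
      pluecker A x i J = c * minor (M i) J))"
    proof (cases "i \<in> {1..factors A}")
      case True
      then show ?thesis using pluecker_scale[OF x True, of "M i"] M[OF True] by blast
    qed (auto intro: exI[of _ 1])
  qed
  then obtain c where c: "\<forall>i. c i \<noteq> 0 \<and> (i \<in> {1..factors A} \<longrightarrow> (\<forall>J. J \<subseteq> {..<vdim A} \<longrightarrow> card J = subdim A i \<longrightarrow>
      pluecker A x i J = c i * minor (M i) J))" by metis
  show ?thesis
  proof (intro exI[of _ c] conjI allI impI)
    fix \<delta> f assume f: "multihom A \<delta> f"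
    show "f (pluecker A x) = (\<Prod>i\<in>{1..factors A}. c i ^ \<delta> i) * f (\<lambda>i. minor (M i))"
      by (rule multihom_scale[OF f]) (use c in auto)
  qed (use c in blast)
qed

text \<open>One quotient represents the function on all of \<open>U\<close>; such functions are closed under the ring operations, so determinants of matrices of them are again such functions.\<close>

definition ratfun :: "gr_product \<Rightarrow> subspaces set \<Rightarrow> (subspaces \<Rightarrow> complex) \<Rightarrow> bool" where
  "ratfun A U \<phi> \<longleftrightarrow> (\<exists>\<delta> f g. multihom A \<delta> f \<and> multihom A \<delta> g \<and>
     (\<forall>y\<in>U. g (pluecker A y) \<noteq> 0 \<and> \<phi> y = f (pluecker A y) / g (pluecker A y)))"

lemma ratfun_cong: "(\<And>y. y \<in> U \<Longrightarrow> \<phi> y = \<psi> y) \<Longrightarrow> ratfun A U \<phi> \<longleftrightarrow> ratfun A U \<psi>"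
  unfolding ratfun_def by (metis (no_types, lifting))

lemma ratfun_eqI: "ratfun A U \<psi> \<Longrightarrow> (\<And>y. y \<in> U \<Longrightarrow> \<phi> y = \<psi> y) \<Longrightarrow> ratfun A U \<phi>"
  using ratfun_cong by blast

lemma ratfun_subset: "ratfun A U \<phi> \<Longrightarrow> U' \<subseteq> U \<Longrightarrow> ratfun A U' \<phi>"
  unfolding ratfun_def by blast

lemma ratfun_const [intro]: "ratfun A U (\<lambda>_. c)"
  unfolding ratfun_def
  by (rule exI, rule exI[of _ "\<lambda>_. c"], rule exI[of _ "\<lambda>_. 1"]) (auto intro: multihom.const)

lemma ratfun_add [intro]:
  assumes "ratfun A U \<phi>" "ratfun A U \<psi>" shows "ratfun A U (\<lambda>y. \<phi> y + \<psi> y)"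
proof -
  obtain \<delta> f g where 1: "multihom A \<delta> f" "multihom A \<delta> g"
      "\<forall>y\<in>U. g (pluecker A y) \<noteq> 0 \<and> \<phi> y = f (pluecker A y) / g (pluecker A y)"
    using assms(1) by (auto simp: ratfun_def)
  obtain \<epsilon> f' g' where 2: "multihom A \<epsilon> f'" "multihom A \<epsilon> g'"
      "\<forall>y\<in>U. g' (pluecker A y) \<noteq> 0 \<and> \<psi> y = f' (pluecker A y) / g' (pluecker A y)"
    using assms(2) by (auto simp: ratfun_def)
  have m: "multihom A (\<lambda>i. \<delta> i + \<epsilon> i) (\<lambda>p. f p * g' p + g p * f' p)"
    by (intro multihom.add multihom.mult 1 2)
  have m': "multihom A (\<lambda>i. \<delta> i + \<epsilon> i) (\<lambda>p. g p * g' p)"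
    by (intro multihom.mult 1 2)
  show ?thesis unfolding ratfun_def
    by (rule exI, rule exI, rule exI, rule conjI[OF m], rule conjI[OF m'])
      (use 1(3) 2(3) in \<open>auto simp: field_simps\<close>)
qed

lemma ratfun_mult [intro]:
  assumes "ratfun A U \<phi>" "ratfun A U \<psi>" shows "ratfun A U (\<lambda>y. \<phi> y * \<psi> y)"
proof -
  obtain \<delta> f g where 1: "multihom A \<delta> f" "multihom A \<delta> g"
      "\<forall>y\<in>U. g (pluecker A y) \<noteq> 0 \<and> \<phi> y = f (pluecker A y) / g (pluecker A y)"
    using assms(1) by (auto simp: ratfun_def)
  obtain \<epsilon> f' g' where 2: "multihom A \<epsilon> f'" "multihom A \<epsilon> g'"
      "\<forall>y\<in>U. g' (pluecker A y) \<noteq> 0 \<and> \<psi> y = f' (pluecker A y) / g' (pluecker A y)"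
    using assms(2) by (auto simp: ratfun_def)
  note m = multihom.mult[OF 1(1) 2(1)] and m' = multihom.mult[OF 1(2) 2(2)]
  show ?thesis unfolding ratfun_def
    by (rule exI, rule exI, rule exI, rule conjI[OF m], rule conjI[OF m'])
      (use 1(3) 2(3) in \<open>auto simp: field_simps\<close>)
qed

lemma ratfun_sum [intro]: "(\<And>a. a \<in> I \<Longrightarrow> ratfun A U (\<phi> a)) \<Longrightarrow> ratfun A U (\<lambda>y. \<Sum>a\<in>I. \<phi> a y)"
  by (induction I rule: infinite_finite_induct) auto

lemma ratfun_prod [intro]: "(\<And>a. a \<in> I \<Longrightarrow> ratfun A U (\<phi> a)) \<Longrightarrow> ratfun A U (\<lambda>y. \<Prod>a\<in>I. \<phi> a y)"
  by (induction I rule: infinite_finite_induct) auto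

lemma ratfun_divide:
  assumes "ratfun A U \<phi>" "ratfun A U \<psi>" "\<And>y. y \<in> U \<Longrightarrow> \<psi> y \<noteq> 0" shows "ratfun A U (\<lambda>y. \<phi> y / \<psi> y)"
proof -
  obtain \<delta> f g where 1: "multihom A \<delta> f" "multihom A \<delta> g"
      "\<forall>y\<in>U. g (pluecker A y) \<noteq> 0 \<and> \<phi> y = f (pluecker A y) / g (pluecker A y)"
    using assms(1) by (auto simp: ratfun_def)
  obtain \<epsilon> f' g' where 2: "multihom A \<epsilon> f'" "multihom A \<epsilon> g'"
      "\<forall>y\<in>U. g' (pluecker A y) \<noteq> 0 \<and> \<psi> y = f' (pluecker A y) / g' (pluecker A y)"
    using assms(2) by (auto simp: ratfun_def)
  note m = multihom.mult[OF 1(1) 2(2)] and m' = multihom.mult[OF 1(2) 2(1)]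
  show ?thesis unfolding ratfun_def
    by (rule exI, rule exI, rule exI, rule conjI[OF m], rule conjI[OF m'])
      (use 1(3) 2(3) assms(3) in \<open>auto simp: field_simps\<close>)
qed

lemma ratfun_quotient:
  assumes "multihom A \<delta> f" "multihom A \<delta> g" "\<And>y. y \<in> U \<Longrightarrow> g (pluecker A y) \<noteq> 0"
  shows "ratfun A U (\<lambda>y. f (pluecker A y) / g (pluecker A y))"
  using assms unfolding ratfun_def by blast

lemma ratfun_multihom:
  assumes "multihom B \<delta> f" "\<And>i J. (i, J) \<in> coords B \<Longrightarrow> ratfun A U (\<lambda>x. p x i J)"
  shows "ratfun A U (\<lambda>x. f (p x))"
  using assms by (induction rule: multihom.induct) auto

definition ratmat :: "gr_product \<Rightarrow> subspaces set \<Rightarrow> nat \<Rightarrow> nat \<Rightarrow> (subspaces \<Rightarrow> complex mat) \<Rightarrow> bool" where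
  "ratmat A U r c M \<longleftrightarrow> (\<forall>x\<in>U. M x \<in> carrier_mat r c) \<and>
     (\<forall>a<r. \<forall>b<c. ratfun A U (\<lambda>x. M x $$ (a, b)))"

lemma ratmat_subset: "ratmat A U r c M \<Longrightarrow> U' \<subseteq> U \<Longrightarrow> ratmat A U' r c M"
  unfolding ratmat_def using ratfun_subset by blast

lemma ratmat_const: "M \<in> carrier_mat r c \<Longrightarrow> ratmat A U r c (\<lambda>_. M)"
  by (auto simp: ratmat_def)

lemma ratmat_mult:
  assumes M: "ratmat A U r k M" and L: "ratmat A U k c L" shows "ratmat A U r c (\<lambda>x. M x * L x)"
  unfolding ratmat_def
proof (intro conjI ballI allI impI)
  fix x assume "x \<in> U" then show "M x * L x \<in> carrier_mat r c" using M L by (auto simp: ratmat_def)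
next
  fix a b assume ab: "a < r" "b < c"
  have "ratfun A U (\<lambda>x. \<Sum>j\<in>{0..<k}. M x $$ (a, j) * L x $$ (j, b))"
    using M L ab by (intro ratfun_sum ratfun_mult) (auto simp: ratmat_def)
  moreover have "(M x * L x) $$ (a, b) = (\<Sum>j\<in>{0..<k}. M x $$ (a, j) * L x $$ (j, b))" if "x \<in> U" for x
  proof -
    have "M x \<in> carrier_mat r k" "L x \<in> carrier_mat k c" using that M L by (auto simp: ratmat_def)
    then show ?thesis using ab by (auto simp: scalar_prod_def)
  qed
  ultimately show "ratfun A U (\<lambda>x. (M x * L x) $$ (a, b))" by (rule ratfun_eqI)
qed

lemma ratmat_minus:
  assumes M: "ratmat A U r c M" and L: "ratmat A U r c L" shows "ratmat A U r c (\<lambda>x. M x - L x)"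
  unfolding ratmat_def
proof (intro conjI ballI allI impI)
  fix x assume "x \<in> U" then show "M x - L x \<in> carrier_mat r c" using L unfolding ratmat_def by (intro minus_carrier_mat) blast
next
  fix a b assume ab: "a < r" "b < c"
  have "ratfun A U (\<lambda>x. M x $$ (a, b) + (-1) * L x $$ (a, b))"
    using M L ab by (intro ratfun_add ratfun_mult ratfun_const) (auto simp: ratmat_def)
  moreover have "(M x - L x) $$ (a, b) = M x $$ (a, b) + (-1) * L x $$ (a, b)" if "x \<in> U" for x
  proof -
    have "M x \<in> carrier_mat r c" "L x \<in> carrier_mat r c" using that M L by (auto simp: ratmat_def)
    then show ?thesis using ab by auto
  qed
  ultimately show "ratfun A U (\<lambda>x. (M x - L x) $$ (a, b))" by (rule ratfun_eqI)
qed

lemma ratmat_transpose: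
  assumes M: "ratmat A U r c M" shows "ratmat A U c r (\<lambda>x. transpose_mat (M x))"
  unfolding ratmat_def
proof (intro conjI ballI allI impI)
  fix x assume "x \<in> U" then show "transpose_mat (M x) \<in> carrier_mat c r" using M by (auto simp: ratmat_def)
next
  fix a b assume ab: "a < c" "b < r"
  have "ratfun A U (\<lambda>x. M x $$ (b, a))" using M ab by (auto simp: ratmat_def)
  moreover have "transpose_mat (M x) $$ (a, b) = M x $$ (b, a)" if "x \<in> U" for x
  proof -
    have "M x \<in> carrier_mat r c" using that M by (auto simp: ratmat_def)
    then show ?thesis using ab by auto
  qed
  ultimately show "ratfun A U (\<lambda>x. transpose_mat (M x) $$ (a, b))" by (rule ratfun_eqI)
qed

lemma ratfun_det:
  assumes M: "ratmat A U d d M" shows "ratfun A U (\<lambda>x. det (M x))"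
proof -
  have "ratfun A U (\<lambda>x. \<Sum>p\<in>{p. p permutes {0..<d}}. signof p * (\<Prod>i = 0..<d. M x $$ (i, p i)))"
  proof (intro ratfun_sum ratfun_mult ratfun_const ratfun_prod)
    fix p i assume "p \<in> {p. p permutes {0..<d}}" "i \<in> {0..<d}"
    then have "i < d" "p i < d" using permutes_in_image by force+
    then show "ratfun A U (\<lambda>x. M x $$ (i, p i))" using M by (auto simp: ratmat_def)
  qed
  moreover have "det (M x) = (\<Sum>p\<in>{p. p permutes {0..<d}}. signof p * (\<Prod>i = 0..<d. M x $$ (i, p i)))"
    if "x \<in> U" for x
    by (rule det_def') (use that M in \<open>auto simp: ratmat_def\<close>)
  ultimately show ?thesis by (rule ratfun_eqI)
qed

lemma ratmat_rows_cols:
  assumes M: "ratmat A U r c M" and f: "\<And>a. a < d \<Longrightarrow> f a < r" and g: "\<And>b. b < e \<Longrightarrow> g b < c"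
  shows "ratmat A U d e (\<lambda>x. mat d e (\<lambda>(a, b). M x $$ (f a, g b)))"
  using M f g by (auto simp: ratmat_def)

lemma openin_ratfun_nonzero:
  assumes U: "openin (zariski A) U" and \<phi>: "ratfun A U \<phi>"
  shows "openin (zariski A) {x \<in> U. \<phi> x \<noteq> 0}"
proof -
  obtain \<delta> f g where 1: "multihom A \<delta> f" "multihom A \<delta> g"
      "\<forall>y\<in>U. g (pluecker A y) \<noteq> 0 \<and> \<phi> y = f (pluecker A y) / g (pluecker A y)"
    using \<phi> by (auto simp: ratfun_def)
  have "openin (zariski A) {x \<in> points A. f (pluecker A x) \<noteq> 0}"
    unfolding openin_zariski zariski_open_def using 1(1) by (intro exI[of _ "{f}"]) auto
  moreover have "{x \<in> U. \<phi> x \<noteq> 0} = U \<inter> {x \<in> points A. f (pluecker A x) \<noteq> 0}"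
    using 1(3) openin_subset[OF U] topspace_zariski by auto
  ultimately show ?thesis using openin_Int[OF U] by simp
qed

lemma openin_multihom_nonzero:
  assumes "multihom A \<delta> f" shows "openin (zariski A) {x \<in> points A. f (pluecker A x) \<noteq> 0}"
  unfolding openin_zariski zariski_open_def using assms by (intro exI[of _ "{f}"]) auto

section \<open>Local frames and closed conditions\<close>

definition selmat :: "nat \<Rightarrow> nat \<Rightarrow> (nat \<Rightarrow> nat) \<Rightarrow> complex mat" where
  "selmat d N f = mat d N (\<lambda>(a, b). if b = f a then 1 else 0)"

lemma selmat_carrier [simp]: "selmat d N f \<in> carrier_mat d N"
  by (simp add: selmat_def)

lemma selmat_mult:
  assumes "\<And>a. a < d \<Longrightarrow> f a < N" "M \<in> carrier_mat N d"
  shows "selmat d N f * M = rowsel d f M"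
proof (rule eq_matI)
  fix a b assume "a < dim_row (rowsel d f M)" "b < dim_col (rowsel d f M)"
  then have ab: "a < d" "b < d" by (auto simp: rowsel_def)
  have "row (selmat d N f) a = unit_vec N (f a)" using ab assms(1) by (intro eq_vecI) (auto simp: selmat_def)
  then show "(selmat d N f * M) $$ (a, b) = rowsel d f M $$ (a, b)"
    using ab assms by (simp add: selmat_def rowsel_def)
qed (use assms in \<open>auto simp: selmat_def rowsel_def\<close>)

text \<open>Each row of \<open>F\<close> is a combination of the rows chosen by \<open>f\<close>. By Cramer's rule its coefficients are quotients of determinants in which one chosen row is exchanged for it.\<close>

lemma cramer_rows:
  assumes F: "F \<in> carrier_mat N d" and f: "\<And>a. a < d \<Longrightarrow> f a < N" and nz: "det (rowsel d f F) \<noteq> 0"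
  shows "F = mat N d (\<lambda>(r, b). det (rowsel d (f(b := r)) F) / det (rowsel d f F)) * rowsel d f F"
    (is "F = ?M * ?P")
proof (rule eq_matI)
  fix r j assume "r < dim_row (?M * ?P)" "j < dim_col (?M * ?P)"
  then have rj: "r < N" "j < d" by (auto simp: rowsel_def)
  let ?T = "transpose_mat ?P"
  have T: "?T \<in> carrier_mat d d" by simp
  have dT: "det ?T \<noteq> 0" using det_transpose[OF rowsel_carrier] nz by simp
  obtain Y where Y: "Y \<in> carrier_mat d d" "?T * Y = 1\<^sub>m d"
    using det_non_zero_imp_unit[OF T dT] unfolding Units_def ring_mat_def by auto
  define w where "w = Y *\<^sub>v row F r"
  have rF: "row F r \<in> carrier_vec d" using F rj by auto
  have w: "w \<in> carrier_vec d" using Y rF by (simp add: w_def)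
  have Tw: "?T *\<^sub>v w = row F r"
    unfolding w_def using assoc_mult_mat_vec[OF T Y(1) rF] Y(2) rF by simp
  have "w $ b = ?M $$ (r, b)" if b: "b < d" for b
  proof -
    have "replace_col ?T (row F r) b = transpose_mat (rowsel d (f(b := r)) F)"
      using b F rj f by (intro eq_matI) (auto simp: replace_col_def rowsel_def)
    then have "det (rowsel d (f(b := r)) F) = w $ b * det ?P"
      using cramer_lemma_mat[OF T w b] det_transpose[OF rowsel_carrier] unfolding Tw by metis
    then show ?thesis using nz b rj by simp
  qed
  then have "row ?M r = w" using w rj by (intro eq_vecI) auto
  then have "(?M * ?P) $$ (r, j) = w \<bullet> col ?P j" using rj by (simp add: rowsel_def)
  also have "\<dots> = col ?P j \<bullet> w" by (rule comm_scalar_prod[OF w]) (simp add: rowsel_def carrier_vecI)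
  also have "\<dots> = (?T *\<^sub>v w) $ j" using rj by (simp add: rowsel_def)
  also have "\<dots> = F $$ (r, j)" unfolding Tw using rj F by simp
  finally show "F $$ (r, j) = (?M * ?P) $$ (r, j)" by simp
qed (use F in \<open>auto simp: rowsel_def\<close>)

text \<open>Normalising a frame to be the identity in the rows \<open>J\<close> makes its entries quotients of Pluecker coordinates by the one with index \<open>J\<close>. The matrix \<open>S\<close> selects these rows.\<close>

lemma local_frame:
  assumes x0: "x0 \<in> points A" and i: "i \<in> {1..factors A}"
  shows "\<exists>J M S. J \<subseteq> {..<vdim A} \<and> card J = subdim A i \<and> pluecker A x0 i J \<noteq> 0 \<and>
    ratmat A {x \<in> points A. pluecker A x i J \<noteq> 0} (vdim A) (subdim A i) M \<and>
    S \<in> carrier_mat (subdim A i) (vdim A) \<and>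
    (\<forall>x\<in>points A. pluecker A x i J \<noteq> 0 \<longrightarrow> img (M x) = x i \<and> S * M x = 1\<^sub>m (subdim A i))"
proof -
  let ?N = "vdim A" and ?d = "subdim A i"
  let ?F = "\<lambda>x. frame ?d ?N (x i)"
  have pm: "pluecker A x i J = minor (?F x) J" for x J by (simp add: pluecker_def minor_def)
  note F0 = frame_spec[OF x0 i]
  obtain M0 where M0: "M0 \<in> carrier_mat ?N ?d" "inj_mat M0" "img M0 = x0 i" using Gr_frame[OF F0(1)] .
  obtain J where J: "J \<subseteq> {..<?N}" "card J = ?d" "minor M0 J \<noteq> 0" using nonzero_minor[OF M0(1,2)] by blast
  obtain c where "c \<noteq> 0" "pluecker A x0 i J = c * minor M0 J"
    using pluecker_scale[OF x0 i M0(1,3)] J(1,2) by blast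
  then have nz0: "pluecker A x0 i J \<noteq> 0" using J(3) by simp
  note pl = pick_less[OF J(1,2)]
  define M where "M x = mat ?N ?d (\<lambda>(r, b). det (rowsel ?d ((pick J)(b := r)) (?F x)) / det (rowsel ?d (pick J) (?F x)))" for x
  have dN: "?d \<le> ?N" using Gr_le[OF F0(1)] .
  have "ratmat A {x \<in> points A. pluecker A x i J \<noteq> 0} ?N ?d M"
    unfolding ratmat_def
  proof (intro conjI ballI allI impI)
    fix r b assume rb: "r < ?N" "b < ?d"
    have "((pick J)(b := r)) a < ?N" if "a < ?d" for a using pl[OF that] rb by simp
    then have "\<exists>s J'. J' \<subseteq> {..<?N} \<and> card J' = ?d \<and>
      (\<forall>M\<in>carrier_mat ?N ?d. det (rowsel ?d ((pick J)(b := r)) M) = s * minor M J')"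
      by (rule rowsel_minor[OF _ dN])
    then obtain s J' where J': "J' \<subseteq> {..<?N}" "card J' = ?d"
      "\<forall>M\<in>carrier_mat ?N ?d. det (rowsel ?d ((pick J)(b := r)) M) = s * minor M J'"
      by (elim exE conjE)
    have co: "multihom A ((\<lambda>_. 0)(i := 1)) (\<lambda>p. s * p i J')"
      "multihom A ((\<lambda>_. 0)(i := 1)) (\<lambda>p. p i J)"
      using multihom_smult[OF multihom.coord[OF i J'(1,2)]] multihom.coord[OF i J(1,2)] by auto
    have r: "ratfun A {x \<in> points A. pluecker A x i J \<noteq> 0} (\<lambda>x. s * pluecker A x i J' / pluecker A x i J)"
      by (rule ratfun_quotient[OF co]) simp
    show "ratfun A {x \<in> points A. pluecker A x i J \<noteq> 0} (\<lambda>x. M x $$ (r, b))"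
    proof (rule ratfun_eqI[OF r])
      fix x assume "x \<in> {x \<in> points A. pluecker A x i J \<noteq> 0}"
      then have x: "x \<in> points A" by simp
      note F = frame_spec(2)[OF x i]
      show "M x $$ (r, b) = s * pluecker A x i J' / pluecker A x i J"
        using rb J'(3) F minor_rowsel[OF F J(1,2)] by (simp add: M_def pm)
    qed
  qed (simp add: M_def)
  moreover have "img (M x) = x i \<and> selmat ?d ?N (pick J) * M x = 1\<^sub>m ?d"
    if x: "x \<in> points A" "pluecker A x i J \<noteq> 0" for x
  proof -
    note F = frame_spec[OF x(1) i]
    let ?P = "rowsel ?d (pick J) (?F x)"
    have nz: "det ?P \<noteq> 0" using x(2) minor_rowsel[OF F(2) J(1,2)] by (simp add: pm)
    have Mc: "M x \<in> carrier_mat ?N ?d" by (simp add: M_def)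
    have FM: "?F x = M x * ?P" unfolding M_def using cramer_rows[OF F(2) pl nz] by simp
    obtain Y where Y: "Y \<in> carrier_mat ?d ?d" "?P * Y = 1\<^sub>m ?d"
      using det_non_zero_imp_unit[OF rowsel_carrier nz] unfolding Units_def ring_mat_def by auto
    have MF: "M x = ?F x * Y"
    proof -
      have "?F x * Y = M x * ?P * Y" using FM by simp
      also have "\<dots> = M x * (?P * Y)" by (rule assoc_mult_mat[OF Mc rowsel_carrier Y(1)])
      finally show ?thesis using Y(2) Mc by simp
    qed
    have "img (M x) \<subseteq> img (?F x)"
    proof
      fix v assume "v \<in> img (M x)"
      then obtain u where u: "u \<in> carrier_vec ?d" "v = M x *\<^sub>v u" by (rule imgE[OF _ Mc])
      have "v = ?F x *\<^sub>v (Y *\<^sub>v u)" unfolding u(2) MF by (rule assoc_mult_mat_vec[OF F(2) Y(1) u(1)])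
      then show "v \<in> img (?F x)" using imgI[OF F(2)] Y(1) u(1) by simp
    qed
    moreover have "img (?F x) \<subseteq> img (M x)"
    proof
      fix v assume "v \<in> img (?F x)"
      then obtain u where u: "u \<in> carrier_vec ?d" "v = ?F x *\<^sub>v u" by (rule imgE[OF _ F(2)])
      have "v = (M x * ?P) *\<^sub>v u" unfolding u(2) using FM by simp
      also have "\<dots> = M x *\<^sub>v (?P *\<^sub>v u)" by (rule assoc_mult_mat_vec[OF Mc rowsel_carrier u(1)])
      finally show "v \<in> img (M x)" using imgI[OF Mc, of "?P *\<^sub>v u"] mult_mat_vec_carrier[OF rowsel_carrier u(1)] by simp
    qed
    ultimately have 1: "img (M x) = x i" using F(3) by simp
    have SF: "selmat ?d ?N (pick J) * ?F x = ?P" by (rule selmat_mult[OF pl F(2)])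
    have "selmat ?d ?N (pick J) * M x = selmat ?d ?N (pick J) * ?F x * Y"
      unfolding MF by (rule assoc_mult_mat[OF selmat_carrier F(2) Y(1), symmetric])
    then show ?thesis using 1 SF Y(2) by simp
  qed
  ultimately show ?thesis using J(1,2) nz0
    by (intro exI[of _ J] exI[of _ M] exI[of _ "selmat ?d ?N (pick J)"]) auto
qed

text \<open>Near every point all the subspaces have bases with regular coordinates simultaneously. Since \<open>S i * M i x\<close> is the identity, \<open>M i x * S i\<close> is a projection onto the \<open>i\<close>-th subspace, which turns membership into a linear equation.\<close>

lemma local_frames:
  assumes x0: "x0 \<in> points A"
  obtains U M S where "openin (zariski A) U" "x0 \<in> U"
    "\<And>i. i \<in> {1..factors A} \<Longrightarrow> ratmat A U (vdim A) (subdim A i) (M i)"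
    "\<And>i. i \<in> {1..factors A} \<Longrightarrow> S i \<in> carrier_mat (subdim A i) (vdim A)"
    "\<And>i x. i \<in> {1..factors A} \<Longrightarrow> x \<in> U \<Longrightarrow> img (M i x) = x i"
    "\<And>i x. i \<in> {1..factors A} \<Longrightarrow> x \<in> U \<Longrightarrow> S i * M i x = 1\<^sub>m (subdim A i)"
proof -
  let ?P = "\<lambda>i J M S. J \<subseteq> {..<vdim A} \<and> card J = subdim A i \<and> pluecker A x0 i J \<noteq> 0 \<and>
    ratmat A {x \<in> points A. pluecker A x i J \<noteq> 0} (vdim A) (subdim A i) M \<and>
    S \<in> carrier_mat (subdim A i) (vdim A) \<and>
    (\<forall>x\<in>points A. pluecker A x i J \<noteq> 0 \<longrightarrow> img (M x) = x i \<and> S * M x = 1\<^sub>m (subdim A i))"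
  have "\<forall>i\<in>{1..factors A}. \<exists>J M S. ?P i J M S" using local_frame[OF x0] by blast
  then obtain J where "\<forall>i\<in>{1..factors A}. \<exists>M S. ?P i (J i) M S" by (rule bchoice[THEN exE])
  then obtain M where "\<forall>i\<in>{1..factors A}. \<exists>S. ?P i (J i) (M i) S" by (rule bchoice[THEN exE])
  then obtain S where P: "\<forall>i\<in>{1..factors A}. ?P i (J i) (M i) (S i)" by (rule bchoice[THEN exE])
  define U where "U = {x \<in> points A. \<forall>i\<in>{1..factors A}. pluecker A x i (J i) \<noteq> 0}"
  have "openin (zariski A) ({x \<in> points A. \<forall>i\<in>I. pluecker A x i (J i) \<noteq> 0})" if "finite I" "I \<subseteq> {1..factors A}" for I
    using that
  proof (induction I rule: finite_induct)
    case empty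
    then show ?case using openin_topspace[of "zariski A"] by (simp add: topspace_zariski)
  next
    case (insert i I)
    have i: "i \<in> {1..factors A}" using insert by simp
    have "openin (zariski A) {x \<in> points A. pluecker A x i (J i) \<noteq> 0}"
      using openin_multihom_nonzero[OF multihom.coord[OF i]] P i by auto
    from openin_Int[OF this insert.IH] have "openin (zariski A) ({x \<in> points A. pluecker A x i (J i) \<noteq> 0} \<inter>
      {x \<in> points A. \<forall>i\<in>I. pluecker A x i (J i) \<noteq> 0})" using insert by auto
    moreover have "{x \<in> points A. pluecker A x i (J i) \<noteq> 0} \<inter> {x \<in> points A. \<forall>i\<in>I. pluecker A x i (J i) \<noteq> 0}
      = {x \<in> points A. \<forall>i\<in>insert i I. pluecker A x i (J i) \<noteq> 0}" by auto
    ultimately show ?case by simp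
  qed
  then have "openin (zariski A) U" unfolding U_def by blast
  moreover have "x0 \<in> U" using x0 P by (auto simp: U_def)
  moreover have "ratmat A U (vdim A) (subdim A i) (M i)" if "i \<in> {1..factors A}" for i
    by (rule ratmat_subset[of _ "{x \<in> points A. pluecker A x i (J i) \<noteq> 0}"]) (use P that in \<open>auto simp: U_def\<close>)
  ultimately show thesis
    by (rule that[where S = S]) (use P in \<open>auto simp: U_def\<close>)
qed

text \<open>Vanishing of regular functions is a closed condition, and closedness may be checked locally.\<close>

lemma closedin_if_local:
  assumes "\<And>x0. x0 \<in> points A \<Longrightarrow> \<exists>U R r c. openin (zariski A) U \<and> x0 \<in> U \<and> ratmat A U r c R \<and>
    (\<forall>x\<in>U. P x \<longleftrightarrow> R x = 0\<^sub>m r c)"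
  shows "closedin (zariski A) {x \<in> points A. P x}"
  unfolding closedin_def topspace_zariski
proof
  show "openin (zariski A) (points A - {x \<in> points A. P x})"
  proof (subst openin_subopen, intro ballI)
    fix x0 assume x0: "x0 \<in> points A - {x \<in> points A. P x}"
    then have "x0 \<in> points A" by simp
    from assms[OF this] obtain U R r c where U: "openin (zariski A) U" "x0 \<in> U" "ratmat A U r c R"
        "\<forall>x\<in>U. P x \<longleftrightarrow> R x = 0\<^sub>m r c"
      by (elim exE conjE)
    have nP: "\<not> P x0" using x0 by simp
    have Rc: "R x0 \<in> carrier_mat r c" using U(2,3) by (simp add: ratmat_def)
    have "\<exists>a b. a < r \<and> b < c \<and> R x0 $$ (a, b) \<noteq> 0"
    proof (rule ccontr)
      assume neg: "\<not> (\<exists>a b. a < r \<and> b < c \<and> R x0 $$ (a, b) \<noteq> 0)"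
      have "R x0 = 0\<^sub>m r c" by (rule eq_matI) (use neg Rc in auto)
      then show False using U(2,4) nP by simp
    qed
    then obtain a b where ab: "a < r" "b < c" "R x0 $$ (a, b) \<noteq> 0" by blast
    have "ratfun A U (\<lambda>x. R x $$ (a, b))" using U ab by (auto simp: ratmat_def)
    then have "openin (zariski A) {x \<in> U. R x $$ (a, b) \<noteq> 0}" by (rule openin_ratfun_nonzero[OF U(1)])
    moreover have "{x \<in> U. R x $$ (a, b) \<noteq> 0} \<subseteq> points A - {x \<in> points A. P x}"
      using U(4) ab openin_subset[OF U(1)] topspace_zariski by auto
    ultimately show "\<exists>T. openin (zariski A) T \<and> x0 \<in> T \<and> T \<subseteq> points A - {x \<in> points A. P x}"
      using U(2) ab(3) by blast
  qed
qed auto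

lemma mult_eq_zero_iff:
  assumes D: "D \<in> carrier_mat r N" and M: "M \<in> carrier_mat N d"
  shows "D * M = 0\<^sub>m r d \<longleftrightarrow> (\<forall>v\<in>img M. D *\<^sub>v v = 0\<^sub>v r)"
proof
  assume 0: "D * M = 0\<^sub>m r d"
  show "\<forall>v\<in>img M. D *\<^sub>v v = 0\<^sub>v r"
  proof
    fix v assume "v \<in> img M"
    then obtain u where u: "u \<in> carrier_vec d" "v = M *\<^sub>v u" by (rule imgE[OF _ M])
    have "D *\<^sub>v v = (D * M) *\<^sub>v u" unfolding u(2) by (rule assoc_mult_mat_vec[OF D M u(1), symmetric])
    then show "D *\<^sub>v v = 0\<^sub>v r" unfolding 0 using u(1) by (auto intro!: eq_vecI)
  qed
next
  assume 0: "\<forall>v\<in>img M. D *\<^sub>v v = 0\<^sub>v r"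
  show "D * M = 0\<^sub>m r d"
  proof (rule mat_col_eqI)
    fix j assume "j < dim_col (0\<^sub>m r d :: complex mat)"
    then have j: "j < d" by simp
    have "col M j \<in> img M" using mult_unit_vec[OF M j] imgI[OF M unit_vec_carrier] by metis
    then have "D *\<^sub>v col M j = 0\<^sub>v r" using 0 by blast
    then show "col (D * M) j = col (0\<^sub>m r d) j" using j D M by (simp add: col_mult2)
  qed (use D M in auto)
qed

text \<open>The projection \<open>M * S\<close> fixes exactly its image.\<close>

lemma img_projection:
  assumes M: "M \<in> carrier_mat N d" and S: "S \<in> carrier_mat d N" "S * M = 1\<^sub>m d" and v: "v \<in> carrier_vec N"
  shows "v \<in> img M \<longleftrightarrow> (1\<^sub>m N - M * S) *\<^sub>v v = 0\<^sub>v N"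
proof -
  have MS: "M * S \<in> carrier_mat N N" using M S by simp
  have e: "(1\<^sub>m N - M * S) *\<^sub>v v = v - M *\<^sub>v (S *\<^sub>v v)"
    using minus_mult_distrib_mat_vec[OF one_carrier_mat MS v] assoc_mult_mat_vec[OF M S(1) v] v by simp
  show ?thesis
  proof
    assume "v \<in> img M"
    then obtain u where u: "u \<in> carrier_vec d" "v = M *\<^sub>v u" by (rule imgE[OF _ M])
    have "S *\<^sub>v v = u" unfolding u(2) using assoc_mult_mat_vec[OF S(1) M u(1)] S(2) u(1) by simp
    then show "(1\<^sub>m N - M * S) *\<^sub>v v = 0\<^sub>v N" unfolding e using u(2) v by simp
  next
    assume "(1\<^sub>m N - M * S) *\<^sub>v v = 0\<^sub>v N"
    then have z: "v - M *\<^sub>v (S *\<^sub>v v) = 0\<^sub>v N" unfolding e .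
    have "v = M *\<^sub>v (S *\<^sub>v v)"
    proof (rule eq_vecI)
      fix a assume "a < dim_vec (M *\<^sub>v (S *\<^sub>v v))"
      then have a: "a < N" using M by simp
      have "(v - M *\<^sub>v (S *\<^sub>v v)) $ a = 0" unfolding z using a by simp
      then show "v $ a = (M *\<^sub>v (S *\<^sub>v v)) $ a" using a M by simp
    qed (use v M in auto)
    then show "v \<in> img M" using imgI[OF M, of "S *\<^sub>v v"] S(1) v by simp
  qed
qed

lemma closed_incidence:
  assumes i: "i \<in> {1..factors A}" and j: "j \<in> {1..factors A}" and D: "D \<in> carrier_mat (vdim A) (vdim A)"
  shows "closedin (zariski A) {x \<in> points A. \<forall>v\<in>x i. D *\<^sub>v v \<in> x j}"
proof (rule closedin_if_local)
  fix x0 assume x0: "x0 \<in> points A"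
  let ?N = "vdim A" and ?d = "subdim A"
  from local_frames[OF x0] obtain U M S where U: "openin (zariski A) U" "x0 \<in> U"
    "\<And>i. i \<in> {1..factors A} \<Longrightarrow> ratmat A U ?N (?d i) (M i)"
    "\<And>i. i \<in> {1..factors A} \<Longrightarrow> S i \<in> carrier_mat (?d i) ?N"
    "\<And>i x. i \<in> {1..factors A} \<Longrightarrow> x \<in> U \<Longrightarrow> img (M i x) = x i"
    "\<And>i x. i \<in> {1..factors A} \<Longrightarrow> x \<in> U \<Longrightarrow> S i * M i x = 1\<^sub>m (?d i)" by metis
  let ?R = "\<lambda>x. (1\<^sub>m ?N - M j x * S j) * D * M i x"
  have "ratmat A U ?N (?d i) ?R"
    by (intro ratmat_mult[where k = ?N] ratmat_minus ratmat_const one_carrier_mat D U(3) i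
        ratmat_mult[where k = "?d j"] U(3,4) j)
  moreover have "(\<forall>v\<in>x i. D *\<^sub>v v \<in> x j) \<longleftrightarrow> ?R x = 0\<^sub>m ?N (?d i)" if x: "x \<in> U" for x
  proof -
    have Mi: "M i x \<in> carrier_mat ?N (?d i)" and Mj: "M j x \<in> carrier_mat ?N (?d j)"
      using U(3) i j x by (auto simp: ratmat_def)
    let ?K = "1\<^sub>m ?N - M j x * S j"
    have K: "?K \<in> carrier_mat ?N ?N" using Mj U(4)[OF j] by (intro minus_carrier_mat) simp
    have KD: "?K * D \<in> carrier_mat ?N ?N" using K D by simp
    have xi: "x i \<subseteq> carrier_vec ?N" using img_carrier[OF Mi] U(5)[OF i x] by simp
    have "D *\<^sub>v v \<in> x j \<longleftrightarrow> (?K * D) *\<^sub>v v = 0\<^sub>v ?N" if v: "v \<in> x i" for v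
    proof -
      have vc: "v \<in> carrier_vec ?N" using v xi by blast
      have "D *\<^sub>v v \<in> carrier_vec ?N" using D vc by simp
      then show ?thesis
        using img_projection[OF Mj U(4)[OF j] U(6)[OF j x]] U(5)[OF j x] assoc_mult_mat_vec[OF K D vc] by simp
    qed
    then show ?thesis using mult_eq_zero_iff[OF KD Mi] U(5)[OF i x] by simp
  qed
  ultimately show "\<exists>U R r c. openin (zariski A) U \<and> x0 \<in> U \<and> ratmat A U r c R \<and>
      (\<forall>x\<in>U. (\<forall>v\<in>x i. D *\<^sub>v v \<in> x j) = (R x = 0\<^sub>m r c))"
    using U(1,2) by blast
qed

lemma closed_member:
  assumes j: "j \<in> {1..factors A}" and e: "e \<in> carrier_vec (vdim A)"
  shows "closedin (zariski A) {x \<in> points A. e \<in> x j}"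
proof (rule closedin_if_local)
  fix x0 assume x0: "x0 \<in> points A"
  let ?N = "vdim A" and ?d = "subdim A"
  from local_frames[OF x0] obtain U M S where U: "openin (zariski A) U" "x0 \<in> U"
    "\<And>i. i \<in> {1..factors A} \<Longrightarrow> ratmat A U ?N (?d i) (M i)"
    "\<And>i. i \<in> {1..factors A} \<Longrightarrow> S i \<in> carrier_mat (?d i) ?N"
    "\<And>i x. i \<in> {1..factors A} \<Longrightarrow> x \<in> U \<Longrightarrow> img (M i x) = x i"
    "\<And>i x. i \<in> {1..factors A} \<Longrightarrow> x \<in> U \<Longrightarrow> S i * M i x = 1\<^sub>m (?d i)" by metis
  let ?E = "mat_of_cols ?N [e]"
  have E: "?E \<in> carrier_mat ?N 1" by (auto simp: mat_of_cols_def)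
  let ?R = "\<lambda>x. (1\<^sub>m ?N - M j x * S j) * ?E"
  have "ratmat A U ?N 1 ?R"
    by (intro ratmat_mult[where k = ?N] ratmat_minus ratmat_const one_carrier_mat E
        ratmat_mult[where k = "?d j"] U(3,4) j)
  moreover have "e \<in> x j \<longleftrightarrow> ?R x = 0\<^sub>m ?N 1" if x: "x \<in> U" for x
  proof -
    have Mj: "M j x \<in> carrier_mat ?N (?d j)" using U(3) j x by (auto simp: ratmat_def)
    let ?K = "1\<^sub>m ?N - M j x * S j"
    have K: "?K \<in> carrier_mat ?N ?N" using Mj U(4)[OF j] by (intro minus_carrier_mat) simp
    have c0: "col ?E 0 = e" using e by (intro eq_vecI) (auto simp: mat_of_cols_def)
    have "?R x = 0\<^sub>m ?N 1 \<longleftrightarrow> ?K *\<^sub>v e = 0\<^sub>v ?N"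
    proof
      assume "?R x = 0\<^sub>m ?N 1"
      then have "col (?K * ?E) 0 = col (0\<^sub>m ?N 1) 0" by simp
      then show "?K *\<^sub>v e = 0\<^sub>v ?N" using col_mult2[OF K E, of 0] c0 by simp
    next
      assume z: "?K *\<^sub>v e = 0\<^sub>v ?N"
      show "?R x = 0\<^sub>m ?N 1"
        by (rule mat_col_eqI) (use z K E c0 col_mult2[OF K E, of 0] in auto)
    qed
    then show ?thesis using img_projection[OF Mj U(4)[OF j] U(6)[OF j x] e] U(5)[OF j x] by simp
  qed
  ultimately show "\<exists>U R r c. openin (zariski A) U \<and> x0 \<in> U \<and> ratmat A U r c R \<and>
      (\<forall>x\<in>U. (e \<in> x j) = (R x = 0\<^sub>m r c))"
    using U(1,2) by blast
qed

lemma closed_orthogonal: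
  assumes i: "i \<in> {1..factors A}" and j: "j \<in> {1..factors A}" and G: "G \<in> carrier_mat (vdim A) (vdim A)"
  shows "closedin (zariski A) {x \<in> points A. \<forall>u\<in>x i. \<forall>v\<in>x j. bform G u v = 0}"
proof (rule closedin_if_local)
  fix x0 assume x0: "x0 \<in> points A"
  let ?N = "vdim A" and ?d = "subdim A"
  from local_frames[OF x0] obtain U M S where U: "openin (zariski A) U" "x0 \<in> U"
    "\<And>i. i \<in> {1..factors A} \<Longrightarrow> ratmat A U ?N (?d i) (M i)"
    "\<And>i. i \<in> {1..factors A} \<Longrightarrow> S i \<in> carrier_mat (?d i) ?N"
    "\<And>i x. i \<in> {1..factors A} \<Longrightarrow> x \<in> U \<Longrightarrow> img (M i x) = x i"
    "\<And>i x. i \<in> {1..factors A} \<Longrightarrow> x \<in> U \<Longrightarrow> S i * M i x = 1\<^sub>m (?d i)" by metis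
  let ?R = "\<lambda>x. transpose_mat (M i x) * G * M j x"
  have "ratmat A U (?d i) (?d j) ?R"
    by (intro ratmat_mult[where k = ?N] ratmat_transpose ratmat_const G U(3) i j)
  moreover have "(\<forall>u\<in>x i. \<forall>v\<in>x j. bform G u v = 0) \<longleftrightarrow> ?R x = 0\<^sub>m (?d i) (?d j)" if x: "x \<in> U" for x
  proof -
    have Mi: "M i x \<in> carrier_mat ?N (?d i)" and Mj: "M j x \<in> carrier_mat ?N (?d j)"
      using U(3) i j x by (auto simp: ratmat_def)
    have Ti: "transpose_mat (M i x) \<in> carrier_mat (?d i) ?N" using Mi by simp
    have TG: "transpose_mat (M i x) * G \<in> carrier_mat (?d i) ?N" using Ti G by simp
    have "(\<forall>u\<in>x i. bform G u v = 0) \<longleftrightarrow> (transpose_mat (M i x) * G) *\<^sub>v v = 0\<^sub>v (?d i)" if v: "v \<in> x j" for v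
    proof -
      have vc: "v \<in> carrier_vec ?N" using v img_carrier[OF Mj] U(5)[OF j x] by blast
      have Gv: "G *\<^sub>v v \<in> carrier_vec ?N" using G vc by simp
      have e: "(transpose_mat (M i x) * G) *\<^sub>v v = transpose_mat (M i x) *\<^sub>v (G *\<^sub>v v)"
        by (rule assoc_mult_mat_vec[OF Ti G vc])
      let ?w = "transpose_mat (M i x) *\<^sub>v (G *\<^sub>v v)"
      have w: "?w \<in> carrier_vec (?d i)" using Ti Gv by simp
      have pair: "bform G (M i x *\<^sub>v u) v = ?w \<bullet> u" if u: "u \<in> carrier_vec (?d i)" for u
      proof -
        have "bform G (M i x *\<^sub>v u) v = (G *\<^sub>v v) \<bullet> (M i x *\<^sub>v u)"
          unfolding bform_def by (rule comm_scalar_prod[OF _ Gv]) (use Mi u in simp)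
        also have "\<dots> = ?w \<bullet> u" by (rule transpose_vec_mult_scalar[OF Mi u Gv, symmetric])
        finally show ?thesis .
      qed
      show ?thesis unfolding e
      proof
        assume L: "\<forall>u\<in>x i. bform G u v = 0"
        have dw: "dim_vec ?w = dim_vec (0\<^sub>v (?d i) :: complex vec)" using w by (metis carrier_vecD index_zero_vec(2))
        show "?w = 0\<^sub>v (?d i)"
        proof (rule eq_vecI[OF _ dw])
          fix a assume "a < dim_vec (0\<^sub>v (?d i) :: complex vec)"
          then have a: "a < ?d i" by simp
          have "M i x *\<^sub>v unit_vec (?d i) a \<in> x i" using imgI[OF Mi unit_vec_carrier] U(5)[OF i x] by simp
          then have "?w \<bullet> unit_vec (?d i) a = 0" using L pair[OF unit_vec_carrier] by metis
          then show "?w $ a = 0\<^sub>v (?d i) $ a" using a scalar_prod_right_unit[OF a, of ?w] by simp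
        qed
      next
        assume z: "?w = 0\<^sub>v (?d i)"
        show "\<forall>u\<in>x i. bform G u v = 0"
        proof
          fix u assume "u \<in> x i"
          then have "u \<in> img (M i x)" using U(5)[OF i x] by simp
          then obtain y where y: "y \<in> carrier_vec (?d i)" "u = M i x *\<^sub>v y" by (rule imgE[OF _ Mi])
          show "bform G u v = 0" unfolding y(2) pair[OF y(1)] z using y(1) by simp
        qed
      qed
    qed
    then show ?thesis using mult_eq_zero_iff[OF TG Mj] U(5)[OF j x] by auto
  qed
  ultimately show "\<exists>U R r c. openin (zariski A) U \<and> x0 \<in> U \<and> ratmat A U r c R \<and>
      (\<forall>x\<in>U. (\<forall>u\<in>x i. \<forall>v\<in>x j. bform G u v = 0) = (R x = 0\<^sub>m r c))"
    using U(1,2) by blast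
qed

section \<open>Morphisms given by column spaces\<close>

lemma col_choice:
  assumes M: "M \<in> carrier_mat N c" and G: "img M \<in> Gr d N"
  shows "\<exists>K\<in>carrier_mat c d. inj_mat (M * K)"
proof -
  obtain F where F: "F \<in> carrier_mat N d" "inj_mat F" "img F = img M" using Gr_frame[OF G] .
  have "col F j \<in> img M" if j: "j < d" for j
    using mult_unit_vec[OF F(1) j] imgI[OF F(1) unit_vec_carrier] F(3) by metis
  then show ?thesis using cols_in_img[OF F(1) M] F(2) by blast
qed

lemma img_mult_subset:
  assumes M: "M \<in> carrier_mat N c" and K: "K \<in> carrier_mat c d"
  shows "img (M * K) \<subseteq> img M"
proof
  have MK: "M * K \<in> carrier_mat N d" using M K by simp
  fix v assume "v \<in> img (M * K)"
  then obtain u where u: "u \<in> carrier_vec d" "v = (M * K) *\<^sub>v u" by (rule imgE[OF _ MK])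
  show "v \<in> img M" unfolding u(2) assoc_mult_mat_vec[OF M K u(1)] using imgI[OF M] K u(1) by simp
qed

lemma ratfun_minor:
  assumes M: "ratmat A U N d M" and J: "J \<subseteq> {..<N}" "card J = d"
  shows "ratfun A U (\<lambda>x. minor (M x) J)"
proof (rule ratfun_eqI)
  show "ratfun A U (\<lambda>x. det (mat d d (\<lambda>(a, b). M x $$ (pick J a, b))))"
    by (rule ratfun_det, rule ratmat_rows_cols[OF M, where g = "\<lambda>b. b"]) (auto intro: pick_less[OF J])
  fix x assume "x \<in> U"
  then have "M x \<in> carrier_mat N d" using M by (simp add: ratmat_def)
  then show "minor (M x) J = det (mat d d (\<lambda>(a, b). M x $$ (pick J a, b)))"
    using minor_rowsel[OF _ J] by (simp add: rowsel_def)
qed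

text \<open>Here the function is only given on \<open>U \<inter> X\<close>; the polynomial in its numerator extends it to an open set of the ambient product.\<close>

lemma openin_ratfun_nonzero_sub:
  assumes U: "openin (zariski A) U" and \<phi>: "ratfun A (U \<inter> X) \<phi>"
  shows "\<exists>V. openin (zariski A) V \<and> V \<subseteq> U \<and> V \<inter> X = {x \<in> U \<inter> X. \<phi> x \<noteq> 0}"
proof -
  obtain \<delta> f g where 1: "multihom A \<delta> f" "multihom A \<delta> g"
      "\<forall>y\<in>U \<inter> X. g (pluecker A y) \<noteq> 0 \<and> \<phi> y = f (pluecker A y) / g (pluecker A y)"
    using \<phi> by (auto simp: ratfun_def)
  let ?V = "U \<inter> {x \<in> points A. f (pluecker A x) \<noteq> 0}"
  have "openin (zariski A) ?V" using openin_Int[OF U openin_multihom_nonzero[OF 1(1)]] .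
  moreover have "?V \<inter> X = {x \<in> U \<inter> X. \<phi> x \<noteq> 0}"
    using 1(3) openin_subset[OF U] topspace_zariski by auto
  ultimately show ?thesis by blast
qed

text \<open>Constant combinations of the columns that are independent at one point stay independent nearby, since some minor stays nonzero. Thus the matrices \<open>M i\<close> may have more columns than the dimension of the subspaces that they span.\<close>

lemma morphism_local_frames:
  assumes h: "h x0 \<in> points B" and U: "openin (zariski A) U" "x0 \<in> U" "x0 \<in> X"
    and hX: "\<And>x. x \<in> X \<Longrightarrow> h x \<in> points B"
    and M: "\<And>i. i \<in> {1..factors B} \<Longrightarrow> ratmat A (U \<inter> X) (vdim B) (c i) (M i)"
      "\<And>i x. i \<in> {1..factors B} \<Longrightarrow> x \<in> U \<inter> X \<Longrightarrow> img (M i x) = h x i"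
  shows "\<exists>V L. openin (zariski A) V \<and> x0 \<in> V \<and> (\<forall>i\<in>{1..factors B}.
    ratmat A (V \<inter> X) (vdim B) (subdim B i) (L i) \<and> (\<forall>x\<in>V \<inter> X. img (L i x) = h x i))"
proof -
  let ?N = "vdim B" and ?d = "subdim B" and ?I = "{1..factors B}"
  have hG: "h x i \<in> Gr (?d i) ?N" if "x \<in> X" "i \<in> ?I" for x i
    using PiE_mem[OF hX[OF that(1), unfolded points_def] that(2)] .
  have "\<forall>i\<in>?I. \<exists>K J. K \<in> carrier_mat (c i) (?d i) \<and> J \<subseteq> {..<?N} \<and> card J = ?d i \<and> minor (M i x0 * K) J \<noteq> 0"
  proof
    fix i assume i: "i \<in> ?I"
    have Mc: "M i x0 \<in> carrier_mat ?N (c i)" using M(1)[OF i] U by (simp add: ratmat_def)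
    have "img (M i x0) \<in> Gr (?d i) ?N" using M(2)[OF i, of x0] U hG[OF _ i, of x0] by simp
    then obtain K where K: "K \<in> carrier_mat (c i) (?d i)" "inj_mat (M i x0 * K)" using col_choice[OF Mc] by blast
    have "M i x0 * K \<in> carrier_mat ?N (?d i)" using Mc K by simp
    from nonzero_minor[OF this K(2)] obtain J where "J \<subseteq> {..<?N}" "card J = ?d i" "minor (M i x0 * K) J \<noteq> 0"
      by blast
    then show "\<exists>K J. K \<in> carrier_mat (c i) (?d i) \<and> J \<subseteq> {..<?N} \<and> card J = ?d i \<and> minor (M i x0 * K) J \<noteq> 0"
      using K(1) by (intro exI conjI)
  qed
  then obtain K where "\<forall>i\<in>?I. \<exists>J. K i \<in> carrier_mat (c i) (?d i) \<and> J \<subseteq> {..<?N} \<and> card J = ?d i \<and> minor (M i x0 * K i) J \<noteq> 0"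
    by (rule bchoice[THEN exE])
  then obtain J where KJ: "\<forall>i\<in>?I. K i \<in> carrier_mat (c i) (?d i) \<and> J i \<subseteq> {..<?N} \<and> card (J i) = ?d i \<and> minor (M i x0 * K i) (J i) \<noteq> 0"
    by (rule bchoice[THEN exE])
  define L where "L i x = M i x * K i" for i x
  have L: "ratmat A (U \<inter> X) ?N (?d i) (L i)" if i: "i \<in> ?I" for i
    unfolding L_def by (rule ratmat_mult[OF M(1)[OF i] ratmat_const]) (use KJ i in blast)
  \<comment> \<open>Nonvanishing of one product keeps the chosen minors of all factors nonzero.\<close>
  let ?\<phi> = "\<lambda>x. \<Prod>i\<in>?I. minor (L i x) (J i)"
  have "ratfun A (U \<inter> X) ?\<phi>"
    by (rule ratfun_prod, rule ratfun_minor[OF L]) (use KJ in auto)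
  from openin_ratfun_nonzero_sub[OF U(1) this]
  obtain V where V: "openin (zariski A) V" "V \<subseteq> U" "V \<inter> X = {x \<in> U \<inter> X. ?\<phi> x \<noteq> 0}" by blast
  have "x0 \<in> V \<inter> X" unfolding V(3) using U KJ by (auto simp: L_def)
  moreover have "ratmat A (V \<inter> X) ?N (?d i) (L i) \<and> (\<forall>x\<in>V \<inter> X. img (L i x) = h x i)" if i: "i \<in> ?I" for i
  proof
    show "ratmat A (V \<inter> X) ?N (?d i) (L i)" by (rule ratmat_subset[OF L[OF i]]) (use V in auto)
    show "\<forall>x\<in>V \<inter> X. img (L i x) = h x i"
    proof
      fix x assume x: "x \<in> V \<inter> X"
      then have xU: "x \<in> U \<inter> X" and nz: "minor (L i x) (J i) \<noteq> 0" using V(3) i by auto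
      have Mc: "M i x \<in> carrier_mat ?N (c i)" using M(1)[OF i] xU by (simp add: ratmat_def)
      have Lc: "L i x \<in> carrier_mat ?N (?d i)" using L[OF i] xU by (simp add: ratmat_def)
      have Ji: "J i \<subseteq> {..<?N}" "card (J i) = ?d i" and Ki: "K i \<in> carrier_mat (c i) (?d i)" using KJ i by auto
      have "inj_mat (L i x)"
        using minor_nonzero_inj[OF Lc pick_less[OF Ji]] nz minor_rowsel[OF Lc Ji] by simp
      then have "img (L i x) \<in> Gr (?d i) ?N" by (rule Gr_img[OF Lc])
      moreover have "img (L i x) \<subseteq> h x i"
        using img_mult_subset[OF Mc Ki] M(2)[OF i xU] by (simp add: L_def)
      ultimately show "img (L i x) = h x i" using Gr_mono(2) hG[OF _ i] x by blast
    qed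
  qed
  ultimately show ?thesis using V(1) by blast
qed

text \<open>A map into a product of Grassmannians that is given, locally on \<open>X\<close>, by column spaces of matrices of regular functions is a morphism: pulled back along it, a multihomogeneous polynomial is up to a nonzero factor a polynomial in minors of these matrices, and the factors cancel in quotients of equal multidegree.\<close>

lemma variety_morphismI:
  assumes XA: "X \<subseteq> points A" and YB: "Y \<subseteq> points B" and h: "\<And>x. x \<in> X \<Longrightarrow> h x \<in> Y"
    and loc: "\<And>x0. x0 \<in> X \<Longrightarrow> \<exists>U M c. openin (zariski A) U \<and> x0 \<in> U \<and> (\<forall>i\<in>{1..factors B}.
      ratmat A (U \<inter> X) (vdim B) (c i) (M i) \<and> (\<forall>x\<in>U \<inter> X. img (M i x) = h x i))"
  shows "variety_morphism A X B Y h"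
proof -
  have loc': "\<exists>V L. openin (zariski A) V \<and> x0 \<in> V \<and> (\<forall>i\<in>{1..factors B}.
    ratmat A (V \<inter> X) (vdim B) (subdim B i) (L i) \<and> (\<forall>x\<in>V \<inter> X. img (L i x) = h x i))" if x0: "x0 \<in> X" for x0
  proof -
    obtain U M c where U: "openin (zariski A) U" "x0 \<in> U" "\<forall>i\<in>{1..factors B}.
      ratmat A (U \<inter> X) (vdim B) (c i) (M i) \<and> (\<forall>x\<in>U \<inter> X. img (M i x) = h x i)"
      using loc[OF x0] by (elim exE conjE)
    show ?thesis
      by (rule morphism_local_frames[OF _ U(1,2) x0, of h B c M]) (use U(3) h YB x0 in auto)
  qed
  have pull: "\<exists>V. openin (zariski A) V \<and> x0 \<in> V \<and> (\<exists>q. (\<forall>\<delta> f. multihom B \<delta> f \<longrightarrow> ratfun A (V \<inter> X) (\<lambda>x. f (q x))) \<and>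
      (\<forall>x\<in>V \<inter> X. \<exists>s. (\<forall>\<delta>. s \<delta> \<noteq> 0) \<and> (\<forall>\<delta> f. multihom B \<delta> f \<longrightarrow> f (pluecker B (h x)) = s \<delta> * f (q x))))"
    if x0: "x0 \<in> X" for x0
  proof -
    obtain V L where V: "openin (zariski A) V" "x0 \<in> V" and L: "\<forall>i\<in>{1..factors B}.
      ratmat A (V \<inter> X) (vdim B) (subdim B i) (L i) \<and> (\<forall>x\<in>V \<inter> X. img (L i x) = h x i)"
      using loc'[OF x0] by (elim exE conjE)
    let ?q = "\<lambda>x i. minor (L i x)"
    have "ratfun A (V \<inter> X) (\<lambda>x. f (?q x))" if "multihom B \<delta> f" for \<delta> f
      by (rule ratfun_multihom[OF that], rule ratfun_minor) (use L in auto)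
    moreover have "\<exists>s. (\<forall>\<delta>. s \<delta> \<noteq> 0) \<and> (\<forall>\<delta> f. multihom B \<delta> f \<longrightarrow> f (pluecker B (h x)) = s \<delta> * f (?q x))"
      if x: "x \<in> V \<inter> X" for x
    proof -
      have hp: "h x \<in> points B" using x h YB by blast
      have "L i x \<in> carrier_mat (vdim B) (subdim B i) \<and> img (L i x) = h x i" if "i \<in> {1..factors B}" for i
        using L that x unfolding ratmat_def by blast
      from multihom_minors[OF hp this] obtain c where c: "\<forall>i. c i \<noteq> 0"
        "\<forall>\<delta> f. multihom B \<delta> f \<longrightarrow> f (pluecker B (h x)) = (\<Prod>i\<in>{1..factors B}. c i ^ \<delta> i) * f (?q x)" by blast
      then show ?thesis by (intro exI[of _ "\<lambda>\<delta>. \<Prod>i\<in>{1..factors B}. c i ^ \<delta> i"]) simp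
    qed
    ultimately show ?thesis using V by (intro exI[of _ V] conjI exI[of _ ?q]) blast+
  qed
  have topA: "topspace (subtopology (zariski A) X) = X" and topB: "topspace (subtopology (zariski B) Y) = Y"
    using XA YB by (auto simp: topspace_zariski)
  have cont: "openin (subtopology (zariski A) X) {x \<in> X. h x \<in> W}"
    if W: "openin (subtopology (zariski B) Y) W" for W
  proof (subst openin_subopen, intro ballI)
    fix x0 assume "x0 \<in> {x \<in> X. h x \<in> W}"
    then have x0: "x0 \<in> X" "h x0 \<in> W" by auto
    obtain W' where W': "openin (zariski B) W'" "W = W' \<inter> Y" using W by (auto simp: openin_subtopology)
    obtain S where S: "\<forall>f\<in>S. \<exists>\<delta>. multihom B \<delta> f" "W' = {x \<in> points B. \<exists>f\<in>S. f (pluecker B x) \<noteq> 0}"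
      using W'(1) by (auto simp: openin_zariski zariski_open_def)
    obtain f \<delta> where f: "f \<in> S" "multihom B \<delta> f" "f (pluecker B (h x0)) \<noteq> 0" using S W' x0 by auto
    obtain V q where V: "openin (zariski A) V" "x0 \<in> V" "\<forall>\<delta> f. multihom B \<delta> f \<longrightarrow> ratfun A (V \<inter> X) (\<lambda>x. f (q x))"
      "\<forall>x\<in>V \<inter> X. \<exists>s. (\<forall>\<delta>. s \<delta> \<noteq> 0) \<and> (\<forall>\<delta> f. multihom B \<delta> f \<longrightarrow> f (pluecker B (h x)) = s \<delta> * f (q x))"
      using pull[OF x0(1)] by (elim exE conjE)
    have nz: "f (pluecker B (h x)) \<noteq> 0 \<longleftrightarrow> f (q x) \<noteq> 0" if x: "x \<in> V \<inter> X" for x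
    proof -
      obtain s where s: "\<forall>\<delta>. s \<delta> \<noteq> 0" "\<forall>\<delta> f. multihom B \<delta> f \<longrightarrow> f (pluecker B (h x)) = s \<delta> * f (q x)"
        using V(4) x by blast
      have "f (pluecker B (h x)) = s \<delta> * f (q x)" "s \<delta> \<noteq> 0" using s f(2) by blast+
      then show ?thesis by simp
    qed
    have "ratfun A (V \<inter> X) (\<lambda>x. f (q x))" using V(3) f(2) by blast
    from openin_ratfun_nonzero_sub[OF V(1) this] obtain V' where V': "openin (zariski A) V'"
      "V' \<inter> X = {x \<in> V \<inter> X. f (q x) \<noteq> 0}" by blast
    have "openin (subtopology (zariski A) X) (V' \<inter> X)" using V'(1) by (auto simp: openin_subtopology)
    moreover have "x0 \<in> V' \<inter> X" unfolding V'(2) using nz f(3) V(2) x0 by simp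
    moreover have "V' \<inter> X \<subseteq> {x \<in> X. h x \<in> W}"
    proof
      fix x assume "x \<in> V' \<inter> X"
      then have x: "x \<in> V \<inter> X" "f (q x) \<noteq> 0" using V'(2) by auto
      then have "h x \<in> Y" "f (pluecker B (h x)) \<noteq> 0" using h nz by auto
      then have "h x \<in> W" unfolding W'(2) S(2) using YB f(1) by blast
      then show "x \<in> {x \<in> X. h x \<in> W}" using x by simp
    qed
    ultimately show "\<exists>T. openin (subtopology (zariski A) X) T \<and> x0 \<in> T \<and> T \<subseteq> {x \<in> X. h x \<in> W}" by blast
  qed
  show ?thesis unfolding variety_morphism_def
  proof (intro conjI allI impI)
    show "continuous_map (subtopology (zariski A) X) (subtopology (zariski B) Y) h"
      unfolding continuous_map_def topA topB using h cont by auto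
  next
    fix W \<phi> assume reg: "regular_on B Y W \<phi>"
    then have W: "openin (subtopology (zariski B) Y) W" by (simp add: regular_on_def)
    show "regular_on A X {x \<in> X. h x \<in> W} (\<phi> \<circ> h)"
      unfolding regular_on_def
    proof (intro conjI ballI cont[OF W])
      fix x0 assume "x0 \<in> {x \<in> X. h x \<in> W}"
      then have x0: "x0 \<in> X" "h x0 \<in> W" by auto
      obtain W' where W': "openin (subtopology (zariski B) Y) W'" "h x0 \<in> W'" "W' \<subseteq> W"
        "\<exists>\<delta> f g. multihom B \<delta> f \<and> multihom B \<delta> g \<and>
           (\<forall>y\<in>W'. g (pluecker B y) \<noteq> 0 \<and> \<phi> y = f (pluecker B y) / g (pluecker B y))"
        using reg x0(2) unfolding regular_on_def by (elim conjE) (drule (1) bspec, elim exE conjE, blast)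
      obtain \<delta> f g where fg: "multihom B \<delta> f" "multihom B \<delta> g"
           "\<forall>y\<in>W'. g (pluecker B y) \<noteq> 0 \<and> \<phi> y = f (pluecker B y) / g (pluecker B y)"
        using W'(4) by (elim exE conjE)
      obtain V q where V: "openin (zariski A) V" "x0 \<in> V" "\<forall>\<delta> f. multihom B \<delta> f \<longrightarrow> ratfun A (V \<inter> X) (\<lambda>x. f (q x))"
        "\<forall>x\<in>V \<inter> X. \<exists>s. (\<forall>\<delta>. s \<delta> \<noteq> 0) \<and> (\<forall>\<delta> f. multihom B \<delta> f \<longrightarrow> f (pluecker B (h x)) = s \<delta> * f (q x))"
        using pull[OF x0(1)] by (elim exE conjE)
      let ?T = "{x \<in> X. h x \<in> W'} \<inter> (V \<inter> X)"
      have op: "openin (subtopology (zariski A) X) ?T"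
        by (rule openin_Int[OF cont[OF W'(1)]]) (use V(1) in \<open>auto simp: openin_subtopology\<close>)
      have val: "g (q x) \<noteq> 0 \<and> \<phi> (h x) = f (q x) / g (q x)" if x: "x \<in> ?T" for x
      proof -
        obtain s where s: "\<forall>\<delta>. s \<delta> \<noteq> 0" "\<forall>\<delta> f. multihom B \<delta> f \<longrightarrow> f (pluecker B (h x)) = s \<delta> * f (q x)"
          using V(4) x by blast
        have "g (pluecker B (h x)) \<noteq> 0 \<and> \<phi> (h x) = f (pluecker B (h x)) / g (pluecker B (h x))"
          using fg(3) x by simp
        moreover have "f (pluecker B (h x)) = s \<delta> * f (q x)" "g (pluecker B (h x)) = s \<delta> * g (q x)" "s \<delta> \<noteq> 0"
          using s fg(1,2) by blast+
        ultimately show ?thesis by simp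
      qed
      have "ratfun A ?T (\<lambda>x. f (q x) / g (q x))"
        using V(3) fg(1,2) val by (intro ratfun_divide) (auto intro: ratfun_subset)
      then have "ratfun A ?T (\<phi> \<circ> h)" by (rule ratfun_eqI) (use val in simp)
      then have "\<exists>\<delta> f g. multihom A \<delta> f \<and> multihom A \<delta> g \<and>
           (\<forall>y\<in>?T. g (pluecker A y) \<noteq> 0 \<and> (\<phi> \<circ> h) y = f (pluecker A y) / g (pluecker A y))"
        by (simp only: ratfun_def)
      moreover have "x0 \<in> ?T" "?T \<subseteq> {x \<in> X. h x \<in> W}" using x0 W' V(2) by auto
      ultimately show "\<exists>U'. openin (subtopology (zariski A) X) U' \<and> x0 \<in> U' \<and> U' \<subseteq> {x \<in> X. h x \<in> W} \<and>
        (\<exists>\<delta> f g. multihom A \<delta> f \<and> multihom A \<delta> g \<and>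
           (\<forall>y\<in>U'. g (pluecker A y) \<noteq> 0 \<and> (\<phi> \<circ> h) y = f (pluecker A y) / g (pluecker A y)))"
        using op by blast
    qed
  qed
qed

section \<open>The comparison map and the two bilinear forms\<close>

definition coord_sub :: "nat \<Rightarrow> nat set \<Rightarrow> complex vec set" where
  "coord_sub N A = {v \<in> carrier_vec N. \<forall>j<N. j \<notin> A \<longrightarrow> v $ j = 0}"

lemma coord_sub_lin: "lin_sub N (coord_sub N A)"
  by (rule lin_subI) (auto simp: coord_sub_def)

text \<open>The unit vectors themselves form a frame; the last conclusion serves to check inclusions of coordinate subspaces on unit vectors.\<close>

lemma coord_sub_frame:
  assumes A: "A \<subseteq> {..<N}"
  obtains M where "M \<in> carrier_mat N (card A)" "inj_mat M" "img M = coord_sub N A"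
    "\<forall>b<card A. \<exists>a\<in>A. col M b = unit_vec N a"
proof -
  let ?d = "card A"
  have fin: "finite A" using A finite_subset by blast
  note bij = pick_bij[OF fin]
  have pk: "pick A b \<in> A" "pick A b < N" if "b < ?d" for b using pick_in_set_le[of b A] that A by auto
  define M :: "complex mat" where "M = mat N ?d (\<lambda>(r, b). if r = pick A b then 1 else 0)"
  have M: "M \<in> carrier_mat N ?d" by (simp add: M_def)
  have col: "col M b = unit_vec N (pick A b)" if "b < ?d" for b
    using that pk[OF that] by (intro eq_vecI) (auto simp: M_def)
  have "rowsel ?d (pick A) M = 1\<^sub>m ?d"
    using pk bij by (intro eq_matI) (auto simp: rowsel_def M_def bij_betw_def inj_on_def)
  then have inj: "inj_mat M" using minor_nonzero_inj[OF M pk(2)] by simp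
  have "img M \<subseteq> coord_sub N A"
    by (rule img_subset[OF coord_sub_lin M]) (use col pk in \<open>auto simp: coord_sub_def\<close>)
  moreover have "coord_sub N A \<subseteq> img M"
  proof
    fix w assume w: "w \<in> coord_sub N A"
    define v where "v = vec ?d (\<lambda>b. w $ pick A b)"
    have "M *\<^sub>v v = w"
    proof (rule eq_vecI)
      fix r assume "r < dim_vec w"
      then have r: "r < N" using w by (auto simp: coord_sub_def)
      show "(M *\<^sub>v v) $ r = w $ r"
      proof (cases "r \<in> A")
        case True
        then obtain b where b: "b < ?d" "r = pick A b" using bij unfolding bij_betw_def by force
        have "row M r = unit_vec ?d b"
          using b r bij by (intro eq_vecI) (auto simp: M_def bij_betw_def inj_on_def)
        then show ?thesis using b r M by (simp add: v_def)
      next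
        case False
        then have "row M r = 0\<^sub>v ?d" using pk r by (intro eq_vecI) (auto simp: M_def)
        then show ?thesis using False r w M by (simp add: v_def coord_sub_def)
      qed
    qed (use M w in \<open>auto simp: coord_sub_def\<close>)
    then show "w \<in> img M" using imgI[OF M, of v] by (simp add: v_def)
  qed
  ultimately show thesis using that[OF M inj] col pk(1) by blast
qed

lemma coord_sub_Gr: "A \<subseteq> {..<N} \<Longrightarrow> coord_sub N A \<in> Gr (card A) N"
  using coord_sub_frame Gr_img by metis

text \<open>The member of dimension \<open>k\<close> of the standard complete flag.\<close>

definition std_sub :: "nat \<Rightarrow> nat \<Rightarrow> complex vec set" where
  "std_sub N k = {v \<in> carrier_vec N. \<forall>j<N. k \<le> j \<longrightarrow> v $ j = 0}"

lemma std_sub_lin: "lin_sub N (std_sub N k)"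
  by (rule lin_subI) (auto simp: std_sub_def)

lemma std_sub_mono: "k \<le> l \<Longrightarrow> std_sub N k \<subseteq> std_sub N l"
  by (auto simp: std_sub_def)

lemma std_sub_carrier: "std_sub N k \<subseteq> carrier_vec N"
  by (auto simp: std_sub_def)

lemma std_sub_coord: "std_sub N k = coord_sub N {..<k}"
  by (auto simp: coord_sub_def std_sub_def)

lemma std_sub_Gr: "k \<le> N \<Longrightarrow> std_sub N k \<in> Gr k N"
  using coord_sub_Gr[of "{..<k}" N] by (simp add: std_sub_coord)

locale window =
  fixes m n :: nat
  assumes m1: "1 \<le> m" and n: "n = 2 * m - 1"
begin

text \<open>Position in \<open>W\<close> of the basis vector number \<open>k\<close> of \<open>V\<close> for the \<open>i\<close>-th factor. Here \<open>k\<close> is 0-based and \<open>i\<close> is 1-based, so that \<open>i \<le> k + 1\<close> compares two 1-based indices.\<close>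

definition pos :: "nat \<Rightarrow> nat \<Rightarrow> nat" where
  "pos i k = (if i \<le> k + 1 then k else n + 1 + k)"

text \<open>The sign of the image of basis vector \<open>k\<close> in the \<open>i\<close>-th window. Nestedness of flags forces it to depend on \<open>i\<close> only through whether \<open>i \<le> k + 1\<close>. The pairing of window \<open>i\<close> with window \<open>n + 1 - i\<close> by \<open>b\<^sub>W\<close> changes sign at \<open>k + 1 = i\<close>, whereas \<open>b\<^sub>V\<close> changes sign at \<open>k + 1 = m\<close>, independently of \<open>i\<close>; the value \<open>-1\<close> makes up for the difference.\<close>

definition twist :: "nat \<Rightarrow> nat \<Rightarrow> complex" where
  "twist i k = (if i \<le> k + 1 then 1 else if k + 1 \<le> m - 1 then - 1 else 1)"

text \<open>Reads off the coordinates in the \<open>i\<close>-th window. Describing \<open>W\<^sub>i\<close> as a preimage under this map, rather than as \<open>E\<^sub>i\<^sub>-\<^sub>1\<close> plus an image, avoids sums of subspaces.\<close>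

definition proj :: "nat \<Rightarrow> complex mat" where
  "proj i = mat (n + 1) (2 * n) (\<lambda>(k, r). if r = pos i k then twist i k else 0)"

lemma proj_carrier: "proj i \<in> carrier_mat (n + 1) (2 * n)"
  by (simp add: proj_def)

lemma n1: "1 \<le> n" using m1 n by simp

lemma pos_less: "i \<in> {1..n} \<Longrightarrow> k < n + 1 \<Longrightarrow> pos i k < n + i \<and> i - 1 \<le> pos i k \<and> pos i k < 2 * n"
  by (auto simp: pos_def)

lemma twist_sq: "twist i k * twist i k = 1"
  by (simp add: twist_def)

lemma proj_index:
  assumes i: "i \<in> {1..n}" and w: "w \<in> carrier_vec (2 * n)" and k: "k < n + 1"
  shows "(proj i *\<^sub>v w) $ k = twist i k * w $ pos i k"
proof -
  have "row (proj i) k = twist i k \<cdot>\<^sub>v unit_vec (2 * n) (pos i k)"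
    using k pos_less[OF i k] by (intro eq_vecI) (auto simp: proj_def)
  then show ?thesis using k w pos_less[OF i k] proj_carrier[of i] by simp
qed

definition lift :: "nat \<Rightarrow> complex mat" where
  "lift i = transpose_mat (proj i)"

lemma lift_mat_carrier: "lift i \<in> carrier_mat (2 * n) (n + 1)"
  using proj_carrier by (simp add: lift_def)

lemma lift_carrier [simp]: "v \<in> carrier_vec (n + 1) \<Longrightarrow> lift i *\<^sub>v v \<in> carrier_vec (2 * n)"
  by (rule mult_mat_vec_carrier[OF lift_mat_carrier])

lemma lift_std:
  assumes i: "i \<in> {1..n}" and v: "v \<in> carrier_vec (n + 1)" shows "lift i *\<^sub>v v \<in> std_sub (2 * n) (n + i)"
proof -
  have "(lift i *\<^sub>v v) $ r = 0" if r: "r < 2 * n" "n + i \<le> r" for r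
  proof -
    have "row (lift i) r = 0\<^sub>v (n + 1)"
    proof (rule eq_vecI)
      fix k assume "k < dim_vec (0\<^sub>v (n + 1) :: complex vec)"
      then have k: "k < n + 1" by simp
      have "r \<noteq> pos i k" using pos_less[OF i k] r by linarith
      then show "row (lift i) r $ k = 0\<^sub>v (n + 1) $ k" using r k by (simp add: lift_def proj_def)
    qed (simp add: lift_def proj_def)
    then show ?thesis using r v lift_mat_carrier[of i] by simp
  qed
  then show ?thesis using lift_carrier[OF v] by (simp add: std_sub_def)
qed

lemma pos_inj: "k < n + 1 \<Longrightarrow> l < n + 1 \<Longrightarrow> pos i k = pos i l \<Longrightarrow> k = l"
  unfolding pos_def by (simp split: if_splits)

lemma proj_lift:
  assumes i: "i \<in> {1..n}" and v: "v \<in> carrier_vec (n + 1)"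
  shows "proj i *\<^sub>v (lift i *\<^sub>v v) = v"
proof (rule eq_vecI)
  fix k assume "k < dim_vec v"
  then have k: "k < n + 1" using v by simp
  have p: "pos i k < 2 * n" using pos_less[OF i k] by simp
  have "row (lift i) (pos i k) = twist i k \<cdot>\<^sub>v unit_vec (n + 1) k"
  proof (rule eq_vecI)
    fix l assume "l < dim_vec (twist i k \<cdot>\<^sub>v unit_vec (n + 1) k)"
    then have l: "l < n + 1" by simp
    \<comment> \<open>Each row of \<open>lift i\<close> in the window has a single nonzero entry.\<close>
    have "pos i k = pos i l \<longleftrightarrow> l = k" using pos_inj[OF k l] by blast
    then show "row (lift i) (pos i k) $ l = (twist i k \<cdot>\<^sub>v unit_vec (n + 1) k) $ l"
      using p k l by (simp add: lift_def proj_def)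
  qed (simp add: lift_def proj_def)
  then have "(lift i *\<^sub>v v) $ pos i k = twist i k * v $ k"
    using k p v lift_mat_carrier[of i] smult_scalar_prod_distrib[OF unit_vec_carrier v, of "twist i k" k] by simp
  then show "(proj i *\<^sub>v (lift i *\<^sub>v v)) $ k = v $ k"
    unfolding proj_index[OF i lift_carrier[OF v] k] using twist_sq[of i k] by (simp flip: mult.assoc)
qed (use v proj_carrier in \<open>auto simp: proj_def\<close>)

text \<open>On \<open>E\<^sub>n\<^sub>+\<^sub>i\<close> only the coordinates in front of the window are lost.\<close>

lemma proj_kernel:
  assumes i: "i \<in> {1..n}"
  shows "{w \<in> std_sub (2 * n) (n + i). proj i *\<^sub>v w = 0\<^sub>v (n + 1)} = std_sub (2 * n) (i - 1)"
proof (intro equalityI subsetI)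
  fix w assume w: "w \<in> {w \<in> std_sub (2 * n) (n + i). proj i *\<^sub>v w = 0\<^sub>v (n + 1)}"
  then have wc: "w \<in> carrier_vec (2 * n)" by (simp add: std_sub_def)
  have "w $ r = 0" if r: "r < 2 * n" "i - 1 \<le> r" for r
  proof (cases "r < n + i")
    case True
    define k where "k = (if r \<le> n then r else r - (n + 1))"
    have k: "k < n + 1" "pos i k = r" using True r i by (auto simp: k_def pos_def)
    have "twist i k * w $ r = 0" using proj_index[OF i wc k(1)] w k by simp
    then show ?thesis using twist_sq[of i k] by (metis mult_cancel_right1 mult_eq_0_iff zero_neq_one)
  next
    case False
    then show ?thesis using w r by (simp add: std_sub_def)
  qed
  then show "w \<in> std_sub (2 * n) (i - 1)" using wc by (simp add: std_sub_def)
next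
  fix w assume w: "w \<in> std_sub (2 * n) (i - 1)"
  then have wc: "w \<in> carrier_vec (2 * n)" by (simp add: std_sub_def)
  have "proj i *\<^sub>v w = 0\<^sub>v (n + 1)"
  proof (rule eq_vecI)
    fix k assume "k < dim_vec (0\<^sub>v (n + 1) :: complex vec)"
    then have k: "k < n + 1" by simp
    show "(proj i *\<^sub>v w) $ k = 0\<^sub>v (n + 1) $ k"
      using proj_index[OF i wc k] pos_less[OF i k] w k by (simp add: std_sub_def)
  qed (simp add: proj_def)
  moreover have "w \<in> std_sub (2 * n) (n + i)" using w std_sub_mono[of "i - 1" "n + i" "2 * n"] i by (meson diff_le_self le_trans subsetD trans_le_add2)
  ultimately show "w \<in> {w \<in> std_sub (2 * n) (n + i). proj i *\<^sub>v w = 0\<^sub>v (n + 1)}" by simp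
qed

text \<open>The heart of the comparison: from window \<open>i\<close> to window \<open>i + 1\<close> the basis vector \<open>f\<^sub>i\<close> jumps from the first position of the old window to the last position of the new one, where vectors of \<open>E\<^sub>n\<^sub>+\<^sub>i\<close> have coordinate \<open>0\<close>. This is exactly the effect of \<open>pr i\<close>.\<close>

lemma proj_Suc:
  assumes i: "i \<in> {1..n - 1}" and w: "w \<in> std_sub (2 * n) (n + i)"
  shows "proj (i + 1) *\<^sub>v w = pr i (proj i *\<^sub>v w)"
proof (rule eq_vecI)
  have wc: "w \<in> carrier_vec (2 * n)" using w by (simp add: std_sub_def)
  have i1: "i \<in> {1..n}" "i + 1 \<in> {1..n}" using i by auto
  fix k assume "k < dim_vec (pr i (proj i *\<^sub>v w))"
  then have k: "k < n + 1" by (simp add: pr_def proj_def)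
  have "(pr i (proj i *\<^sub>v w)) $ k = (if k = i - 1 then 0 else (proj i *\<^sub>v w) $ k)"
    using k by (simp add: pr_def proj_def)
  also have "\<dots> = twist (i + 1) k * w $ pos (i + 1) k"
  proof (cases "k = i - 1")
    case True
    then have "pos (i + 1) k = n + i" "n + i < 2 * n" using i by (auto simp: pos_def)
    then show ?thesis using w True by (simp add: std_sub_def)
  next
    case False
    then have "pos (i + 1) k = pos i k" "twist (i + 1) k = twist i k" using i by (auto simp: pos_def twist_def)
    then show ?thesis using False proj_index[OF i1(1) wc k] by simp
  qed
  finally show "(proj (i + 1) *\<^sub>v w) $ k = (pr i (proj i *\<^sub>v w)) $ k"
    using proj_index[OF i1(2) wc k] by simp
qed (simp add: pr_def proj_def)

lemma lift_Gr:
  assumes i: "i \<in> {1..n}" and V: "V \<in> Gr i (n + 1)"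
  shows "{w \<in> std_sub (2 * n) (n + i). proj i *\<^sub>v w \<in> V} \<in> Gr (2 * i - 1) (2 * n)" (is "?U \<in> _")
proof -
  note Vs = lin_subD[OF Gr_lin_sub[OF V]]
  have p0: "proj i *\<^sub>v 0\<^sub>v (2 * n) = 0\<^sub>v (n + 1)" by (rule mult_zero_vec[OF proj_carrier])
  have "lin_sub (2 * n) ?U"
  proof (rule lin_subI)
    fix u v c assume u: "u \<in> ?U"
    then have uc: "u \<in> carrier_vec (2 * n)" using std_sub_carrier by blast
    show "c \<cdot>\<^sub>v u \<in> ?U" using u lin_subD(4)[OF std_sub_lin] Vs(4) mult_mat_vec[OF proj_carrier uc] by auto
    assume v: "v \<in> ?U"
    then have vc: "v \<in> carrier_vec (2 * n)" using std_sub_carrier by blast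
    show "u + v \<in> ?U"
      using u v lin_subD(3)[OF std_sub_lin] Vs(3) mult_add_distrib_mat_vec[OF proj_carrier uc vc] by auto
  qed (use std_sub_carrier p0 Vs(2) lin_subD(2)[OF std_sub_lin] in auto)
  then obtain d where d: "?U \<in> Gr d (2 * n)" using lin_sub_Gr by blast
  have "{u \<in> ?U. proj i *\<^sub>v u = 0\<^sub>v (n + 1)} = {w \<in> std_sub (2 * n) (n + i). proj i *\<^sub>v w = 0\<^sub>v (n + 1)}"
    using Vs(2) by auto
  also note proj_kernel[OF i]
  finally have "{u \<in> ?U. proj i *\<^sub>v u = 0\<^sub>v (n + 1)} = std_sub (2 * n) (i - 1)" .
  then have K: "{u \<in> ?U. proj i *\<^sub>v u = 0\<^sub>v (n + 1)} \<in> Gr (i - 1) (2 * n)"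
    using std_sub_Gr[of "i - 1" "2 * n"] i by auto
  have "(\<lambda>w. proj i *\<^sub>v w) ` ?U = V"
  proof
    show "V \<subseteq> (\<lambda>w. proj i *\<^sub>v w) ` ?U"
    proof
      fix v assume v: "v \<in> V"
      then have "v \<in> carrier_vec (n + 1)" using Vs(1) by blast
      then show "v \<in> (\<lambda>w. proj i *\<^sub>v w) ` ?U"
        using v proj_lift[OF i] lift_std[OF i] by (intro image_eqI[of _ _ "lift i *\<^sub>v v"]) auto
    qed
  qed auto
  then have "d = i - 1 + i" using rank_nullity[OF d proj_carrier K, of i] V by simp
  then show ?thesis using d i by (simp add: mult_2)
qed

lemma proj_Gr:
  assumes i: "i \<in> {1..n}" and W: "W \<in> Gr (2 * i - 1) (2 * n)" "std_sub (2 * n) (i - 1) \<subseteq> W" "W \<subseteq> std_sub (2 * n) (n + i)"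
  shows "(\<lambda>w. proj i *\<^sub>v w) ` W \<in> Gr i (n + 1)"
proof -
  obtain j where j: "(\<lambda>w. proj i *\<^sub>v w) ` W \<in> Gr j (n + 1)"
    using lin_sub_Gr[OF lin_sub_image[OF Gr_lin_sub[OF W(1)] proj_carrier]] by blast
  have "{u \<in> W. proj i *\<^sub>v u = 0\<^sub>v (n + 1)} = std_sub (2 * n) (i - 1)"
    using proj_kernel[OF i] W(2,3) by blast
  then have K: "{u \<in> W. proj i *\<^sub>v u = 0\<^sub>v (n + 1)} \<in> Gr (i - 1) (2 * n)"
    using std_sub_Gr[of "i - 1" "2 * n"] i by auto
  have "j = i" using rank_nullity[OF W(1) proj_carrier K j] i by auto
  then show ?thesis using j by simp
qed

lemma index_succ: "i \<in> {1..n - 1} \<Longrightarrow> i \<in> {1..n} \<and> i + 1 \<in> {1..n}"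
  by auto

text \<open>The image of the degenerate flag variety, and in the end the Schubert variety.\<close>

definition flags_W :: "subspaces set" where
  "flags_W = {y \<in> SL_mod_P n. \<forall>i\<in>{1..n}. std_sub (2 * n) (i - 1) \<subseteq> y i \<and> y i \<subseteq> std_sub (2 * n) (n + i)}"

definition zeta :: "subspaces \<Rightarrow> subspaces" where
  "zeta x = (\<lambda>i\<in>{1..n}. {w \<in> std_sub (2 * n) (n + i). proj i *\<^sub>v w \<in> x i})"

definition zeta_inv :: "subspaces \<Rightarrow> subspaces" where
  "zeta_inv y = (\<lambda>i\<in>{1..n}. (\<lambda>w. proj i *\<^sub>v w) ` y i)"

lemma deg_flags_Gr: "x \<in> deg_flags n \<Longrightarrow> i \<in> {1..n} \<Longrightarrow> x i \<in> Gr i (n + 1)"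
  using PiE_mem by (fastforce simp: deg_flags_def points_def ambV_def)

lemma flags_W_Gr: "y \<in> SL_mod_P n \<Longrightarrow> i \<in> {1..n} \<Longrightarrow> y i \<in> Gr (2 * i - 1) (2 * n)"
  using PiE_mem by (fastforce simp: SL_mod_P_def points_def ambW_def)

lemma zeta_flags:
  assumes x: "x \<in> deg_flags n" shows "zeta x \<in> flags_W"
proof -
  have G: "zeta x i \<in> Gr (2 * i - 1) (2 * n)" if "i \<in> {1..n}" for i
    using lift_Gr[OF that deg_flags_Gr[OF x that]] that by (simp add: zeta_def)
  have "zeta x \<in> points (ambW n)"
    unfolding points_def ambW_def using G by (auto simp: zeta_def PiE_iff)
  moreover have "zeta x i \<subseteq> zeta x (i + 1)" if i: "i \<in> {1..n - 1}" for i
  proof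
    fix w assume "w \<in> zeta x i"
    then have w: "w \<in> std_sub (2 * n) (n + i)" "proj i *\<^sub>v w \<in> x i"
      using index_succ[OF i] by (auto simp: zeta_def)
    have "pr i ` x i \<subseteq> x (i + 1)" using x i unfolding deg_flags_def by blast
    then have "pr i (proj i *\<^sub>v w) \<in> x (i + 1)" using w(2) by blast
    then have "proj (i + 1) *\<^sub>v w \<in> x (i + 1)" using proj_Suc[OF i w(1)] by simp
    moreover have "w \<in> std_sub (2 * n) (n + (i + 1))" using w(1) std_sub_mono[of "n + i" "n + (i + 1)"] by auto
    ultimately show "w \<in> zeta x (i + 1)" using index_succ[OF i] by (auto simp: zeta_def)
  qed
  moreover have "std_sub (2 * n) (i - 1) \<subseteq> zeta x i \<and> zeta x i \<subseteq> std_sub (2 * n) (n + i)" if i: "i \<in> {1..n}" for i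
    using proj_kernel[OF i] lin_subD(2)[OF Gr_lin_sub[OF deg_flags_Gr[OF x i]]] i by (fastforce simp: zeta_def)
  ultimately show ?thesis by (simp add: flags_W_def SL_mod_P_def)
qed

lemma zeta_inv_flags:
  assumes y: "y \<in> flags_W" shows "zeta_inv y \<in> deg_flags n"
proof -
  have yP: "y \<in> SL_mod_P n" and yE: "\<And>i. i \<in> {1..n} \<Longrightarrow> std_sub (2 * n) (i - 1) \<subseteq> y i \<and> y i \<subseteq> std_sub (2 * n) (n + i)"
    using y by (auto simp: flags_W_def)
  have G: "zeta_inv y i \<in> Gr i (n + 1)" if "i \<in> {1..n}" for i
    using proj_Gr[OF that flags_W_Gr[OF yP that]] yE[OF that] that by (simp add: zeta_inv_def)
  have "zeta_inv y \<in> points (ambV n)"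
    unfolding points_def ambV_def using G by (auto simp: zeta_inv_def PiE_iff)
  moreover have "pr i ` zeta_inv y i \<subseteq> zeta_inv y (i + 1)" if i: "i \<in> {1..n - 1}" for i
  proof
    fix v assume "v \<in> pr i ` zeta_inv y i"
    then obtain w where w: "w \<in> y i" "v = pr i (proj i *\<^sub>v w)"
      using index_succ[OF i] by (auto simp: zeta_inv_def)
    have "w \<in> std_sub (2 * n) (n + i)" using yE[of i] index_succ[OF i] w(1) by blast
    then have "v = proj (i + 1) *\<^sub>v w" using proj_Suc[OF i] w(2) by simp
    moreover have "w \<in> y (i + 1)" using yP i w(1) by (auto simp: SL_mod_P_def)
    ultimately show "v \<in> zeta_inv y (i + 1)" using index_succ[OF i] by (auto simp: zeta_inv_def)
  qed
  ultimately show ?thesis by (simp add: deg_flags_def)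
qed

lemma zeta_inv_zeta:
  assumes x: "x \<in> deg_flags n" shows "zeta_inv (zeta x) = x"
proof
  fix i
  show "zeta_inv (zeta x) i = x i"
  proof (cases "i \<in> {1..n}")
    case True
    have "(\<lambda>w. proj i *\<^sub>v w) ` {w \<in> std_sub (2 * n) (n + i). proj i *\<^sub>v w \<in> x i} = x i"
    proof
      show "x i \<subseteq> (\<lambda>w. proj i *\<^sub>v w) ` {w \<in> std_sub (2 * n) (n + i). proj i *\<^sub>v w \<in> x i}"
      proof
        fix v assume v: "v \<in> x i"
        then have "v \<in> carrier_vec (n + 1)" using Gr_carrier[OF deg_flags_Gr[OF x True]] by blast
        then show "v \<in> (\<lambda>w. proj i *\<^sub>v w) ` {w \<in> std_sub (2 * n) (n + i). proj i *\<^sub>v w \<in> x i}"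
          using v proj_lift[OF True] lift_std[OF True] by (intro image_eqI[of _ _ "lift i *\<^sub>v v"]) auto
      qed
    qed auto
    then show ?thesis using True by (simp add: zeta_def zeta_inv_def)
  next
    case False
    have "x i = undefined" using x False by (auto simp: deg_flags_def points_def ambV_def PiE_def extensional_def)
    then show ?thesis using False by (simp add: zeta_inv_def del: atLeastAtMost_iff)
  qed
qed

lemma zeta_zeta_inv:
  assumes y: "y \<in> flags_W" shows "zeta (zeta_inv y) = y"
proof
  fix i
  have yP: "y \<in> SL_mod_P n" using y by (simp add: flags_W_def)
  show "zeta (zeta_inv y) i = y i"
  proof (cases "i \<in> {1..n}")
    case True
    have yE: "std_sub (2 * n) (i - 1) \<subseteq> y i" "y i \<subseteq> std_sub (2 * n) (n + i)"
      using y True by (auto simp: flags_W_def)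
    note lin = Gr_lin_sub[OF flags_W_Gr[OF yP True]]
    have "w \<in> y i" if w: "w \<in> std_sub (2 * n) (n + i)" and u: "u \<in> y i" and eq: "proj i *\<^sub>v w = proj i *\<^sub>v u" for w u
    proof -
      have c: "w \<in> carrier_vec (2 * n)" "u \<in> carrier_vec (2 * n)" using w u yE std_sub_carrier by blast+
      have "proj i *\<^sub>v (w - u) = proj i *\<^sub>v w - proj i *\<^sub>v u"
        by (rule mult_minus_distrib_mat_vec[OF proj_carrier c])
      also have "\<dots> = 0\<^sub>v (n + 1)" unfolding eq using mult_mat_vec_carrier[OF proj_carrier c(2)] by simp
      finally have "w - u \<in> std_sub (2 * n) (i - 1)"
        using proj_kernel[OF True] lin_sub_minus[OF std_sub_lin w] u yE by blast
      then have "u + (w - u) \<in> y i" using lin_subD(3)[OF lin u] yE by blast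
      moreover have "u + (w - u) = w" using c by (intro eq_vecI) auto
      ultimately show ?thesis by simp
    qed
    then have "{w \<in> std_sub (2 * n) (n + i). proj i *\<^sub>v w \<in> (\<lambda>w. proj i *\<^sub>v w) ` y i} = y i" using yE by blast
    then show ?thesis using True by (simp add: zeta_def zeta_inv_def)
  next
    case False
    have "y i = undefined" using yP False by (auto simp: SL_mod_P_def points_def ambW_def PiE_def extensional_def)
    then show ?thesis using False by (simp add: zeta_def del: atLeastAtMost_iff)
  qed
qed

lemma mn: "2 * m = n + 1" using m1 n by simp

text \<open>The index that pairs with \<open>k\<close> under \<open>b\<^sub>V\<close>, and whether the pairing is \<open>+1\<close> when \<open>k\<close> comes first (both 0-based).\<close>

definition dual :: "nat \<Rightarrow> nat" where
  "dual k = (if k + 2 \<le> n then n - 2 - k else if k = n - 1 then n else n - 1)"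

definition dual_pos :: "nat \<Rightarrow> bool" where
  "dual_pos k \<longleftrightarrow> k + 1 \<le> m - 1 \<or> k = n - 1"

lemma dual_less: "k < n + 1 \<Longrightarrow> dual k < n + 1"
  by (auto simp: dual_def)

lemma dual_cases:
  assumes "k < n + 1"
  obtains "k + 2 \<le> n" "dual k = n - 2 - k" "dual_pos k \<longleftrightarrow> k + 1 \<le> m - 1"
    | "k = n - 1" "dual k = n" "dual_pos k"
    | "k = n" "dual k = n - 1" "\<not> dual_pos k"
proof -
  consider "k + 2 \<le> n" | "k = n - 1" | "k = n" using assms by linarith
  then show thesis
  proof cases
    case 1 then show thesis using n1 by (intro that(1)) (auto simp: dual_def dual_pos_def)
  next
    case 2 then show thesis using n1 by (intro that(2)) (auto simp: dual_def dual_pos_def)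
  next
    case 3 then show thesis using n1 mn by (intro that(3)) (auto simp: dual_def dual_pos_def)
  qed
qed

lemma bV_one_dual:
  assumes "k < n + 1" "j < n + 1"
  shows "bV_one m (k + 1) (j + 1) \<longleftrightarrow> j = dual k \<and> dual_pos k"
    "bV_one m (j + 1) (k + 1) \<longleftrightarrow> j = dual k \<and> \<not> dual_pos k"
proof -
  have "(bV_one m (k + 1) (j + 1) \<longleftrightarrow> j = dual k \<and> dual_pos k) \<and> (bV_one m (j + 1) (k + 1) \<longleftrightarrow> j = dual k \<and> \<not> dual_pos k)"
    using assms(1)
  proof (cases rule: dual_cases)
    case 1 then show ?thesis using assms mn by (auto simp: bV_one_def)
  next
    case 2 then show ?thesis using assms mn n1 by (auto simp: bV_one_def)
  next
    case 3 then show ?thesis using assms mn n1 by (auto simp: bV_one_def)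
  qed
  then show "bV_one m (k + 1) (j + 1) \<longleftrightarrow> j = dual k \<and> dual_pos k"
    "bV_one m (j + 1) (k + 1) \<longleftrightarrow> j = dual k \<and> \<not> dual_pos k" by blast+
qed

lemma gramV_carrier: "gramV m \<in> carrier_mat (n + 1) (n + 1)"
  by (simp add: gramV_def mn)

lemma gramV_row:
  assumes k: "k < n + 1"
  shows "row (gramV m) k = (if dual_pos k then 1 else - 1) \<cdot>\<^sub>v unit_vec (n + 1) (dual k)"
proof (rule eq_vecI)
  fix j assume "j < dim_vec ((if dual_pos k then 1 else - 1) \<cdot>\<^sub>v unit_vec (n + 1) (dual k) :: complex vec)"
  then have j: "j < n + 1" by simp
  show "row (gramV m) k $ j = ((if dual_pos k then 1 else - 1) \<cdot>\<^sub>v unit_vec (n + 1) (dual k)) $ j"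
    using bV_one_dual[OF k j] j k dual_less[OF k] by (simp add: gramV_def mn)
qed (simp add: gramV_def mn)

lemma pos_dual:
  assumes "i \<in> {1..n}" "k < n + 1"
  shows "pos (n + 1 - i) (dual k) = 2 * n - 1 - pos i k"
  using assms(2)
proof (cases rule: dual_cases)
  case 1 then show ?thesis using assms by (auto simp: pos_def)
next
  case 2 then show ?thesis using assms n1 by (auto simp: pos_def)
next
  case 3 then show ?thesis using assms n1 by (auto simp: pos_def)
qed

lemma twist_dual:
  assumes "i \<in> {1..n}" "k < n + 1"
  shows "twist i k * ((if dual_pos k then 1 else - 1) * twist (n + 1 - i) (dual k)) = (if pos i k < n then 1 else - 1)"
  using assms(2)
proof (cases rule: dual_cases)
  case 1 then show ?thesis using assms mn by (auto simp: pos_def twist_def)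
next
  case 2 then show ?thesis using assms n1 mn by (auto simp: pos_def twist_def)
next
  case 3 then show ?thesis using assms n1 mn by (auto simp: pos_def twist_def)
qed

lemma E_mat_row:
  assumes r: "r < 2 * n"
  shows "row (E_mat n) r = (if r < n then 1 else - 1) \<cdot>\<^sub>v unit_vec (2 * n) (2 * n - 1 - r)"
proof (rule eq_vecI)
  fix j assume "j < dim_vec ((if r < n then 1 else - 1) \<cdot>\<^sub>v unit_vec (2 * n) (2 * n - 1 - r) :: complex vec)"
  then have j: "j < 2 * n" by simp
  have "row (E_mat n) r $ j = E_mat n $$ (r, j)" using j r E_mat_carrier[of n] by simp
  also have "\<dots> = ((if r < n then 1 else - 1) \<cdot>\<^sub>v unit_vec (2 * n) (2 * n - 1 - r)) $ j"
    using j r by (auto simp: E_mat_def J_mat_def)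
  finally show "row (E_mat n) r $ j = ((if r < n then 1 else - 1) \<cdot>\<^sub>v unit_vec (2 * n) (2 * n - 1 - r)) $ j" .
qed (use E_mat_carrier[of n] in auto)

text \<open>Both forms pair each basis vector with exactly one other, and the windows \<open>i\<close> and \<open>n + 1 - i\<close> correspond under \<open>r \<mapsto> 2 * n - 1 - r\<close>; coordinates outside the window of one argument meet zeros of the other. The identity is then one of signs, \<open>twist_dual\<close>.\<close>

lemma bform_compat:
  assumes i: "i \<in> {1..n}" and w: "w \<in> std_sub (2 * n) (n + i)" and u: "u \<in> std_sub (2 * n) (n + (n + 1 - i))"
  shows "bform (E_mat n) w u = bform (gramV m) (proj i *\<^sub>v w) (proj (n + 1 - i) *\<^sub>v u)"
proof -
  let ?j = "n + 1 - i"
  have j: "?j \<in> {1..n}" using i by auto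
  have c: "w \<in> carrier_vec (2 * n)" "u \<in> carrier_vec (2 * n)" using w u by (auto simp: std_sub_def)
  have "bform (E_mat n) w u = (\<Sum>r\<in>{0..<2 * n}. w $ r * (E_mat n *\<^sub>v u) $ r)"
    using E_mat_carrier[of n] by (simp add: bform_def scalar_prod_def)
  also have "\<dots> = (\<Sum>r\<in>{0..<2 * n}. w $ r * ((if r < n then 1 else - 1) * u $ (2 * n - 1 - r)))"
    using E_mat_carrier[of n] c by (intro sum.cong) (auto simp: E_mat_row)
  also have "\<dots> = (\<Sum>r\<in>{i - 1..<n + i}. w $ r * ((if r < n then 1 else - 1) * u $ (2 * n - 1 - r)))"
  proof (rule sum.mono_neutral_right)
    show "\<forall>r\<in>{0..<2 * n} - {i - 1..<n + i}. w $ r * ((if r < n then 1 else - 1) * u $ (2 * n - 1 - r)) = 0"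
      using w u i by (auto simp: std_sub_def)
  qed (use i in auto)
  also have "\<dots> = (\<Sum>k\<in>{0..<n + 1}. w $ pos i k * ((if pos i k < n then 1 else - 1) * u $ (2 * n - 1 - pos i k)))"
  proof -
    define q where "q r = (if r \<le> n then r else r - (n + 1))" for r
    have pq: "pos i (q r) = r" "q r < n + 1" if "r \<in> {i - 1..<n + i}" for r
      using that i by (auto simp: pos_def q_def)
    have qp: "q (pos i k) = k" if "k < n + 1" for k using that by (auto simp: pos_def q_def)
    show ?thesis
      by (rule sum.reindex_bij_witness[of _ "pos i" q]) (use pq qp pos_less[OF i] in simp_all)
  qed
  also have "\<dots> = (\<Sum>k\<in>{0..<n + 1}. (proj i *\<^sub>v w) $ k * (gramV m *\<^sub>v (proj ?j *\<^sub>v u)) $ k)"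
  proof (rule sum.cong[OF refl])
    fix k assume "k \<in> {0..<n + 1}"
    then have k: "k < n + 1" by simp
    define s :: complex where "s = (if dual_pos k then 1 else - 1)"
    have pc: "proj ?j *\<^sub>v u \<in> carrier_vec (n + 1)" using mult_mat_vec_carrier[OF proj_carrier c(2)] .
    have "(gramV m *\<^sub>v (proj ?j *\<^sub>v u)) $ k = s * (proj ?j *\<^sub>v u) $ dual k"
      using gramV_row[OF k, folded s_def] k dual_less[OF k] pc gramV_carrier
        smult_scalar_prod_distrib[OF unit_vec_carrier pc, of s "dual k"] by simp
    also have "\<dots> = s * (twist ?j (dual k) * u $ pos ?j (dual k))"
      using proj_index[OF j c(2) dual_less[OF k]] by simp
    finally have G: "(gramV m *\<^sub>v (proj ?j *\<^sub>v u)) $ k = s * (twist ?j (dual k) * u $ pos ?j (dual k))" .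
    have p: "pos ?j (dual k) = 2 * n - 1 - pos i k" by (rule pos_dual[OF i k])
    have t: "twist i k * (s * twist ?j (dual k)) = (if pos i k < n then 1 else - 1)"
      unfolding s_def by (rule twist_dual[OF i k])
    show "w $ pos i k * ((if pos i k < n then 1 else - 1) * u $ (2 * n - 1 - pos i k)) =
      (proj i *\<^sub>v w) $ k * (gramV m *\<^sub>v (proj ?j *\<^sub>v u)) $ k"
      unfolding G proj_index[OF i c(1) k] p t[symmetric] by (simp add: algebra_simps)
  qed
  also have "\<dots> = bform (gramV m) (proj i *\<^sub>v w) (proj ?j *\<^sub>v u)"
    using gramV_carrier by (simp add: bform_def scalar_prod_def)
  finally show ?thesis .
qed

end

section \<open>Limits of deformations, and the open Borel orbit\<close>

lemma closed_kernel:
  assumes i: "i \<in> {1..factors A}" and D: "D \<in> carrier_mat r (vdim A)"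
  shows "closedin (zariski A) {x \<in> points A. \<forall>v\<in>x i. D *\<^sub>v v = 0\<^sub>v r}"
proof (rule closedin_if_local)
  fix x0 assume x0: "x0 \<in> points A"
  let ?N = "vdim A" and ?d = "subdim A"
  from local_frames[OF x0] obtain U M where U: "openin (zariski A) U" "x0 \<in> U"
    "\<And>i. i \<in> {1..factors A} \<Longrightarrow> ratmat A U ?N (?d i) (M i)"
    "\<And>i x. i \<in> {1..factors A} \<Longrightarrow> x \<in> U \<Longrightarrow> img (M i x) = x i" by metis
  have "ratmat A U r (?d i) (\<lambda>x. D * M i x)" by (rule ratmat_mult[OF ratmat_const[OF D] U(3)[OF i]])
  moreover have "(\<forall>v\<in>x i. D *\<^sub>v v = 0\<^sub>v r) \<longleftrightarrow> D * M i x = 0\<^sub>m r (?d i)" if x: "x \<in> U" for x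
  proof -
    have "M i x \<in> carrier_mat ?N (?d i)" using U(3)[OF i] x by (simp add: ratmat_def)
    from mult_eq_zero_iff[OF D this] show ?thesis using U(4)[OF i x] by simp
  qed
  ultimately show "\<exists>U R r' c. openin (zariski A) U \<and> x0 \<in> U \<and> ratmat A U r' c R \<and>
      (\<forall>x\<in>U. (\<forall>v\<in>x i. D *\<^sub>v v = 0\<^sub>v r) = (R x = 0\<^sub>m r' c))"
    using U(1,2) by blast
qed

lemma closed_conj:
  assumes "closedin (zariski A) {x \<in> points A. P x}" "closedin (zariski A) {x \<in> points A. Q x}"
  shows "closedin (zariski A) {x \<in> points A. P x \<and> Q x}"
proof -
  have "{x \<in> points A. P x \<and> Q x} = {x \<in> points A. P x} \<inter> {x \<in> points A. Q x}" by blast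
  then show ?thesis using closedin_Int[OF assms] by simp
qed

lemma closed_ball:
  assumes "\<And>i. i \<in> I \<Longrightarrow> closedin (zariski A) {x \<in> points A. P i x}"
  shows "closedin (zariski A) {x \<in> points A. \<forall>i\<in>I. P i x}"
proof (cases "I = {}")
  case True
  then show ?thesis using closedin_topspace[of "zariski A"] by (simp add: topspace_zariski)
next
  case False
  then have "{x \<in> points A. \<forall>i\<in>I. P i x} = (\<Inter>i\<in>I. {x \<in> points A. P i x})" by blast
  then show ?thesis using closedin_INT[OF False assms] by simp
qed

lemma multihom_continuous:
  assumes "multihom A \<delta> f" "\<And>i J. (i, J) \<in> coords A \<Longrightarrow> continuous_on UNIV (\<lambda>t :: complex. q t i J)"
  shows "continuous_on UNIV (\<lambda>t. f (q t))"
  using assms by (induction rule: multihom.induct) (auto intro!: continuous_intros)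

lemma minor_continuous:
  fixes M :: "complex \<Rightarrow> complex mat"
  assumes M: "\<And>t. M t \<in> carrier_mat N d" and J: "J \<subseteq> {..<N}" "card J = d"
    and c: "\<And>a b. a < N \<Longrightarrow> b < d \<Longrightarrow> continuous_on UNIV (\<lambda>t. M t $$ (a, b))"
  shows "continuous_on UNIV (\<lambda>t. minor (M t) J)"
proof -
  have "continuous_on UNIV (\<lambda>t. \<Sum>p\<in>{p. p permutes {0..<d}}. signof p * (\<Prod>i = 0..<d. rowsel d (pick J) (M t) $$ (i, p i)))"
  proof (intro continuous_intros)
    fix p i assume "p \<in> {p. p permutes {0..<d}}" "i \<in> {0..<d}"
    then have "i < d" "p i < d" using permutes_in_image by force+
    then show "continuous_on UNIV (\<lambda>t. rowsel d (pick J) (M t) $$ (i, p i))"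
      using c[OF pick_less[OF J]] by (simp add: rowsel_def)
  qed
  then show ?thesis using minor_rowsel[OF M J] det_def'[OF rowsel_carrier] by simp
qed

lemma img_image:
  assumes G: "G \<in> carrier_mat r N" and F: "F \<in> carrier_mat N d"
  shows "(\<lambda>v. G *\<^sub>v v) ` img F = img (G * F)"
proof -
  have GF: "G * F \<in> carrier_mat r d" using G F by simp
  have "(G * F) *\<^sub>v v = G *\<^sub>v (F *\<^sub>v v)" if "v \<in> carrier_vec d" for v
    by (rule assoc_mult_mat_vec[OF G F that])
  then show ?thesis using GF F by (auto simp: img_def image_image intro!: image_cong)
qed

text \<open>Zariski closed sets are stable under limits in the ordinary topology. It suffices that the flag moves by matrices that depend continuously on a complex parameter: if a polynomial does not vanish at the limit, then by continuity of minors it does not vanish nearby.\<close>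

lemma closedin_deformation:
  assumes Z: "closedin (zariski A) Z" and y: "y \<in> points A"
    and G: "\<And>i t. G i t \<in> carrier_mat (vdim A) (vdim A)" "\<And>i. G i 0 = 1\<^sub>m (vdim A)"
      "\<And>i a b. a < vdim A \<Longrightarrow> b < vdim A \<Longrightarrow> continuous_on UNIV (\<lambda>t :: complex. G i t $$ (a, b))"
    and ev: "eventually (\<lambda>t. act (factors A) (\<lambda>i. G i t) y \<in> Z) (at 0)"
  shows "y \<in> Z"
proof (rule ccontr)
  let ?N = "vdim A" and ?d = "subdim A" and ?I = "{1..factors A}"
  assume "y \<notin> Z"
  have "zariski_open A (points A - Z)" using Z by (simp add: closedin_def topspace_zariski openin_zariski)
  then obtain S where S: "\<forall>f\<in>S. \<exists>\<delta>. multihom A \<delta> f" "points A - Z = {x \<in> points A. \<exists>f\<in>S. f (pluecker A x) \<noteq> 0}"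
    by (auto simp: zariski_open_def)
  have "y \<in> points A - Z" using y \<open>y \<notin> Z\<close> by simp
  then obtain f \<delta> where f: "f \<in> S" "multihom A \<delta> f" "f (pluecker A y) \<noteq> 0" unfolding S(2) using S(1) by blast
  have "\<forall>i\<in>?I. \<exists>M. M \<in> carrier_mat ?N (?d i) \<and> img M = y i"
    using frame_spec(2,3)[OF y] by blast
  then obtain F where F: "\<forall>i\<in>?I. F i \<in> carrier_mat ?N (?d i) \<and> img (F i) = y i" by (rule bchoice[THEN exE])
  define q where "q t i = minor (G i t * F i)" for t i
  have G1: "G i 0 * F i = F i" if "i \<in> ?I" for i
    unfolding G(2) using F that left_mult_one_mat[of "F i" ?N "?d i"] by blast
  have q0: "f (q 0) = f (\<lambda>i. minor (F i))"
    by (rule multihom_cong[OF f(2)]) (use G1 in \<open>auto simp: q_def\<close>)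
  obtain c where "\<forall>i. c i \<noteq> 0" "f (pluecker A y) = (\<Prod>i\<in>?I. c i ^ \<delta> i) * f (\<lambda>i. minor (F i))"
    using multihom_minors[OF y, of F] F f(2) by blast
  then have nz: "f (q 0) \<noteq> 0" using f(3) q0 by auto
  have GF: "G i t * F i \<in> carrier_mat ?N (?d i)" if "i \<in> ?I" for i t using F that G(1)[of i t] by simp
  have "continuous_on UNIV (\<lambda>t. f (q t))"
  proof (rule multihom_continuous[OF f(2)])
    fix i J assume "(i, J) \<in> coords A"
    then have i: "i \<in> ?I" and J: "J \<subseteq> {..<?N}" "card J = ?d i" by auto
    have Fi: "F i \<in> carrier_mat ?N (?d i)" using F i by blast
    show "continuous_on UNIV (\<lambda>t. q t i J)"
      unfolding q_def
    proof (rule minor_continuous[OF GF[OF i] J])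
      fix a b assume ab: "a < ?N" "b < ?d i"
      have "(G i t * F i) $$ (a, b) = (\<Sum>j\<in>{0..<?N}. G i t $$ (a, j) * F i $$ (j, b))" for t
        using G(1)[of i t] Fi ab by (auto simp: scalar_prod_def)
      then show "continuous_on UNIV (\<lambda>t. (G i t * F i) $$ (a, b))"
        using G(3)[of a _ i] ab by (auto intro!: continuous_intros)
    qed
  qed
  then have "((\<lambda>t. f (q t)) \<longlongrightarrow> f (q 0)) (at 0)"
    by (simp add: continuous_on_def)
  then have "eventually (\<lambda>t. f (q t) \<noteq> 0) (at 0)" using nz tendsto_imp_eventually_ne by blast
  with ev have "eventually (\<lambda>t. act (factors A) (\<lambda>i. G i t) y \<in> Z \<and> f (q t) \<noteq> 0) (at (0 :: complex))"
    by (rule eventually_conj)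
  then obtain t where t: "act (factors A) (\<lambda>i. G i t) y \<in> Z" "f (q t) \<noteq> 0"
    using eventually_happens[of _ "at (0 :: complex)"] by auto
  let ?x = "act (factors A) (\<lambda>i. G i t) y"
  have xp: "?x \<in> points A" using t(1) closedin_subset[OF Z] topspace_zariski by blast
  have "G i t * F i \<in> carrier_mat ?N (?d i) \<and> img (G i t * F i) = ?x i" if i: "i \<in> ?I" for i
  proof -
    have Fi: "F i \<in> carrier_mat ?N (?d i)" "img (F i) = y i" using F i by blast+
    show ?thesis using GF[OF i] img_image[OF G(1)[of i t] Fi(1)] Fi(2) i by (simp add: act_def)
  qed
  from multihom_minors[OF xp this] obtain c where c: "\<forall>i. c i \<noteq> 0"
    "f (pluecker A ?x) = (\<Prod>i\<in>?I. c i ^ \<delta> i) * f (\<lambda>i. minor (G i t * F i))" using f(2) by blast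
  have "q t = (\<lambda>i. minor (G i t * F i))" by (rule ext) (simp add: q_def)
  then have "f (pluecker A ?x) \<noteq> 0" using t(2) c by auto
  then have "?x \<in> points A - Z" unfolding S(2) using xp f(1) by blast
  then show False using t(1) by simp
qed

lemma coord_flag_coord_sub:
  assumes i: "i \<in> {1..n}" and \<sigma>: "\<And>j. j \<in> {1..2 * i - 1} \<Longrightarrow> \<sigma> j - 1 < 2 * n"
  shows "coord_flag n \<sigma> i = coord_sub (2 * n) ((\<lambda>j. \<sigma> j - 1) ` {1..2 * i - 1})"
proof -
  let ?A = "(\<lambda>j. \<sigma> j - 1) ` {1..2 * i - 1}" and ?N = "2 * n"
  let ?S = "{unit_vec ?N (\<sigma> j - 1) | j. j \<in> {1..2 * i - 1}} :: complex vec set"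
  interpret vec_space "TYPE(complex)" ?N .
  have A: "?A \<subseteq> {..<?N}" using \<sigma> by auto
  have S: "?S \<subseteq> carrier_vec ?N" by auto
  have "span ?S = coord_sub ?N ?A"
  proof
    have sub: "submodule class_ring (coord_sub ?N ?A) V"
      using coord_sub_lin[of ?N ?A] subspace_iff_lin_sub[of "coord_sub ?N ?A" ?N] by (auto simp only: subspace_def)
    have "?S \<subseteq> coord_sub ?N ?A"
    proof
      fix v assume "v \<in> ?S"
      then obtain j where j: "j \<in> {1..2 * i - 1}" "v = unit_vec ?N (\<sigma> j - 1)" by blast
      then have "\<sigma> j - 1 \<in> ?A" by blast
      then show "v \<in> coord_sub ?N ?A" unfolding j(2) using \<sigma>[OF j(1)] by (auto simp: coord_sub_def simp del: One_nat_def)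
    qed
    then show "span ?S \<subseteq> coord_sub ?N ?A" by (rule span_is_subset[OF _ sub])
    obtain M where M: "M \<in> carrier_mat ?N (card ?A)" "inj_mat M" "img M = coord_sub ?N ?A"
      "\<forall>b<card ?A. \<exists>a\<in>?A. col M b = unit_vec ?N a" by (rule coord_sub_frame[OF A])
    have "lin_sub ?N (span ?S)" using span_is_subspace[OF S] subspace_iff_lin_sub by simp
    then have "img M \<subseteq> span ?S"
    proof (rule img_subset[OF _ M(1)])
      fix b assume "b < card ?A"
      then have "col M b \<in> ?S" using M(4) by fastforce
      then show "col M b \<in> span ?S" using in_own_span[OF S] by blast
    qed
    then show "coord_sub ?N ?A \<subseteq> span ?S" using M(3) by simp
  qed
  then show ?thesis using i by (simp add: coord_flag_def)
qed

lemma coord_flag_id: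
  assumes i: "i \<in> {1..n}" shows "coord_flag n id i = std_sub (2 * n) (2 * i - 1)"
proof -
  have "(\<lambda>j. id j - 1) ` {1..2 * i - 1} = {..<2 * i - 1}"
  proof
    show "{..<2 * i - 1} \<subseteq> (\<lambda>j. id j - 1) ` {1..2 * i - 1}"
      by (intro subsetI image_eqI[of _ _ "Suc _"]) auto
  qed auto
  then show ?thesis unfolding std_sub_coord by (subst coord_flag_coord_sub[OF i]) (use i in auto)
qed

lemma sigma_coords:
  assumes i: "i \<in> {1..n}"
  shows "(\<lambda>j. sigma n j - 1) ` {1..2 * i - 1} = {..<i - 1} \<union> {n..<n + i}"
proof (intro equalityI subsetI)
  fix r assume "r \<in> (\<lambda>j. sigma n j - 1) ` {1..2 * i - 1}"
  then obtain j where j: "j \<in> {1..2 * i - 1}" "r = sigma n j - 1" by blast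
  then show "r \<in> {..<i - 1} \<union> {n..<n + i}" using i by (cases "even j") (auto simp: sigma_def elim!: evenE oddE)
next
  fix r assume "r \<in> {..<i - 1} \<union> {n..<n + i}"
  then show "r \<in> (\<lambda>j. sigma n j - 1) ` {1..2 * i - 1}"
  proof
    assume "r \<in> {..<i - 1}"
    then show ?thesis using i by (intro image_eqI[of _ _ "2 * (r + 1)"]) (auto simp: sigma_def)
  next
    assume "r \<in> {n..<n + i}"
    then show ?thesis using i by (intro image_eqI[of _ _ "2 * (r - n) + 1"]) (auto simp: sigma_def)
  qed
qed

lemma coord_flag_sigma:
  assumes i: "i \<in> {1..n}"
  shows "coord_flag n (sigma n) i = coord_sub (2 * n) ({..<i - 1} \<union> {n..<n + i})"
proof -
  have "sigma n j - 1 < 2 * n" if "j \<in> {1..2 * i - 1}" for j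
  proof -
    have "sigma n j - 1 \<in> {..<i - 1} \<union> {n..<n + i}" using that sigma_coords[OF i] by blast
    then show ?thesis using i by auto
  qed
  then show ?thesis using coord_flag_coord_sub[OF i, of "sigma n"] sigma_coords[OF i] by simp
qed

lemma coord_flag_sigma_Gr:
  assumes i: "i \<in> {1..n}"
  shows "coord_flag n (sigma n) i \<in> Gr (2 * i - 1) (2 * n)"
proof -
  have "card ({..<i - 1} \<union> {n..<n + i}) = (i - 1) + i" using i by (subst card_Un_disjoint) auto
  moreover have "{..<i - 1} \<union> {n..<n + i} \<subseteq> {..<2 * n}" using i by auto
  ultimately show ?thesis using coord_sub_Gr[of "{..<i - 1} \<union> {n..<n + i}" "2 * n"] i
    unfolding coord_flag_sigma[OF i] by (simp add: mult_2)
qed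

lemma unit_det_inj:
  assumes b: "b \<in> carrier_mat N N" and d: "det b = (1 :: complex)" and u: "u \<in> carrier_vec N" "b *\<^sub>v u = 0\<^sub>v N"
  shows "u = 0\<^sub>v N"
  using det_0_iff_vec_prod_zero_field[OF b] d u by auto

lemma upper_triangular_std_sub:
  assumes b: "b \<in> borel_SL n" and k: "k \<le> 2 * n"
  shows "(\<lambda>v. b *\<^sub>v v) ` std_sub (2 * n) k = std_sub (2 * n) k"
proof -
  have bc: "b \<in> carrier_mat (2 * n) (2 * n)" and d: "det b = 1" and up: "upper_triangular b"
    using b by (auto simp: borel_SL_def SL_def)
  have sub: "(\<lambda>v. b *\<^sub>v v) ` std_sub (2 * n) k \<subseteq> std_sub (2 * n) k"
  proof
    fix w assume "w \<in> (\<lambda>v. b *\<^sub>v v) ` std_sub (2 * n) k"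
    then obtain v where v: "v \<in> std_sub (2 * n) k" "w = b *\<^sub>v v" by blast
    have vc: "v \<in> carrier_vec (2 * n)" using v(1) by (simp add: std_sub_def)
    have "w $ r = 0" if r: "r < 2 * n" "k \<le> r" for r
    proof -
      have "w $ r = (\<Sum>j\<in>{0..<2 * n}. b $$ (r, j) * v $ j)"
        using v(2) r bc vc by (simp add: scalar_prod_def)
      also have "\<dots> = 0"
      proof (rule sum.neutral, intro ballI)
        fix j assume j: "j \<in> {0..<2 * n}"
        show "b $$ (r, j) * v $ j = 0"
        proof (cases "j < r")
          case True then show ?thesis using up r bc by (simp add: upper_triangularD)
        next
          case False then show ?thesis using v(1) r j by (simp add: std_sub_def)
        qed
      qed
      finally show ?thesis .
    qed
    then show "w \<in> std_sub (2 * n) k" using v(2) vc bc by (simp add: std_sub_def)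
  qed
  have "(\<lambda>v. b *\<^sub>v v) ` std_sub (2 * n) k \<in> Gr k (2 * n)"
    by (rule Gr_inj_image[OF std_sub_Gr[OF k] bc]) (use unit_det_inj[OF bc d] std_sub_carrier in blast)
  then show ?thesis using Gr_mono(2)[OF _ std_sub_Gr[OF k] sub] by simp
qed

definition borel_orbit :: "nat \<Rightarrow> subspaces set" where
  "borel_orbit n = (\<lambda>b. act n (\<lambda>_. b) (coord_flag n (sigma n))) ` borel_SL n"

context window
begin

text \<open>Upper triangular matrices preserve the standard flag, so the inclusions that hold for the coordinate flag hold on its whole orbit.\<close>

lemma borel_orbit_subset: "borel_orbit n \<subseteq> flags_W"
proof
  fix y assume "y \<in> borel_orbit n"
  then obtain b where b: "b \<in> borel_SL n" "y = act n (\<lambda>_. b) (coord_flag n (sigma n))" by (auto simp: borel_orbit_def)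
  have bc: "b \<in> carrier_mat (2 * n) (2 * n)" and d: "det b = 1" using b by (auto simp: borel_SL_def SL_def)
  let ?C = "coord_flag n (sigma n)"
  have yi: "y i = (\<lambda>v. b *\<^sub>v v) ` ?C i" if "i \<in> {1..n}" for i using that by (simp add: b(2) act_def)
  have "y i \<in> Gr (2 * i - 1) (2 * n)" if i: "i \<in> {1..n}" for i
    unfolding yi[OF i]
    by (rule Gr_inj_image[OF coord_flag_sigma_Gr[OF i] bc])
      (use unit_det_inj[OF bc d] Gr_carrier[OF coord_flag_sigma_Gr[OF i]] in blast)
  then have "y \<in> points (ambW n)"
    unfolding points_def ambW_def by (auto simp: b(2) act_def PiE_iff)
  moreover have "y i \<subseteq> y (i + 1)" if i: "i \<in> {1..n - 1}" for i
  proof -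
    have "?C i \<subseteq> ?C (i + 1)"
      using index_succ[OF i] by (auto simp: coord_flag_sigma coord_sub_def simp del: atLeastAtMost_iff)
    then show ?thesis using yi index_succ[OF i] by blast
  qed
  moreover have "std_sub (2 * n) (i - 1) \<subseteq> y i \<and> y i \<subseteq> std_sub (2 * n) (n + i)" if i: "i \<in> {1..n}" for i
  proof -
    have "std_sub (2 * n) (i - 1) \<subseteq> ?C i" "?C i \<subseteq> std_sub (2 * n) (n + i)"
      unfolding coord_flag_sigma[OF i] by (auto simp: std_sub_def coord_sub_def)
    moreover have "i - 1 \<le> 2 * n" "n + i \<le> 2 * n" using i by auto
    note this[THEN upper_triangular_std_sub[OF b(1)]]
    ultimately show ?thesis unfolding yi[OF i] by blast
  qed
  ultimately show "y \<in> flags_W" by (simp add: flags_W_def SL_mod_P_def)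
qed

text \<open>The coordinates \<open>n + 1, \<dots>, 2 * n\<close>, that is, reduction modulo \<open>E\<^sub>n\<close>.\<close>

definition tail :: "complex mat" where
  "tail = selmat n (2 * n) (\<lambda>a. n + a)"

lemma tail_carrier: "tail \<in> carrier_mat n (2 * n)"
  by (simp add: tail_def)

lemma tail_index:
  assumes "w \<in> carrier_vec (2 * n)" "a < n" shows "(tail *\<^sub>v w) $ a = w $ (n + a)"
proof -
  have "row tail a = unit_vec (2 * n) (n + a)" using assms(2) by (intro eq_vecI) (auto simp: tail_def selmat_def)
  then show ?thesis using assms tail_carrier by simp
qed

lemma tail_zero_iff:
  assumes w: "w \<in> carrier_vec (2 * n)" shows "tail *\<^sub>v w = 0\<^sub>v n \<longleftrightarrow> w \<in> std_sub (2 * n) n"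
proof
  assume z: "tail *\<^sub>v w = 0\<^sub>v n"
  have "w $ j = 0" if "j < 2 * n" "n \<le> j" for j
    using tail_index[OF w, of "j - n"] z that by simp
  then show "w \<in> std_sub (2 * n) n" using w by (simp add: std_sub_def)
next
  assume "w \<in> std_sub (2 * n) n"
  then show "tail *\<^sub>v w = 0\<^sub>v n"
    using tail_index[OF w] tail_carrier by (intro eq_vecI) (auto simp: std_sub_def)
qed

lemma tail_std:
  assumes w: "w \<in> carrier_vec (2 * n)" shows "tail *\<^sub>v w \<in> std_sub n i \<longleftrightarrow> w \<in> std_sub (2 * n) (n + i)"
proof
  assume z: "tail *\<^sub>v w \<in> std_sub n i"
  have "w $ j = 0" if "j < 2 * n" "n + i \<le> j" for j
    using tail_index[OF w, of "j - n"] z that by (simp add: std_sub_def)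
  then show "w \<in> std_sub (2 * n) (n + i)" using w by (simp add: std_sub_def)
next
  assume "w \<in> std_sub (2 * n) (n + i)"
  then show "tail *\<^sub>v w \<in> std_sub n i"
    using tail_index[OF w] mult_mat_vec_carrier[OF tail_carrier w] by (auto simp: std_sub_def)
qed

lemma flags_W_D:
  assumes "y \<in> flags_W"
  shows "i \<in> {1..n} \<Longrightarrow> y i \<in> Gr (2 * i - 1) (2 * n)" "i \<in> {1..n} \<Longrightarrow> lin_sub (2 * n) (y i)"
    "i \<in> {1..n} \<Longrightarrow> y i \<subseteq> carrier_vec (2 * n)"
    "i \<in> {1..n} \<Longrightarrow> std_sub (2 * n) (i - 1) \<subseteq> y i" "i \<in> {1..n} \<Longrightarrow> y i \<subseteq> std_sub (2 * n) (n + i)"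
    "i \<in> {1..n - 1} \<Longrightarrow> y i \<subseteq> y (i + 1)"
  using assms flags_W_Gr[of y i] Gr_lin_sub Gr_carrier unfolding flags_W_def SL_mod_P_def by blast+

lemma flags_W_mono:
  assumes y: "y \<in> flags_W" and "1 \<le> i" "i \<le> j" "j \<le> n" shows "y i \<subseteq> y j"
  using assms(3,4)
proof (induction j rule: dec_induct)
  case (step k)
  then have "k \<in> {1..n - 1}" using assms(2) by auto
  from flags_W_D(6)[OF y this] step show ?case by auto
qed simp

text \<open>The kernel has dimension at least \<open>i - 1\<close> and the image at most \<open>i\<close>, while they add up to \<open>2 * i - 1\<close>; so one bound is sharp if and only if the other is.\<close>

lemma tail_surj_iff:
  assumes y: "y \<in> flags_W" and i: "i \<in> {1..n}"
  shows "(\<lambda>w. tail *\<^sub>v w) ` y i \<subseteq> std_sub n i"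
    "(\<lambda>w. tail *\<^sub>v w) ` y i = std_sub n i \<longleftrightarrow> y i \<inter> std_sub (2 * n) n = std_sub (2 * n) (i - 1)"
proof -
  note D = flags_W_D(1-5)[OF y i]
  show sub: "(\<lambda>w. tail *\<^sub>v w) ` y i \<subseteq> std_sub n i" using D(3,5) tail_std by blast
  have ker: "{w \<in> y i. tail *\<^sub>v w = 0\<^sub>v n} = y i \<inter> std_sub (2 * n) n" using tail_zero_iff D(3) by blast
  obtain k where k: "{w \<in> y i. tail *\<^sub>v w = 0\<^sub>v n} \<in> Gr k (2 * n)"
    using lin_sub_Gr[OF lin_sub_kernel[OF D(2) tail_carrier]] by blast
  obtain j where j: "(\<lambda>w. tail *\<^sub>v w) ` y i \<in> Gr j n"
    using lin_sub_Gr[OF lin_sub_image[OF D(2) tail_carrier]] by blast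
  have kj: "2 * i - 1 = k + j" by (rule rank_nullity[OF D(1) tail_carrier k j])
  have E: "std_sub (2 * n) (i - 1) \<in> Gr (i - 1) (2 * n)" "std_sub n i \<in> Gr i n"
    using std_sub_Gr i by auto
  have subE: "std_sub (2 * n) (i - 1) \<subseteq> y i \<inter> std_sub (2 * n) n"
  proof -
    have "i - 1 \<le> n" using i by auto
    from std_sub_mono[OF this] D(4) show ?thesis by blast
  qed
  show "(\<lambda>w. tail *\<^sub>v w) ` y i = std_sub n i \<longleftrightarrow> y i \<inter> std_sub (2 * n) n = std_sub (2 * n) (i - 1)"
  proof
    assume "(\<lambda>w. tail *\<^sub>v w) ` y i = std_sub n i"
    then have "j = i" using Gr_unique j E(2) by metis
    then have "i - 1 = k" using kj by simp
    then show "y i \<inter> std_sub (2 * n) n = std_sub (2 * n) (i - 1)"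
      using Gr_mono(2)[OF E(1) k] subE unfolding ker by blast
  next
    assume "y i \<inter> std_sub (2 * n) n = std_sub (2 * n) (i - 1)"
    then have "k = i - 1" using Gr_unique k E(1) unfolding ker by metis
    then have "j = i" using kj i by auto
    then show "(\<lambda>w. tail *\<^sub>v w) ` y i = std_sub n i" using Gr_mono(2)[OF j E(2) sub] by simp
  qed
qed

text \<open>Vectors \<open>w\<^sub>i \<in> W\<^sub>i\<close> that lift the last \<open>n\<close> basis vectors modulo \<open>E\<^sub>n\<close> are, after the first \<open>n\<close> basis vectors, the columns of an upper triangular matrix with ones on the diagonal. It moves the coordinate flag into the given flag, and the dimensions agree.\<close>

lemma big_cell:
  assumes y: "y \<in> flags_W" and cell: "\<And>i. i \<in> {1..n} \<Longrightarrow> (\<lambda>w. tail *\<^sub>v w) ` y i = std_sub n i"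
  shows "y \<in> borel_orbit n"
proof -
  have "\<forall>i\<in>{1..n}. \<exists>w. w \<in> y i \<and> tail *\<^sub>v w = unit_vec n (i - 1)"
  proof
    fix i assume i: "i \<in> {1..n}"
    have "unit_vec n (i - 1) \<in> std_sub n i" using i by (auto simp: std_sub_def)
    then have "unit_vec n (i - 1) \<in> (\<lambda>w. tail *\<^sub>v w) ` y i" using cell[OF i] by simp
    then show "\<exists>w. w \<in> y i \<and> tail *\<^sub>v w = unit_vec n (i - 1)" by (elim imageE) (intro exI conjI, simp_all)
  qed
  then obtain w where w: "\<forall>i\<in>{1..n}. w i \<in> y i \<and> tail *\<^sub>v w i = unit_vec n (i - 1)" by (rule bchoice[THEN exE])
  define b where "b = mat (2 * n) (2 * n) (\<lambda>(r, c). if c < n then (if r = c then 1 else 0) else w (c - n + 1) $ r)"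
  have bc: "b \<in> carrier_mat (2 * n) (2 * n)" by (simp add: b_def)
  have wE: "w i \<in> std_sub (2 * n) (n + i)" if "i \<in> {1..n}" for i using w that flags_W_D(5)[OF y that] by blast
  have wd: "w (c - n + 1) $ c = 1" if c: "n \<le> c" "c < 2 * n" for c
  proof -
    have i: "c - n + 1 \<in> {1..n}" using c by auto
    have "w (c - n + 1) \<in> carrier_vec (2 * n)" using wE[OF i] std_sub_carrier by blast
    from tail_index[OF this, of "c - n"] show ?thesis using w i c by simp
  qed
  have wz: "w (c - n + 1) $ r = 0" if c: "n \<le> c" "c < r" "r < 2 * n" for c r
  proof -
    have i: "c - n + 1 \<in> {1..n}" using c by auto
    then show ?thesis using wE[OF i] c by (simp add: std_sub_def)
  qed
  have up: "upper_triangular b" by (rule upper_triangularI) (use wz in \<open>auto simp: b_def\<close>)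
  have "diag_mat b = map (\<lambda>_. 1) [0..<2 * n]" using wd by (auto simp: diag_mat_def b_def)
  then have "det b = 1" using det_upper_triangular[OF up bc] by (simp add: map_replicate_const)
  then have b: "b \<in> borel_SL n" using bc up by (simp add: borel_SL_def SL_def)
  have "act n (\<lambda>_. b) (coord_flag n (sigma n)) i = y i" for i
  proof (cases "i \<in> {1..n}")
    case True
    let ?A = "{..<i - 1} \<union> {n..<n + i}"
    have A: "?A \<subseteq> {..<2 * n}" using True by auto
    obtain M where M: "M \<in> carrier_mat (2 * n) (card ?A)" "inj_mat M" "img M = coord_sub (2 * n) ?A"
      "\<forall>b<card ?A. \<exists>a\<in>?A. col M b = unit_vec (2 * n) a" by (rule coord_sub_frame[OF A]) 
    have bM: "b * M \<in> carrier_mat (2 * n) (card ?A)" using bc M(1) by simp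
    have "img (b * M) \<subseteq> y i"
    proof (rule img_subset[OF flags_W_D(2)[OF y True] bM])
      fix j assume j: "j < card ?A"
      then obtain a where a: "a \<in> ?A" "col M j = unit_vec (2 * n) a" using M(4) by blast
      have a2: "a < 2 * n" using a(1) A by auto
      have e: "col (b * M) j = col b a" using col_mult2[OF bc M(1) j] a(2) mult_unit_vec[OF bc a2] by simp
      show "col (b * M) j \<in> y i"
      proof (cases "a < n")
        case an: True
        then have "a < i - 1" using a(1) by auto
        moreover have "col b a = unit_vec (2 * n) a" using an a2 by (intro eq_vecI) (auto simp: b_def)
        ultimately have "col (b * M) j \<in> std_sub (2 * n) (i - 1)" unfolding e by (auto simp: std_sub_def)
        then show ?thesis using flags_W_D(4)[OF y True] by blast
      next
        case False
        then have ai: "a - n + 1 \<in> {1..n}" "a - n + 1 \<le> i" using a(1) True by auto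
        have "w (a - n + 1) \<in> carrier_vec (2 * n)" using wE[OF ai(1)] std_sub_carrier by blast
        then have "col b a = w (a - n + 1)" using False a2 by (intro eq_vecI) (auto simp: b_def)
        moreover have "w (a - n + 1) \<in> y i" using w ai flags_W_mono[OF y _ ai(2)] True by auto
        ultimately show ?thesis unfolding e by simp
      qed
    qed
    then have sub: "(\<lambda>v. b *\<^sub>v v) ` coord_flag n (sigma n) i \<subseteq> y i"
      unfolding coord_flag_sigma[OF True] M(3)[symmetric] img_image[OF bc M(1)] .
    have "(\<lambda>v. b *\<^sub>v v) ` coord_flag n (sigma n) i \<in> Gr (2 * i - 1) (2 * n)"
      by (rule Gr_inj_image[OF coord_flag_sigma_Gr[OF True] bc])
        (use unit_det_inj[OF bc \<open>det b = 1\<close>] Gr_carrier[OF coord_flag_sigma_Gr[OF True]] in blast)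
    from Gr_mono(2)[OF this flags_W_D(1)[OF y True] sub] show ?thesis using True by (simp add: act_def)
  next
    case False
    have "y i = undefined" using y False by (auto simp: flags_W_def SL_mod_P_def points_def ambW_def PiE_def extensional_def)
    then show ?thesis using False by (simp add: act_def del: atLeastAtMost_iff)
  qed
  then have "y = act n (\<lambda>_. b) (coord_flag n (sigma n))" by auto
  then show ?thesis using b by (auto simp: borel_orbit_def)
qed

end

section \<open>Density of the Borel orbit\<close>

lemma std_sub_subset_iff:
  assumes U: "lin_sub N U" and k: "k \<le> N"
  shows "std_sub N k \<subseteq> U \<longleftrightarrow> (\<forall>j<k. unit_vec N j \<in> U)"
proof
  assume "std_sub N k \<subseteq> U"
  then show "\<forall>j<k. unit_vec N j \<in> U" using k by (auto simp: std_sub_def subset_iff)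
next
  assume un: "\<forall>j<k. unit_vec N j \<in> U"
  obtain M where M: "M \<in> carrier_mat N (card {..<k})" "inj_mat M" "img M = coord_sub N {..<k}"
    "\<forall>b<card {..<k}. \<exists>a\<in>{..<k}. col M b = unit_vec N a" by (rule coord_sub_frame[of "{..<k}" N]) (use k in auto)
  have "img M \<subseteq> U" by (rule img_subset[OF U M(1)]) (use M(4) un in force)
  then show "std_sub N k \<subseteq> U" using M(3) std_sub_coord by simp
qed

lemma lin_sub_sum:
  assumes U: "lin_sub N U" and V: "lin_sub N V"
  shows "lin_sub N {u + v | u v. u \<in> U \<and> v \<in> V}" (is "lin_sub N ?S")
proof (rule lin_subI)
  note u = lin_subD[OF U] and v = lin_subD[OF V]
  show "?S \<subseteq> carrier_vec N" by (auto dest!: subsetD[OF u(1)] subsetD[OF v(1)])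
  have "0\<^sub>v N = 0\<^sub>v N + (0\<^sub>v N :: complex vec)" by simp
  then show "0\<^sub>v N \<in> ?S" using u(2) v(2) by blast
  fix x z c assume x: "x \<in> ?S"
  then obtain a b where ab: "a \<in> U" "b \<in> V" "x = a + b" by blast
  have abc: "a \<in> carrier_vec N" "b \<in> carrier_vec N" using ab u(1) v(1) by blast+
  have "c \<cdot>\<^sub>v x = c \<cdot>\<^sub>v a + c \<cdot>\<^sub>v b" using ab(3) abc by (simp add: smult_add_distrib_vec)
  then show "c \<cdot>\<^sub>v x \<in> ?S" using u(4) v(4) ab by blast
  assume "z \<in> ?S"
  then obtain a' b' where ab': "a' \<in> U" "b' \<in> V" "z = a' + b'" by blast
  have abc': "a' \<in> carrier_vec N" "b' \<in> carrier_vec N" using ab' u(1) v(1) by blast+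
  have "x + z = (a + a') + (b + b')" using ab(3) ab'(3) abc abc' by (intro eq_vecI) auto
  then show "x + z \<in> ?S" using u(3) v(3) ab ab' by blast
qed

text \<open>The matrix of \<open>v \<mapsto> v + t (l \<bullet> v) c\<close>.\<close>

definition rank1 :: "complex vec \<Rightarrow> complex vec \<Rightarrow> complex \<Rightarrow> complex mat" where
  "rank1 c l t = mat (dim_vec c) (dim_vec c) (\<lambda>(r, s). (if r = s then 1 else 0) + t * c $ r * l $ s)"

lemma rank1_mult:
  assumes c: "c \<in> carrier_vec N" and l: "l \<in> carrier_vec N" and v: "v \<in> carrier_vec N"
  shows "rank1 c l t \<in> carrier_mat N N" "rank1 c l t *\<^sub>v v = v + (t * (l \<bullet> v)) \<cdot>\<^sub>v c"
proof -
  show R: "rank1 c l t \<in> carrier_mat N N" using c by (simp add: rank1_def)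
  show "rank1 c l t *\<^sub>v v = v + (t * (l \<bullet> v)) \<cdot>\<^sub>v c"
  proof (rule eq_vecI)
    fix r assume "r < dim_vec (v + (t * (l \<bullet> v)) \<cdot>\<^sub>v c)"
    then have r: "r < N" using c by simp
    have "row (rank1 c l t) r = unit_vec N r + (t * c $ r) \<cdot>\<^sub>v l"
      using r c l by (intro eq_vecI) (auto simp: rank1_def)
    then have "(rank1 c l t *\<^sub>v v) $ r = (unit_vec N r + (t * c $ r) \<cdot>\<^sub>v l) \<bullet> v" using r R by simp
    also have "\<dots> = v $ r + t * c $ r * (l \<bullet> v)"
      using r l v by (simp add: add_scalar_prod_distrib[of _ N])
    finally show "(rank1 c l t *\<^sub>v v) $ r = (v + (t * (l \<bullet> v)) \<cdot>\<^sub>v c) $ r" using r c v by simp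
  qed (use R c v in auto)
qed

lemma rank1_zero: "c \<in> carrier_vec N \<Longrightarrow> rank1 c l 0 = 1\<^sub>m N"
  by (intro eq_matI) (auto simp: rank1_def)

lemma zero_smult: "c \<in> carrier_vec N \<Longrightarrow> 0 \<cdot>\<^sub>v c = (0\<^sub>v N :: complex vec)"
  by (intro eq_vecI) auto

lemma minus_smult_zero: "(x :: complex vec) \<in> carrier_vec N \<Longrightarrow> x - k \<cdot>\<^sub>v 0\<^sub>v N = x"
  by (intro eq_vecI) auto

lemma std_subD: "v \<in> std_sub N k \<Longrightarrow> k \<le> j \<Longrightarrow> j < N \<Longrightarrow> v $ j = 0"
  by (simp add: std_sub_def)

lemma rank1_fix:
  assumes "c \<in> carrier_vec N" "l \<in> carrier_vec N" "v \<in> carrier_vec N" "l \<bullet> v = 0"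
  shows "rank1 c l t *\<^sub>v v = v"
  using rank1_mult(2)[OF assms(1-3)] assms zero_smult[OF assms(1)] by simp

lemma rank1_inj:
  assumes c: "c \<in> carrier_vec N" and l: "l \<in> carrier_vec N" and v: "v \<in> carrier_vec N"
    and nz: "1 + t * (l \<bullet> c) \<noteq> 0" and z: "rank1 c l t *\<^sub>v v = 0\<^sub>v N"
  shows "v = 0\<^sub>v N"
proof -
  have e: "v + (t * (l \<bullet> v)) \<cdot>\<^sub>v c = 0\<^sub>v N" using rank1_mult(2)[OF c l v] z by simp
  have "l \<bullet> (v + (t * (l \<bullet> v)) \<cdot>\<^sub>v c) = l \<bullet> v + (t * (l \<bullet> v)) * (l \<bullet> c)"
    using c l v by (simp add: scalar_prod_add_distrib[of _ N])
  then have "(l \<bullet> v) * (1 + t * (l \<bullet> c)) = 0" using e l by (simp add: algebra_simps)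
  then have "l \<bullet> v = 0" using nz by simp
  then show ?thesis using e v zero_smult[OF c] by simp
qed

definition vdimn :: "nat \<Rightarrow> complex vec set \<Rightarrow> nat" where
  "vdimn N U = (THE d. U \<in> Gr d N)"

lemma vdimn_eq: "U \<in> Gr d N \<Longrightarrow> vdimn N U = d"
  unfolding vdimn_def using Gr_unique by blast

lemma vdimn_Gr: "lin_sub N U \<Longrightarrow> U \<in> Gr (vdimn N U) N"
  using lin_sub_Gr vdimn_eq by metis

lemma vdimn_mono:
  assumes "lin_sub N U" "lin_sub N V" "U \<subseteq> V"
  shows "vdimn N U \<le> vdimn N V" "U \<noteq> V \<Longrightarrow> vdimn N U < vdimn N V"
  using Gr_mono[OF vdimn_Gr[OF assms(1)] vdimn_Gr[OF assms(2)] assms(3)] by linarith+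

lemma vdimn_le: "lin_sub N U \<Longrightarrow> vdimn N U \<le> N"
  using Gr_le vdimn_Gr by blast

context window
begin

text \<open>Measures how far a flag is from the big cell: it is at most \<open>1 + \<dots> + n\<close>, with equality exactly on the cell.\<close>

definition tail_rank :: "subspaces \<Rightarrow> nat" where
  "tail_rank y = (\<Sum>i\<in>{1..n}. vdimn n ((\<lambda>w. tail *\<^sub>v w) ` y i))"

lemma tail_image_lin: "y \<in> flags_W \<Longrightarrow> i \<in> {1..n} \<Longrightarrow> lin_sub n ((\<lambda>w. tail *\<^sub>v w) ` y i)"
  using lin_sub_image[OF flags_W_D(2) tail_carrier] .

lemma tail_rank_le: "y \<in> flags_W \<Longrightarrow> tail_rank y \<le> n * n"
  unfolding tail_rank_def using sum_bounded_above[of "{1..n}" "\<lambda>i. vdimn n ((\<lambda>w. tail *\<^sub>v w) ` y i)" n]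
    vdimn_le[OF tail_image_lin] by simp

text \<open>Subtract from \<open>w\<close> all but its last nonzero coordinate \<open>b\<close>; what is subtracted lies in \<open>E\<^sub>b\<^sub>-\<^sub>1\<close>, which is contained in the \<open>b\<close>-th member of the flag.\<close>

lemma leading_unit:
  assumes y: "y \<in> flags_W" and i: "i \<in> {1..n}" and w: "w \<in> y i" "w \<in> std_sub (2 * n) n" "w \<notin> std_sub (2 * n) (i - 1)"
  shows "\<exists>b\<in>{i..n}. unit_vec (2 * n) (b - 1) \<in> y b"
proof -
  have wc: "w \<in> carrier_vec (2 * n)" using w(2) std_sub_carrier by blast
  let ?R = "{r. r < 2 * n \<and> w $ r \<noteq> 0}"
  have ex: "\<exists>r. i - 1 \<le> r \<and> r < 2 * n \<and> w $ r \<noteq> 0" using w(3) wc by (auto simp: std_sub_def)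
  define r where "r = Max ?R"
  have r: "r \<in> ?R" unfolding r_def by (rule Max_in) (use ex in auto)
  have rmax: "s \<le> r" if "s \<in> ?R" for s unfolding r_def by (rule Max_ge) (use that in auto)
  have ir: "i - 1 \<le> r" using ex rmax by fastforce
  have rn: "r < n" using r w(2) by (auto simp: std_sub_def not_le[symmetric])
  have b: "r + 1 \<in> {1..n}" "i \<le> r + 1" using ir rn by auto
  have wy: "w \<in> y (r + 1)" using flags_W_mono[OF y _ b(2)] w(1) i b(1) by auto
  let ?e = "unit_vec (2 * n) r :: complex vec"
  have "w - w $ r \<cdot>\<^sub>v ?e \<in> std_sub (2 * n) (r + 1 - 1)"
    using rmax wc r by (auto simp: std_sub_def) (metis le_antisym)
  then have m: "w - w $ r \<cdot>\<^sub>v ?e \<in> y (r + 1)" using flags_W_D(4)[OF y b(1)] by blast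
  have "w - (w - w $ r \<cdot>\<^sub>v ?e) \<in> y (r + 1)" by (rule lin_sub_minus[OF flags_W_D(2)[OF y b(1)] wy m])
  then have "(1 / w $ r) \<cdot>\<^sub>v (w - (w - w $ r \<cdot>\<^sub>v ?e)) \<in> y (r + 1)" by (rule lin_subD(4)[OF flags_W_D(2)[OF y b(1)]])
  moreover have "(1 / w $ r) \<cdot>\<^sub>v (w - (w - w $ r \<cdot>\<^sub>v ?e)) = ?e" using r wc by (intro eq_vecI) auto
  ultimately show ?thesis using b by (intro bexI[of _ "r + 1"]) auto
qed

text \<open>Let \<open>b\<close> be the largest index with \<open>e\<^sub>b \<in> W\<^sub>b\<close> and \<open>a\<close> the smallest with \<open>e\<^sub>b \<in> W\<^sub>a + E\<^sub>b\<^sub>-\<^sub>1\<close>. Minimality of \<open>a\<close> provides a functional \<open>l\<close> with \<open>l e\<^sub>b = 1\<close> that kills \<open>W\<^sub>a\<^sub>-\<^sub>1\<close> and \<open>E\<^sub>b\<^sub>-\<^sub>1\<close>. Since \<open>W\<^sub>a\<close> contains a vector of \<open>E\<^sub>n\<close> outside \<open>E\<^sub>a\<^sub>-\<^sub>1\<close>, it does not map onto \<open>E\<^sub>n\<^sub>+\<^sub>a\<close> modulo \<open>E\<^sub>n\<close>; maximality of \<open>b\<close> says that \<open>W\<^sub>b\<^sub>+\<^sub>1\<close> does map onto \<open>E\<^sub>n\<^sub>+\<^sub>b\<^sub>+\<^sub>1\<close>, so a direction \<open>c\<close> missed by \<open>W\<^sub>a\<close> can be lifted to \<open>W\<^sub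>b\<^sub>+\<^sub>1\<close>.\<close>

lemma deformation_data:
  assumes y: "y \<in> flags_W" and nc: "\<exists>i\<in>{1..n}. (\<lambda>w. tail *\<^sub>v w) ` y i \<noteq> std_sub n i"
  obtains a b l c z where "1 \<le> a" "a \<le> b" "b \<le> n" "l \<in> carrier_vec (2 * n)" "c \<in> std_sub (2 * n) (n + a)"
    "b < n \<Longrightarrow> c \<in> y (b + 1)" "tail *\<^sub>v c \<notin> (\<lambda>w. tail *\<^sub>v w) ` y a"
    "\<And>v. v \<in> std_sub (2 * n) (b - 1) \<Longrightarrow> l \<bullet> v = 0" "\<And>v. 1 < a \<Longrightarrow> v \<in> y (a - 1) \<Longrightarrow> l \<bullet> v = 0"
    "z \<in> y a" "tail *\<^sub>v z = 0\<^sub>v n" "l \<bullet> z = 1"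
proof -
  let ?N = "2 * n" and ?E = "std_sub (2 * n)"
  let ?e = "\<lambda>b. unit_vec (2 * n) (b - 1) :: complex vec"
  define B where "B = {b \<in> {1..n}. ?e b \<in> y b}"
  have notcell: "\<exists>w. w \<in> y i \<and> w \<in> ?E n \<and> w \<notin> ?E (i - 1)"
    if i: "i \<in> {1..n}" and "(\<lambda>w. tail *\<^sub>v w) ` y i \<noteq> std_sub n i" for i
  proof -
    have "i - 1 \<le> n" using i by auto
    from std_sub_mono[OF this] have "?E (i - 1) \<subseteq> y i \<inter> ?E n" using flags_W_D(4)[OF y i] by blast
    then show ?thesis using tail_surj_iff(2)[OF y i] that by blast
  qed
  have "B \<noteq> {}"
  proof -
    obtain i w where "i \<in> {1..n}" "w \<in> y i" "w \<in> ?E n" "w \<notin> ?E (i - 1)" using nc notcell by blast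
    from leading_unit[OF y this] show ?thesis using \<open>i \<in> {1..n}\<close> by (auto simp: B_def)
  qed
  moreover have fB: "finite B" by (simp add: B_def)
  ultimately have "Max B \<in> B" by (rule Max_in[rotated])
  define b where "b = Max B"
  have b: "b \<in> {1..n}" "?e b \<in> y b" using \<open>Max B \<in> B\<close> by (auto simp: b_def B_def)
  have bmax: "b' \<notin> B" if "b < b'" for b' using Max_ge[OF fB] that unfolding b_def by (meson not_le)
  define Q where "Q a \<longleftrightarrow> 1 \<le> a \<and> (\<exists>z\<in>y a. z - ?e b \<in> ?E (b - 1))" for a
  have "?e b - ?e b \<in> ?E (b - 1)" by (auto simp: std_sub_def)
  then have Qb: "Q b" using b by (auto simp: Q_def)
  define a where "a = (LEAST a. Q a)"
  have Qa: "Q a" unfolding a_def using Qb by (rule LeastI)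
  have amin: "\<not> Q a'" if "a' < a" for a' using not_less_Least that unfolding a_def by blast
  have ab: "1 \<le> a" "a \<le> b" using Qa Least_le[of Q b, OF Qb] by (auto simp: Q_def a_def)
  then have a: "a \<in> {1..n}" using b(1) by auto
  obtain z where z: "z \<in> y a" "z - ?e b \<in> ?E (b - 1)" using Qa by (auto simp: Q_def)
  have zc: "z \<in> carrier_vec ?N" using flags_W_D(3)[OF y a] z(1) by blast
  have ec: "?e b \<in> carrier_vec ?N" by simp
  have zb: "z $ (b - 1) = 1"
  proof -
    have "(z - ?e b) $ (b - 1) = 0" using z(2) b(1) by (auto simp: std_sub_def)
    then show ?thesis using b(1) zc by auto
  qed
  have zE: "z \<in> ?E n"
  proof -
    have "z $ r = 0" if r: "n \<le> r" "r < ?N" for r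
    proof -
      have "(z - ?e b) $ r = 0" using z(2) r b(1) by (auto simp: std_sub_def)
      then show ?thesis using r b(1) zc by auto
    qed
    then show ?thesis using zc by (simp add: std_sub_def)
  qed
  \<comment> \<open>The member before the \<open>a\<close>-th one, which is zero if there is none.\<close>
  define Wp where "Wp = (if a = 1 then {0\<^sub>v ?N} else y (a - 1))"
  have Wp: "lin_sub ?N Wp"
  proof (cases "a = 1")
    case True
    then show ?thesis using Gr_lin_sub[OF Gr_zero] by (simp add: Wp_def)
  next
    case False
    then have "a - 1 \<in> {1..n}" using a by auto
    from flags_W_D(2)[OF y this] show ?thesis using False by (simp add: Wp_def)
  qed
  define S where "S = {u + v | u v. u \<in> Wp \<and> v \<in> ?E (b - 1)}"
  have S: "lin_sub ?N S" unfolding S_def by (rule lin_sub_sum[OF Wp std_sub_lin])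
  have bN: "b - 1 < ?N" using b(1) unfolding atLeastAtMost_iff by linarith
  have "?e b \<notin> S"
  proof
    assume "?e b \<in> S"
    then obtain u v where uv: "u \<in> Wp" "v \<in> ?E (b - 1)" "?e b = u + v" unfolding S_def by blast
    have uc: "u \<in> carrier_vec ?N" using uv(1) lin_subD(1)[OF Wp] by blast
    have vc: "v \<in> carrier_vec ?N" using uv(2) std_sub_carrier by blast
    have "u - ?e b = (-1) \<cdot>\<^sub>v v" unfolding uv(3) using uc vc by (intro eq_vecI) auto
    then have ue: "u - ?e b \<in> ?E (b - 1)" using lin_subD(4)[OF std_sub_lin uv(2), of "-1"] by simp
    show False
    proof (cases "a = 1")
      case True
      then have "u = 0\<^sub>v ?N" using uv(1) by (simp add: Wp_def)
      then have "(0\<^sub>v ?N - ?e b) $ (b - 1) = 0" using std_subD[OF ue, of "b - 1"] bN by simp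
      then show False using bN by simp
    next
      case False
      then have "u \<in> y (a - 1)" using uv(1) by (simp add: Wp_def)
      moreover have "1 \<le> a - 1" using False a by auto
      ultimately have "Q (a - 1)" using ue by (auto simp: Q_def)
      then show False using amin[of "a - 1"] a by auto
    qed
  qed
  then obtain l where l: "l \<in> carrier_vec ?N" "l \<bullet> ?e b = 1" "\<forall>s\<in>S. l \<bullet> s = 0"
    using separating_functional[OF S ec] by blast
  have lE: "l \<bullet> v = 0" if v: "v \<in> ?E (b - 1)" for v
  proof -
    have "v = 0\<^sub>v ?N + v" using v std_sub_carrier[of ?N "b - 1"] by auto
    then have "v \<in> S" unfolding S_def using v lin_subD(2)[OF Wp] by blast
    then show ?thesis using l(3) by blast
  qed
  have lW: "l \<bullet> v = 0" if v: "1 < a" "v \<in> y (a - 1)" for v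
  proof -
    have vW: "v \<in> Wp" using v by (simp add: Wp_def)
    have "v = v + 0\<^sub>v ?N" using vW lin_subD(1)[OF Wp] by auto
    then have "v \<in> S" unfolding S_def using vW lin_subD(2)[OF std_sub_lin] by blast
    then show ?thesis using l(3) by blast
  qed
  have lz: "l \<bullet> z = 1"
  proof -
    have "z = ?e b + (z - ?e b)" using zc by (intro eq_vecI) auto
    then have "l \<bullet> z = l \<bullet> (?e b + (z - ?e b))" by simp
    also have "\<dots> = l \<bullet> ?e b + l \<bullet> (z - ?e b)" using l(1) zc by (intro scalar_prod_add_distrib[of _ ?N]) auto
    finally show ?thesis using l(2) lE[OF z(2)] by simp
  qed
  have "z \<notin> ?E (a - 1)"
  proof
    assume "z \<in> ?E (a - 1)"
    then have "z $ (b - 1) = 0" using ab b(1) by (auto simp: std_sub_def)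
    then show False using zb by simp
  qed
  then have "(\<lambda>w. tail *\<^sub>v w) ` y a \<noteq> std_sub n a" using tail_surj_iff(2)[OF y a] z(1) zE by blast
  then obtain d where d: "d \<in> std_sub n a" "d \<notin> (\<lambda>w. tail *\<^sub>v w) ` y a" using tail_surj_iff(1)[OF y a] by blast
  have "\<exists>c. c \<in> carrier_vec ?N \<and> tail *\<^sub>v c = d \<and> (b < n \<longrightarrow> c \<in> y (b + 1))"
  proof (cases "b < n")
    case True
    then have b1: "b + 1 \<in> {1..n}" by auto
    have "(\<lambda>w. tail *\<^sub>v w) ` y (b + 1) = std_sub n (b + 1)"
    proof (rule ccontr)
      assume "(\<lambda>w. tail *\<^sub>v w) ` y (b + 1) \<noteq> std_sub n (b + 1)"
      then obtain w where "w \<in> y (b + 1)" "w \<in> ?E n" "w \<notin> ?E (b + 1 - 1)" using notcell[OF b1] by blast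
      from leading_unit[OF y b1 this] obtain b' where "b' \<in> {b + 1..n}" "?e b' \<in> y b'" by blast
      then show False using bmax[of b'] by (auto simp: B_def)
    qed
    moreover have "d \<in> std_sub n (b + 1)" using d(1) std_sub_mono[of a "b + 1" n] ab by auto
    ultimately obtain c where "c \<in> y (b + 1)" "d = tail *\<^sub>v c" by (metis imageE)
    then show ?thesis using flags_W_D(3)[OF y b1] by blast
  next
    case False
    \<comment> \<open>There is no member after the \<open>n\<close>-th one, so any lift of \<open>d\<close> will do.\<close>
    let ?c = "vec ?N (\<lambda>r. if n \<le> r then d $ (r - n) else 0)"
    have "tail *\<^sub>v ?c = d"
      using tail_index[of ?c] d(1) tail_carrier by (intro eq_vecI) (auto simp: std_sub_def)
    then show ?thesis using False by (intro exI[of _ ?c]) auto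
  qed
  then obtain c where c: "c \<in> carrier_vec ?N" "tail *\<^sub>v c = d" "b < n \<longrightarrow> c \<in> y (b + 1)" by blast
  have "c \<in> ?E (n + a)" using tail_std[OF c(1)] c(2) d(1) by simp
  moreover have "tail *\<^sub>v z = 0\<^sub>v n" using tail_zero_iff[OF zc] zE by simp
  ultimately show thesis
    using that[of a b l c z] ab b(1) l(1) c d(2) lE lW z(1) lz by auto
qed

text \<open>Apply \<open>1 + t c l\<close> to the members with indices \<open>a, \<dots>, b\<close>. The inclusion from \<open>a - 1\<close> to \<open>a\<close> survives because \<open>l\<close> kills the smaller space, and the one from \<open>b\<close> to \<open>b + 1\<close> because \<open>c\<close> lies in the larger one. The vector \<open>z\<close>, which is invisible modulo \<open>E\<^sub>n\<close>, becomes \<open>z + t c\<close>, so the rank of the \<open>a\<close>-th member modulo \<open>E\<^sub>n\<close> grows; no other rank drops because every vector can be changed by a multiple of \<open>z\<close> to one that the deformation fixes.\<close>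

lemma deformation_step:
  assumes y: "y \<in> flags_W" and nc: "\<exists>i\<in>{1..n}. (\<lambda>w. tail *\<^sub>v w) ` y i \<noteq> std_sub n i"
  obtains G where "\<And>i t. G i t \<in> carrier_mat (2 * n) (2 * n)" "\<And>i. G i 0 = 1\<^sub>m (2 * n)"
    "\<And>i a b. a < 2 * n \<Longrightarrow> b < 2 * n \<Longrightarrow> continuous_on UNIV (\<lambda>t :: complex. G i t $$ (a, b))"
    "eventually (\<lambda>t. act n (\<lambda>i. G i t) y \<in> flags_W \<and> tail_rank y < tail_rank (act n (\<lambda>i. G i t) y)) (at 0)"
proof -
  let ?N = "2 * n" and ?E = "std_sub (2 * n)"
  obtain a b l c z where D: "1 \<le> a" "a \<le> b" "b \<le> n" "l \<in> carrier_vec ?N" "c \<in> ?E (n + a)"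
    "b < n \<longrightarrow> c \<in> y (b + 1)" "tail *\<^sub>v c \<notin> (\<lambda>w. tail *\<^sub>v w) ` y a"
    "\<forall>v. v \<in> ?E (b - 1) \<longrightarrow> l \<bullet> v = 0" "\<forall>v. 1 < a \<longrightarrow> v \<in> y (a - 1) \<longrightarrow> l \<bullet> v = 0"
    "z \<in> y a" "tail *\<^sub>v z = 0\<^sub>v n" "l \<bullet> z = 1"
    by (rule deformation_data[OF y nc]) blast
  have c: "c \<in> carrier_vec ?N" using D(5) std_sub_carrier by blast
  note R = rank1_mult[OF c D(4)]
  have Rc: "rank1 c l t \<in> carrier_mat ?N ?N" for t using R(1)[OF c] .
  define G where "G i t = (if a \<le> i \<and> i \<le> b then rank1 c l t else 1\<^sub>m ?N)" for i t
  have Gc: "G i t \<in> carrier_mat ?N ?N" for i t using Rc by (simp add: G_def)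
  have G0: "G i 0 = 1\<^sub>m ?N" for i using rank1_zero[OF c] by (simp add: G_def)
  have Gcont: "continuous_on UNIV (\<lambda>t :: complex. G i t $$ (r, s))" if "r < ?N" "s < ?N" for i r s
    using that c by (cases "a \<le> i \<and> i \<le> b") (auto simp: G_def rank1_def intro!: continuous_intros)
  have main: "act n (\<lambda>i. G i t) y \<in> flags_W \<and> tail_rank y < tail_rank (act n (\<lambda>i. G i t) y)"
    if t: "t \<noteq> 0" "1 + t * (l \<bullet> c) \<noteq> 0" for t
  proof -
    let ?x = "act n (\<lambda>i. G i t) y" and ?g = "\<lambda>v. rank1 c l t *\<^sub>v v"
    have xin: "?x i = ?g ` y i" if "i \<in> {1..n}" "a \<le> i" "i \<le> b" for i using that by (simp add: act_def G_def)
    have xout: "?x i = y i" if i: "i \<in> {1..n}" "\<not> (a \<le> i \<and> i \<le> b)" for i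
    proof -
      have "?x i = (\<lambda>v. 1\<^sub>m ?N *\<^sub>v v) ` y i" using i by (auto simp: act_def G_def)
      also have "\<dots> = (\<lambda>v. v) ` y i" by (rule image_cong) (use flags_W_D(3)[OF y i(1)] in auto)
      finally show ?thesis by simp
    qed
    have Gr: "?x i \<in> Gr (2 * i - 1) ?N" if i: "i \<in> {1..n}" for i
    proof (cases "a \<le> i \<and> i \<le> b")
      case True
      then have "?x i = ?g ` y i" using xin[OF i] by blast
      moreover have "?g ` y i \<in> Gr (2 * i - 1) ?N"
        by (rule Gr_inj_image[OF flags_W_D(1)[OF y i] Rc])
          (use rank1_inj[OF c D(4) _ t(2)] flags_W_D(3)[OF y i] in blast)
      ultimately show ?thesis by simp
    next
      case False
      then show ?thesis using xout[OF i] flags_W_D(1)[OF y i] by simp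
    qed
    have "?x \<in> points (ambW n)"
      unfolding points_def ambW_def using Gr by (auto simp: PiE_iff act_def)
    moreover have "?x i \<subseteq> ?x (i + 1)" if i: "i \<in> {1..n - 1}" for i
    proof -
      have i1: "i \<in> {1..n}" "i + 1 \<in> {1..n}" using index_succ[OF i] by auto
      note sub = flags_W_D(6)[OF y i]
      consider "i + 1 < a" | "i + 1 = a" | "a \<le> i" "i < b" | "i = b" | "b < i" using D(2) by linarith
      then show ?thesis
      proof cases
        case 1 then show ?thesis using xout[OF i1(1)] xout[OF i1(2)] sub by simp
      next
        case 2
        have "v \<in> ?g ` y a" if v: "v \<in> y i" for v
        proof -
          have "l \<bullet> v = 0" using D(9) v 2 i by auto
          then have "?g v = v" using rank1_fix[OF c D(4)] flags_W_D(3)[OF y i1(1)] v by blast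
          then show ?thesis using v sub 2 by (metis imageI subsetD)
        qed
        then show ?thesis using xout[OF i1(1)] xin[OF i1(2)] 2 D(2) by auto
      next
        case 3
        then show ?thesis using xin[OF i1(1)] xin[OF i1(2)] sub by auto
      next
        case 4
        have "?g v \<in> y (i + 1)" if v: "v \<in> y i" for v
        proof -
          have vc: "v \<in> carrier_vec ?N" using flags_W_D(3)[OF y i1(1)] v by blast
          note lin = lin_subD[OF flags_W_D(2)[OF y i1(2)]]
          have "c \<in> y (i + 1)" using D(6) 4 i by auto
          then have "v + (t * (l \<bullet> v)) \<cdot>\<^sub>v c \<in> y (i + 1)" using lin(3,4) sub v by blast
          then show ?thesis using R(2)[OF vc] by simp
        qed
        then show ?thesis using xin[OF i1(1)] xout[OF i1(2)] 4 D(2) by auto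
      next
        case 5 then show ?thesis using xout[OF i1(1)] xout[OF i1(2)] sub by simp
      qed
    qed
    moreover have "?E (i - 1) \<subseteq> ?x i \<and> ?x i \<subseteq> ?E (n + i)" if i: "i \<in> {1..n}" for i
    proof (cases "a \<le> i \<and> i \<le> b")
      case True
      have "v \<in> ?g ` y i" if v: "v \<in> ?E (i - 1)" for v
      proof -
        have "i - 1 \<le> b - 1" using True by linarith
        then have "v \<in> ?E (b - 1)" using v std_sub_mono by blast
        then have "?g v = v" using D(8) rank1_fix[OF c D(4)] std_sub_carrier by blast
        then show ?thesis using v flags_W_D(4)[OF y i] by (metis imageI subsetD)
      qed
      moreover have "?g v \<in> ?E (n + i)" if v: "v \<in> y i" for v
      proof -
        have vc: "v \<in> carrier_vec ?N" using flags_W_D(3)[OF y i] v by blast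
        note lin = lin_subD[OF std_sub_lin[of ?N "n + i"]]
        have "c \<in> ?E (n + i)" using D(5) True std_sub_mono[of "n + a" "n + i" ?N] by auto
        then have "v + (t * (l \<bullet> v)) \<cdot>\<^sub>v c \<in> ?E (n + i)" using lin(3,4) flags_W_D(5)[OF y i] v by blast
        then show ?thesis using R(2)[OF vc] by simp
      qed
      ultimately show ?thesis using xin[OF i] True by auto
    next
      case False
      then show ?thesis using xout[OF i] flags_W_D(4,5)[OF y i] by simp
    qed
    ultimately have xW: "?x \<in> flags_W" by (simp add: flags_W_def SL_mod_P_def)
    have zi: "z \<in> y i" if "a \<le> i" "i \<le> n" for i using flags_W_mono[OF y D(1) that] D(10) by blast
    have zc: "z \<in> carrier_vec ?N" using flags_W_D(3)[OF y, of a] D(1-3,10) by auto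
    have mono: "(\<lambda>w. tail *\<^sub>v w) ` y i \<subseteq> (\<lambda>w. tail *\<^sub>v w) ` ?x i" if i: "i \<in> {1..n}" for i
    proof (cases "a \<le> i \<and> i \<le> b")
      case True
      show ?thesis
      proof
        fix d assume "d \<in> (\<lambda>w. tail *\<^sub>v w) ` y i"
        then obtain u where u: "u \<in> y i" "d = tail *\<^sub>v u" by blast
        have uc: "u \<in> carrier_vec ?N" using flags_W_D(3)[OF y i] u by blast
        note lin = flags_W_D(2)[OF y i]
        \<comment> \<open>The vector \<open>u\<close> changed within its class modulo \<open>E\<^sub>n\<close> to one that is fixed by the deformation.\<close>
        let ?u = "u - (l \<bullet> u) \<cdot>\<^sub>v z"
        have zy: "(l \<bullet> u) \<cdot>\<^sub>v z \<in> y i" using lin_subD(4)[OF lin] zi True i by auto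
        have uy: "?u \<in> y i" by (rule lin_sub_minus[OF lin u(1) zy])
        have "l \<bullet> ?u = l \<bullet> u - (l \<bullet> u) * (l \<bullet> z)"
          using D(4) uc zc by (simp add: scalar_prod_minus_distrib[of _ ?N])
        then have "l \<bullet> ?u = 0" using D(12) by simp
        then have "?g ?u = ?u" using rank1_fix[OF c D(4)] uc zc by simp
        then have ux: "?u \<in> ?x i" using xin[OF i] True uy by (metis imageI)
        have "tail *\<^sub>v ?u = tail *\<^sub>v u - (l \<bullet> u) \<cdot>\<^sub>v (tail *\<^sub>v z)"
          using mult_minus_distrib_mat_vec[OF tail_carrier uc, of "(l \<bullet> u) \<cdot>\<^sub>v z"] mult_mat_vec[OF tail_carrier zc] zc by simp
        also have "\<dots> = tail *\<^sub>v u" unfolding D(11) by (rule minus_smult_zero[OF mult_mat_vec_carrier[OF tail_carrier uc]])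
        finally have "tail *\<^sub>v ?u = d" using u(2) by simp
        then show "d \<in> (\<lambda>w. tail *\<^sub>v w) ` ?x i" using ux by (metis imageI)
      qed
    next
      case False
      then show ?thesis using xout[OF i] by simp
    qed
    have an: "a \<in> {1..n}" using D(1-3) by auto
    have strict: "(\<lambda>w. tail *\<^sub>v w) ` y a \<noteq> (\<lambda>w. tail *\<^sub>v w) ` ?x a"
    proof
      assume eq: "(\<lambda>w. tail *\<^sub>v w) ` y a = (\<lambda>w. tail *\<^sub>v w) ` ?x a"
      have "?g z \<in> ?x a" using xin[OF an] D(2,10) by simp
      then have "tail *\<^sub>v ?g z \<in> (\<lambda>w. tail *\<^sub>v w) ` y a" using eq by blast
      moreover have "tail *\<^sub>v ?g z = t \<cdot>\<^sub>v (tail *\<^sub>v c)"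
      proof -
        have "tail *\<^sub>v ?g z = tail *\<^sub>v z + tail *\<^sub>v (t \<cdot>\<^sub>v c)"
          using R(2)[OF zc] D(12) mult_add_distrib_mat_vec[OF tail_carrier zc, of "t \<cdot>\<^sub>v c"] c by simp
        then show ?thesis using D(11) mult_mat_vec[OF tail_carrier c] mult_mat_vec_carrier[OF tail_carrier c] by simp
      qed
      ultimately have "t \<cdot>\<^sub>v (tail *\<^sub>v c) \<in> (\<lambda>w. tail *\<^sub>v w) ` y a" by simp
      from lin_subD(4)[OF tail_image_lin[OF y an] this, of "1 / t"]
      have "(1 / t) \<cdot>\<^sub>v (t \<cdot>\<^sub>v (tail *\<^sub>v c)) \<in> (\<lambda>w. tail *\<^sub>v w) ` y a" .
      moreover have "(1 / t) \<cdot>\<^sub>v (t \<cdot>\<^sub>v (tail *\<^sub>v c)) = tail *\<^sub>v c" using t(1) by (intro eq_vecI) auto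
      ultimately show False using D(7) by simp
    qed
    have "tail_rank y < tail_rank ?x"
      unfolding tail_rank_def
    proof (rule sum_strict_mono_ex1)
      show "\<forall>i\<in>{1..n}. vdimn n ((\<lambda>w. tail *\<^sub>v w) ` y i) \<le> vdimn n ((\<lambda>w. tail *\<^sub>v w) ` ?x i)"
        using vdimn_mono(1)[OF tail_image_lin[OF y] tail_image_lin[OF xW] mono] by blast
      show "\<exists>i\<in>{1..n}. vdimn n ((\<lambda>w. tail *\<^sub>v w) ` y i) < vdimn n ((\<lambda>w. tail *\<^sub>v w) ` ?x i)"
        using vdimn_mono(2)[OF tail_image_lin[OF y an] tail_image_lin[OF xW an] mono[OF an] strict] an by blast
    qed simp
    then show ?thesis using xW by blast
  qed
  have "((\<lambda>t. 1 + t * (l \<bullet> c)) \<longlongrightarrow> 1 + 0 * (l \<bullet> c)) (at 0)" by (intro tendsto_intros)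
  then have "eventually (\<lambda>t. 1 + t * (l \<bullet> c) \<noteq> 0) (at 0)" using tendsto_imp_eventually_ne by fastforce
  then have "eventually (\<lambda>t. act n (\<lambda>i. G i t) y \<in> flags_W \<and> tail_rank y < tail_rank (act n (\<lambda>i. G i t) y)) (at 0)"
    using eventually_neq_at_within[of 0 0 UNIV] by eventually_elim (use main in blast)
  then show thesis using that[of G] Gc G0 Gcont by blast
qed

lemma flags_W_points: "flags_W \<subseteq> points (ambW n)"
  by (auto simp: flags_W_def SL_mod_P_def)

lemma flags_W_closure:
  assumes "y \<in> flags_W" shows "y \<in> zariski (ambW n) closure_of borel_orbit n"
  using assms
proof (induction "n * n - tail_rank y" arbitrary: y rule: less_induct)
  case less
  show ?case
  proof (cases "\<exists>i\<in>{1..n}. (\<lambda>w. tail *\<^sub>v w) ` y i \<noteq> std_sub n i")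
    case False
    then have "y \<in> borel_orbit n" using big_cell[OF less.prems] by blast
    moreover have "borel_orbit n \<subseteq> topspace (zariski (ambW n))"
      using borel_orbit_subset flags_W_points topspace_zariski by blast
    ultimately show ?thesis using closure_of_subset by blast
  next
    case True
    obtain G where G: "\<And>i t. G i t \<in> carrier_mat (2 * n) (2 * n)" "\<And>i. G i 0 = 1\<^sub>m (2 * n)"
      "\<And>i a b. a < 2 * n \<Longrightarrow> b < 2 * n \<Longrightarrow> continuous_on UNIV (\<lambda>t :: complex. G i t $$ (a, b))"
      "eventually (\<lambda>t. act n (\<lambda>i. G i t) y \<in> flags_W \<and> tail_rank y < tail_rank (act n (\<lambda>i. G i t) y)) (at 0)"
      by (rule deformation_step[OF less.prems True]) blast
    show ?thesis
    proof (rule closedin_deformation[of "ambW n" _ y G])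
      show "closedin (zariski (ambW n)) (zariski (ambW n) closure_of borel_orbit n)" by (rule closedin_closure_of)
      show "y \<in> points (ambW n)" using less.prems flags_W_points by blast
      show "\<forall>\<^sub>F t in at 0. act (factors (ambW n)) (\<lambda>i. G i t) y \<in> zariski (ambW n) closure_of borel_orbit n"
        using G(4)
      proof eventually_elim
        case (elim t)
        let ?x = "act n (\<lambda>i. G i t) y"
        have "tail_rank y < tail_rank ?x" "tail_rank ?x \<le> n * n" using elim tail_rank_le[of ?x] by blast+
        then have "n * n - tail_rank ?x < n * n - tail_rank y" by linarith
        then have "?x \<in> zariski (ambW n) closure_of borel_orbit n" using less.hyps elim by blast
        then show ?case by (simp add: ambW_def)
      qed
    qed (use G in \<open>auto simp: ambW_def\<close>)
  qed
qed

lemma closed_flags_W: "closedin (zariski (ambW n)) flags_W"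
proof -
  let ?A = "ambW n" and ?N = "2 * n"
  have fac: "factors ?A = n" "vdim ?A = ?N" by (auto simp: ambW_def)
  let ?D = "\<lambda>k. mat ?N ?N (\<lambda>(r, s). if r = s \<and> k \<le> r then 1 else 0) :: complex mat"
  have D: "?D k *\<^sub>v v = 0\<^sub>v ?N \<longleftrightarrow> v \<in> std_sub ?N k" if v: "v \<in> carrier_vec ?N" for k v
  proof -
    have "(?D k *\<^sub>v v) $ r = (if k \<le> r then v $ r else 0)" if r: "r < ?N" for r
    proof -
      have "row (?D k) r = (if k \<le> r then unit_vec ?N r else 0\<^sub>v ?N)" using r by (intro eq_vecI) auto
      then show ?thesis using r v by simp
    qed
    then have "?D k *\<^sub>v v = 0\<^sub>v ?N \<longleftrightarrow> (\<forall>r<?N. (if k \<le> r then v $ r else 0) = 0)"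
      by (auto simp: vec_eq_iff)
    then show ?thesis using v by (auto simp: std_sub_def)
  qed
  have "flags_W = {x \<in> points ?A. (\<forall>i\<in>{1..n - 1}. \<forall>v\<in>x i. 1\<^sub>m ?N *\<^sub>v v \<in> x (i + 1)) \<and>
    ((\<forall>i\<in>{1..n}. \<forall>j\<in>{..<i - 1}. unit_vec ?N j \<in> x i) \<and>
    (\<forall>i\<in>{1..n}. \<forall>v\<in>x i. ?D (n + i) *\<^sub>v v = 0\<^sub>v ?N))}"
  proof -
    have "x \<in> flags_W \<longleftrightarrow> (\<forall>i\<in>{1..n - 1}. \<forall>v\<in>x i. 1\<^sub>m ?N *\<^sub>v v \<in> x (i + 1)) \<and>
      ((\<forall>i\<in>{1..n}. \<forall>j\<in>{..<i - 1}. unit_vec ?N j \<in> x i) \<and>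
      (\<forall>i\<in>{1..n}. \<forall>v\<in>x i. ?D (n + i) *\<^sub>v v = 0\<^sub>v ?N))" if xp: "x \<in> points ?A" for x
    proof -
      have G: "x i \<in> Gr (2 * i - 1) ?N" if "i \<in> {1..n}" for i
        using frame_spec(1)[OF xp, of i] that by (simp add: ambW_def)
      have 1: "(\<forall>v\<in>x i. 1\<^sub>m ?N *\<^sub>v v \<in> x (i + 1)) \<longleftrightarrow> x i \<subseteq> x (i + 1)" if i: "i \<in> {1..n - 1}" for i
      proof -
        have "1\<^sub>m ?N *\<^sub>v v = v" if "v \<in> x i" for v
          using Gr_carrier[OF G] index_succ[OF i] that by (intro one_mult_mat_vec) blast
        then show ?thesis by auto
      qed
      have 2: "(\<forall>j\<in>{..<i - 1}. unit_vec ?N j \<in> x i) \<longleftrightarrow> std_sub ?N (i - 1) \<subseteq> x i" if i: "i \<in> {1..n}" for i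
      proof -
        have "i - 1 \<le> ?N" using i by auto
        from std_sub_subset_iff[OF Gr_lin_sub[OF G[OF i]] this] show ?thesis by auto
      qed
      have 3: "(\<forall>v\<in>x i. ?D (n + i) *\<^sub>v v = 0\<^sub>v ?N) \<longleftrightarrow> x i \<subseteq> std_sub ?N (n + i)" if i: "i \<in> {1..n}" for i
        using D Gr_carrier[OF G[OF i]] by (meson subset_iff)
      show ?thesis
        using xp by (simp add: flags_W_def SL_mod_P_def 1 2 3 ball_conj_distrib del: atLeastAtMost_iff One_nat_def)
    qed
    then show ?thesis using flags_W_points by blast
  qed
  moreover have "closedin (zariski ?A) {x \<in> points ?A. (\<forall>i\<in>{1..n - 1}. \<forall>v\<in>x i. 1\<^sub>m ?N *\<^sub>v v \<in> x (i + 1)) \<and>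
    ((\<forall>i\<in>{1..n}. \<forall>j\<in>{..<i - 1}. unit_vec ?N j \<in> x i) \<and>
    (\<forall>i\<in>{1..n}. \<forall>v\<in>x i. ?D (n + i) *\<^sub>v v = 0\<^sub>v ?N))}"
    using index_succ by (intro closed_conj closed_ball closed_incidence closed_member closed_kernel)
      (simp_all add: fac del: atLeastAtMost_iff One_nat_def)
  ultimately show ?thesis by simp
qed

lemma schubert_eq: "schubert n (sigma n) = flags_W"
proof -
  let ?X = "zariski (ambW n)"
  have sub: "borel_orbit n \<subseteq> SL_mod_P n" using borel_orbit_subset by (auto simp: flags_W_def)
  have "schubert n (sigma n) = SL_mod_P n \<inter> ?X closure_of borel_orbit n"
    unfolding schubert_def borel_orbit_def[symmetric] closure_of_subtopology using sub by (simp add: Int_absorb1)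
  also have "?X closure_of borel_orbit n = flags_W"
    using closure_of_minimal[OF borel_orbit_subset closed_flags_W] flags_W_closure by blast
  finally show ?thesis by (auto simp: flags_W_def)
qed

end

section \<open>Involutions, closedness and equivariance\<close>

lemma minus_add_vec: "(w :: complex vec) \<in> carrier_vec N \<Longrightarrow> u \<in> carrier_vec N \<Longrightarrow> w - u + u = w"
  by (intro eq_vecI) auto

text \<open>The orthogonal is the kernel of a matrix with \<open>d\<close> rows that has a right inverse.\<close>

lemma orthogonal_Gr:
  assumes U: "U \<in> Gr d N" and G: "G \<in> carrier_mat N N"
    and inj: "\<And>v. v \<in> carrier_vec N \<Longrightarrow> G *\<^sub>v v = 0\<^sub>v N \<Longrightarrow> v = 0\<^sub>v N"
  shows "perp G U \<in> Gr (N - d) N"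
proof -
  obtain M where M: "M \<in> carrier_mat N d" "inj_mat M" "img M = U" using Gr_frame[OF U] .
  have GM: "G * M \<in> carrier_mat N d" using G M by simp
  have "inj_mat (G * M)"
  proof (rule inj_matI[OF GM])
    fix v assume v: "v \<in> carrier_vec d" "(G * M) *\<^sub>v v = 0\<^sub>v N"
    have "G *\<^sub>v (M *\<^sub>v v) = 0\<^sub>v N" using v(2) unfolding assoc_mult_mat_vec[OF G M(1) v(1)] .
    then have "M *\<^sub>v v = 0\<^sub>v N" using inj mult_mat_vec_carrier[OF M(1) v(1)] by blast
    then show "v = 0\<^sub>v d" by (rule inj_matD[OF M(2,1) v(1)])
  qed
  then obtain L where L: "L \<in> carrier_mat d N" "L * (G * M) = 1\<^sub>m d" using inj_left_inverse[OF GM] by blast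
  let ?A = "transpose_mat (G * M)"
  have A: "?A \<in> carrier_mat d N" and LT: "transpose_mat L \<in> carrier_mat N d" using GM L by auto
  have AL: "?A * transpose_mat L = 1\<^sub>m d" using transpose_mult[OF L(1) GM] L(2) by simp
  have surj: "(\<lambda>v. ?A *\<^sub>v v) ` carrier_vec N = carrier_vec d"
  proof
    show "carrier_vec d \<subseteq> (\<lambda>v. ?A *\<^sub>v v) ` carrier_vec N"
    proof
      fix w :: "complex vec" assume w: "w \<in> carrier_vec d"
      have "?A *\<^sub>v (transpose_mat L *\<^sub>v w) = w"
        using assoc_mult_mat_vec[OF A LT w] AL w by simp
      moreover have "transpose_mat L *\<^sub>v w \<in> carrier_vec N" by (rule mult_mat_vec_carrier[OF LT w])
      ultimately show "w \<in> (\<lambda>v. ?A *\<^sub>v v) ` carrier_vec N" by (metis imageI)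
    qed
    show "(\<lambda>v. ?A *\<^sub>v v) ` carrier_vec N \<subseteq> carrier_vec d" using mult_mat_vec_carrier[OF A] by blast
  qed
  have pair: "bform G v (M *\<^sub>v x) = (?A *\<^sub>v v) \<bullet> x" if v: "v \<in> carrier_vec N" and x: "x \<in> carrier_vec d" for v x
    unfolding bform_def assoc_mult_mat_vec[OF G M(1) x, symmetric] by (rule transpose_vec_mult_scalar[OF GM x v, symmetric])
  have "perp G U = {v \<in> carrier_vec N. ?A *\<^sub>v v = 0\<^sub>v d}"
  proof (intro equalityI subsetI)
    fix v assume "v \<in> perp G U"
    then have v: "v \<in> carrier_vec N" "\<forall>u\<in>U. bform G v u = 0" using G by (auto simp: perp_def)
    have "?A *\<^sub>v v = 0\<^sub>v d"
    proof (rule eq_vecI)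
      fix a assume "a < dim_vec (0\<^sub>v d :: complex vec)"
      then have a: "a < d" by simp
      have "(?A *\<^sub>v v) \<bullet> unit_vec d a = 0"
        using v(2) imgI[OF M(1) unit_vec_carrier] M(3) pair[OF v(1) unit_vec_carrier] by metis
      then show "(?A *\<^sub>v v) $ a = 0\<^sub>v d $ a" using a scalar_prod_right_unit[OF a, of "?A *\<^sub>v v"] by simp
    qed (use A in auto)
    then show "v \<in> {v \<in> carrier_vec N. ?A *\<^sub>v v = 0\<^sub>v d}" using v(1) by blast
  next
    fix v assume "v \<in> {v \<in> carrier_vec N. ?A *\<^sub>v v = 0\<^sub>v d}"
    then have v: "v \<in> carrier_vec N" "?A *\<^sub>v v = 0\<^sub>v d" by auto
    have "bform G v u = 0" if "u \<in> U" for u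
    proof -
      have "u \<in> img M" using that M(3) by simp
      then obtain x where x: "x \<in> carrier_vec d" "u = M *\<^sub>v x" by (rule imgE[OF _ M(1)])
      show ?thesis unfolding x(2) pair[OF v(1) x(1)] v(2) using x(1) by simp
    qed
    then show "v \<in> perp G U" using v(1) G by (simp add: perp_def)
  qed
  moreover obtain k where k: "{v \<in> carrier_vec N. ?A *\<^sub>v v = 0\<^sub>v d} \<in> Gr k N"
    using lin_sub_Gr[OF lin_sub_kernel[OF Gr_lin_sub[OF Gr_full] A]] by blast
  moreover have "N = k + d" using rank_nullity[OF Gr_full A k] surj Gr_full[of d] by simp
  ultimately show ?thesis by simp
qed

text \<open>One inclusion between a member and the orthogonal of the opposite one suffices, as their dimensions agree.\<close>

lemma iota_fixed_iff:
  assumes x: "x \<in> points A" and fac: "factors A = n" "vdim A = N"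
    and dims: "\<And>i. i \<in> {1..n} \<Longrightarrow> subdim A i + subdim A (n + 1 - i) = N"
    and G: "G \<in> carrier_mat N N" and inj: "\<And>v. v \<in> carrier_vec N \<Longrightarrow> G *\<^sub>v v = 0\<^sub>v N \<Longrightarrow> v = 0\<^sub>v N"
  shows "iota n G x = x \<longleftrightarrow> (\<forall>i\<in>{1..n}. \<forall>u\<in>x i. \<forall>v\<in>x (n + 1 - i). bform G u v = 0)"
proof -
  have Gr: "x i \<in> Gr (subdim A i) N" if "i \<in> {1..n}" for i
    using frame_spec(1)[OF x] that fac by simp
  have j: "n + 1 - i \<in> {1..n}" if "i \<in> {1..n}" for i using that by auto
  have eq: "perp G (x (n + 1 - i)) = x i \<longleftrightarrow> (\<forall>u\<in>x i. \<forall>v\<in>x (n + 1 - i). bform G u v = 0)" if i: "i \<in> {1..n}" for i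
  proof
    assume "perp G (x (n + 1 - i)) = x i"
    then show "\<forall>u\<in>x i. \<forall>v\<in>x (n + 1 - i). bform G u v = 0" unfolding perp_def by blast
  next
    assume "\<forall>u\<in>x i. \<forall>v\<in>x (n + 1 - i). bform G u v = 0"
    then have sub: "x i \<subseteq> perp G (x (n + 1 - i))" using Gr_carrier[OF Gr[OF i]] G by (auto simp: perp_def)
    have "perp G (x (n + 1 - i)) \<in> Gr (N - subdim A (n + 1 - i)) N" by (rule orthogonal_Gr[OF Gr[OF j[OF i]] G inj])
    moreover have "N - subdim A (n + 1 - i) = subdim A i" using dims[OF i] by simp
    ultimately show "perp G (x (n + 1 - i)) = x i" using Gr_mono(2)[OF Gr[OF i] _ sub] by simp
  qed
  have "iota n G x = x \<longleftrightarrow> (\<forall>i\<in>{1..n}. perp G (x (n + 1 - i)) = x i)"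
  proof
    assume a: "iota n G x = x"
    show "\<forall>i\<in>{1..n}. perp G (x (n + 1 - i)) = x i"
    proof
      fix i assume "i \<in> {1..n}"
      then have "iota n G x i = perp G (x (n + 1 - i))" unfolding iota_def by (rule restrict_apply')
      then show "perp G (x (n + 1 - i)) = x i" unfolding a by simp
    qed
  next
    assume "\<forall>i\<in>{1..n}. perp G (x (n + 1 - i)) = x i"
    then have "iota n G x = restrict x {1..n}" unfolding iota_def by (intro restrict_ext) blast
    also have "\<dots> = x" using x fac by (auto simp: points_def PiE_restrict)
    finally show "iota n G x = x" .
  qed
  then show ?thesis using eq by simp
qed

lemma ratmat_join:
  assumes K: "ratmat A U r k K" and R: "ratmat A U r c R"
  shows "ratmat A U r (k + c) (\<lambda>x. join_cols (K x) (R x))"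
  unfolding ratmat_def
proof (intro conjI ballI allI impI)
  fix x assume x: "x \<in> U"
  have "dim_row (K x) = r" "dim_col (K x) = k" "dim_col (R x) = c" using K R x by (auto simp: ratmat_def)
  then show "join_cols (K x) (R x) \<in> carrier_mat r (k + c)" unfolding join_cols_def by simp
next
  fix a b assume ab: "a < r" "b < k + c"
  have dim: "dim_row (K x) = r \<and> dim_col (K x) = k \<and> dim_col (R x) = c" if "x \<in> U" for x
    using K R that by (auto simp: ratmat_def)
  show "ratfun A U (\<lambda>x. join_cols (K x) (R x) $$ (a, b))"
  proof (cases "b < k")
    case True
    then have "ratfun A U (\<lambda>x. K x $$ (a, b))" using K ab by (auto simp: ratmat_def)
    then show ?thesis by (rule ratfun_eqI) (use ab dim True in \<open>simp add: join_cols_def\<close>)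
  next
    case False
    then have "ratfun A U (\<lambda>x. R x $$ (a, b - k))" using R ab by (auto simp: ratmat_def)
    then show ?thesis by (rule ratfun_eqI) (use ab dim False in \<open>simp add: join_cols_def\<close>)
  qed
qed

context window
begin

lemma E_mat_inj:
  assumes v: "v \<in> carrier_vec (2 * n)" "E_mat n *\<^sub>v v = 0\<^sub>v (2 * n)" shows "v = 0\<^sub>v (2 * n)"
proof (rule eq_vecI)
  fix q assume "q < dim_vec (0\<^sub>v (2 * n) :: complex vec)"
  then have q: "q < 2 * n" by simp
  let ?r = "2 * n - 1 - q"
  have r: "?r < 2 * n" "2 * n - 1 - ?r = q" using q by auto
  have "(E_mat n *\<^sub>v v) $ ?r = (if ?r < n then 1 else - 1) * v $ q"
    using E_mat_row[OF r(1)] r v(1) q E_mat_carrier[of n] 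
      smult_scalar_prod_distrib[OF unit_vec_carrier v(1), of "if ?r < n then 1 else - 1" q] by simp
  then show "v $ q = 0\<^sub>v (2 * n) $ q" using v(2) r(1) q by (simp split: if_splits)
qed (use v in simp)

lemma dual_dual: "k < n + 1 \<Longrightarrow> dual (dual k) = k"
  using n1 by (auto simp: dual_def)

lemma gramV_inj:
  assumes v: "v \<in> carrier_vec (n + 1)" "gramV m *\<^sub>v v = 0\<^sub>v (n + 1)" shows "v = 0\<^sub>v (n + 1)"
proof (rule eq_vecI)
  fix q assume "q < dim_vec (0\<^sub>v (n + 1) :: complex vec)"
  then have q: "q < n + 1" by simp
  note r = dual_less[OF q]
  have "(gramV m *\<^sub>v v) $ dual q = (if dual_pos (dual q) then 1 else - 1) * v $ q"
    using gramV_row[OF r] r v(1) q gramV_carrier dual_dual[OF q]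
      smult_scalar_prod_distrib[OF unit_vec_carrier v(1), of "if dual_pos (dual q) then 1 else - 1" q] by simp
  then show "v $ q = 0\<^sub>v (n + 1) $ q" using v(2) r q by (simp split: if_splits)
qed (use v in simp)

lemma iota_V_iff:
  assumes "x \<in> points (ambV n)"
  shows "iota n (gramV m) x = x \<longleftrightarrow> (\<forall>i\<in>{1..n}. \<forall>u\<in>x i. \<forall>v\<in>x (n + 1 - i). bform (gramV m) u v = 0)"
  by (rule iota_fixed_iff[OF assms, of n "n + 1"]) (use gramV_carrier gramV_inj in \<open>auto simp: ambV_def\<close>)

lemma iota_W_iff:
  assumes "y \<in> points (ambW n)"
  shows "iota n (E_mat n) y = y \<longleftrightarrow> (\<forall>i\<in>{1..n}. \<forall>u\<in>y i. \<forall>v\<in>y (n + 1 - i). bform (E_mat n) u v = 0)"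
  by (rule iota_fixed_iff[OF assms, of n "2 * n"]) (use E_mat_carrier E_mat_inj in \<open>auto simp: ambW_def\<close>)

lemma zeta_iota:
  assumes x: "x \<in> deg_flags n"
  shows "iota n (E_mat n) (zeta x) = zeta x \<longleftrightarrow> iota n (gramV m) x = x"
proof -
  have xp: "x \<in> points (ambV n)" using x by (simp add: deg_flags_def)
  have zp: "zeta x \<in> points (ambW n)" using zeta_flags[OF x] flags_W_points by blast
  have "(\<forall>u\<in>zeta x i. \<forall>v\<in>zeta x (n + 1 - i). bform (E_mat n) u v = 0) \<longleftrightarrow>
    (\<forall>u\<in>x i. \<forall>v\<in>x (n + 1 - i). bform (gramV m) u v = 0)" if i: "i \<in> {1..n}" for i
  proof -
    let ?j = "n + 1 - i"
    have j: "?j \<in> {1..n}" using i by auto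
    have z: "zeta x k = {w \<in> std_sub (2 * n) (n + k). proj k *\<^sub>v w \<in> x k}" if "k \<in> {1..n}" for k
      using that by (simp add: zeta_def)
    show ?thesis
    proof
      assume L: "\<forall>u\<in>zeta x i. \<forall>v\<in>zeta x ?j. bform (E_mat n) u v = 0"
      show "\<forall>u\<in>x i. \<forall>v\<in>x ?j. bform (gramV m) u v = 0"
      proof (intro ballI)
        fix u v assume uv: "u \<in> x i" "v \<in> x ?j"
        have c: "u \<in> carrier_vec (n + 1)" "v \<in> carrier_vec (n + 1)"
          using uv Gr_carrier[OF deg_flags_Gr[OF x i]] Gr_carrier[OF deg_flags_Gr[OF x j]] by blast+
        have "lift i *\<^sub>v u \<in> zeta x i" unfolding z[OF i] using lift_std[OF i c(1)] proj_lift[OF i c(1)] uv(1) by simp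
        moreover have "lift ?j *\<^sub>v v \<in> zeta x ?j" unfolding z[OF j] using lift_std[OF j c(2)] proj_lift[OF j c(2)] uv(2) by simp
        ultimately have "bform (E_mat n) (lift i *\<^sub>v u) (lift ?j *\<^sub>v v) = 0" using L by blast
        then show "bform (gramV m) u v = 0"
          using bform_compat[OF i lift_std[OF i c(1)] lift_std[OF j c(2)]] proj_lift[OF i c(1)] proj_lift[OF j c(2)] by simp
      qed
    next
      assume R: "\<forall>u\<in>x i. \<forall>v\<in>x ?j. bform (gramV m) u v = 0"
      show "\<forall>u\<in>zeta x i. \<forall>v\<in>zeta x ?j. bform (E_mat n) u v = 0"
        unfolding z[OF i] z[OF j] using bform_compat[OF i] R by auto
    qed
  qed
  then show ?thesis unfolding iota_V_iff[OF xp] iota_W_iff[OF zp] by simp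
qed

lemma SpFl_eq: "SpFl m = {x \<in> deg_flags n. iota n (gramV m) x = x}"
  by (simp add: SpFl_def n)

lemma schubert_iota_eq: "schubert_iota n (sigma n) = {y \<in> flags_W. iota n (E_mat n) y = y}"
  by (simp add: schubert_iota_def schubert_eq)

lemma zeta_bij: "bij_betw zeta (SpFl m) (schubert_iota n (sigma n))"
proof (rule bij_betw_byWitness[where f' = zeta_inv])
  show "\<forall>x\<in>SpFl m. zeta_inv (zeta x) = x" by (simp add: SpFl_eq zeta_inv_zeta)
  show "\<forall>y\<in>schubert_iota n (sigma n). zeta (zeta_inv y) = y" by (simp add: schubert_iota_eq zeta_zeta_inv)
  show "zeta ` SpFl m \<subseteq> schubert_iota n (sigma n)"
    using zeta_flags zeta_iota by (auto simp: SpFl_eq schubert_iota_eq)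
  show "zeta_inv ` schubert_iota n (sigma n) \<subseteq> SpFl m"
    using zeta_inv_flags zeta_iota[OF zeta_inv_flags] zeta_zeta_inv by (auto simp: SpFl_eq schubert_iota_eq)
qed

lemma closed_SpFl: "projective_variety (ambV n) (SpFl m)"
proof -
  let ?A = "ambV n"
  have fac: "factors ?A = n" "vdim ?A = n + 1" by (auto simp: ambV_def)
  let ?D = "\<lambda>i. mat (n + 1) (n + 1) (\<lambda>(r, s). if r = s \<and> r \<noteq> i - 1 then 1 else 0) :: complex mat"
  have D: "?D i *\<^sub>v v = pr i v" if v: "v \<in> carrier_vec (n + 1)" for i v
  proof (rule eq_vecI)
    fix r assume "r < dim_vec (pr i v)"
    then have r: "r < n + 1" using v by (simp add: pr_def)
    have "row (?D i) r = (if r = i - 1 then 0\<^sub>v (n + 1) else unit_vec (n + 1) r)" using r by (intro eq_vecI) auto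
    then show "(?D i *\<^sub>v v) $ r = pr i v $ r" using r v by (simp add: pr_def)
  qed (use v in \<open>simp add: pr_def\<close>)
  have "SpFl m = {x \<in> points ?A. (\<forall>i\<in>{1..n - 1}. \<forall>v\<in>x i. ?D i *\<^sub>v v \<in> x (i + 1)) \<and>
    (\<forall>i\<in>{1..n}. \<forall>u\<in>x i. \<forall>v\<in>x (n + 1 - i). bform (gramV m) u v = 0)}"
  proof -
    have "pr i ` x i \<subseteq> x (i + 1) \<longleftrightarrow> (\<forall>v\<in>x i. ?D i *\<^sub>v v \<in> x (i + 1))"
      if xp: "x \<in> points ?A" and i: "i \<in> {1..n - 1}" for x i
    proof -
      have "x i \<subseteq> carrier_vec (n + 1)"
        using Gr_carrier[OF frame_spec(1)[OF xp, of i]] index_succ[OF i] fac by simp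
      then have "?D i *\<^sub>v v = pr i v" if "v \<in> x i" for v using D that by blast
      then show ?thesis by auto
    qed
    then have "(\<forall>i\<in>{1..n - 1}. pr i ` x i \<subseteq> x (i + 1)) \<longleftrightarrow> (\<forall>i\<in>{1..n - 1}. \<forall>v\<in>x i. ?D i *\<^sub>v v \<in> x (i + 1))"
      if "x \<in> points ?A" for x using that by blast
    then have "x \<in> SpFl m \<longleftrightarrow> x \<in> points ?A \<and> (\<forall>i\<in>{1..n - 1}. \<forall>v\<in>x i. ?D i *\<^sub>v v \<in> x (i + 1)) \<and>
      (\<forall>i\<in>{1..n}. \<forall>u\<in>x i. \<forall>v\<in>x (n + 1 - i). bform (gramV m) u v = 0)" for x
      unfolding SpFl_eq deg_flags_def using iota_V_iff[of x] by blast
    then show ?thesis by blast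
  qed
  moreover have "closedin (zariski ?A) {x \<in> points ?A. (\<forall>i\<in>{1..n - 1}. \<forall>v\<in>x i. ?D i *\<^sub>v v \<in> x (i + 1)) \<and>
    (\<forall>i\<in>{1..n}. \<forall>u\<in>x i. \<forall>v\<in>x (n + 1 - i). bform (gramV m) u v = 0)}"
  proof (intro closed_conj closed_ball)
    fix i assume "i \<in> {1..n - 1}"
    then show "closedin (zariski ?A) {x \<in> points ?A. \<forall>v\<in>x i. ?D i *\<^sub>v v \<in> x (i + 1)}"
      using index_succ by (intro closed_incidence) (simp_all add: fac del: atLeastAtMost_iff One_nat_def)
  next
    fix i assume "i \<in> {1..n}"
    then show "closedin (zariski ?A) {x \<in> points ?A. \<forall>u\<in>x i. \<forall>v\<in>x (n + 1 - i). bform (gramV m) u v = 0}"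
      using gramV_carrier by (intro closed_orthogonal) (auto simp: fac)
  qed
  ultimately show ?thesis by (simp add: projective_variety_def)
qed

lemma closed_schubert_iota: "projective_variety (ambW n) (schubert_iota n (sigma n))"
proof -
  let ?A = "ambW n"
  have fac: "factors ?A = n" "vdim ?A = 2 * n" by (auto simp: ambW_def)
  have "schubert_iota n (sigma n) = flags_W \<inter> {y \<in> points ?A. \<forall>i\<in>{1..n}. \<forall>u\<in>y i. \<forall>v\<in>y (n + 1 - i). bform (E_mat n) u v = 0}"
    unfolding schubert_iota_eq using iota_W_iff flags_W_points by blast
  moreover have "closedin (zariski ?A) {y \<in> points ?A. \<forall>i\<in>{1..n}. \<forall>u\<in>y i. \<forall>v\<in>y (n + 1 - i). bform (E_mat n) u v = 0}"
  proof (rule closed_ball)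
    fix i assume "i \<in> {1..n}"
    then show "closedin (zariski ?A) {x \<in> points ?A. \<forall>u\<in>x i. \<forall>v\<in>x (n + 1 - i). bform (E_mat n) u v = 0}"
      using E_mat_carrier by (intro closed_orthogonal) (auto simp: fac)
  qed
  ultimately show ?thesis using closedin_Int[OF closed_flags_W] by (simp add: projective_variety_def)
qed

text \<open>The comparison map in terms of frames: a constant frame of \<open>E\<^sub>i\<^sub>-\<^sub>1\<close> next to the image of a frame of \<open>V\<^sub>i\<close>.\<close>

lemma zeta_frame:
  assumes i: "i \<in> {1..n}" and K: "K \<in> carrier_mat (2 * n) (i - 1)" "img K = std_sub (2 * n) (i - 1)"
    and M: "M \<in> carrier_mat (n + 1) d"
  shows "img (join_cols K (lift i * M)) = {w \<in> std_sub (2 * n) (n + i). proj i *\<^sub>v w \<in> img M}"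
proof -
  have LM: "lift i * M \<in> carrier_mat (2 * n) d" by (rule mult_carrier_mat[OF lift_mat_carrier M])
  note J = join_cols_mult[OF K(1) LM]
  have Jc: "join_cols K (lift i * M) \<in> carrier_mat (2 * n) (i - 1 + d)" using J(1)[of "0\<^sub>v (i - 1)" "0\<^sub>v d"] by simp
  have KE: "K *\<^sub>v a \<in> std_sub (2 * n) (n + i)" "proj i *\<^sub>v (K *\<^sub>v a) = 0\<^sub>v (n + 1)" if "a \<in> carrier_vec (i - 1)" for a
    using imgI[OF K(1) that] proj_kernel[OF i] unfolding K(2) by blast+
  have LME: "(lift i * M) *\<^sub>v b \<in> std_sub (2 * n) (n + i)" "proj i *\<^sub>v ((lift i * M) *\<^sub>v b) = M *\<^sub>v b"
    if b: "b \<in> carrier_vec d" for b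
  proof -
    have Mb: "M *\<^sub>v b \<in> carrier_vec (n + 1)" by (rule mult_mat_vec_carrier[OF M b])
    show "(lift i * M) *\<^sub>v b \<in> std_sub (2 * n) (n + i)" "proj i *\<^sub>v ((lift i * M) *\<^sub>v b) = M *\<^sub>v b"
      unfolding assoc_mult_mat_vec[OF lift_mat_carrier M b] by (rule lift_std[OF i Mb], rule proj_lift[OF i Mb])
  qed
  show ?thesis
  proof (intro equalityI subsetI)
    fix w assume "w \<in> img (join_cols K (lift i * M))"
    then obtain v where v: "v \<in> carrier_vec (i - 1 + d)" "w = join_cols K (lift i * M) *\<^sub>v v" by (rule imgE[OF _ Jc])
    obtain a b where ab: "a \<in> carrier_vec (i - 1)" "b \<in> carrier_vec d" "v = a @\<^sub>v b"
      using vec_first_last_append[OF v(1)] by (metis vec_first_carrier vec_last_carrier)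
    have w: "w = K *\<^sub>v a + (lift i * M) *\<^sub>v b" unfolding v(2) ab(3) by (rule J(2)[OF ab(1,2)])
    have "proj i *\<^sub>v w = 0\<^sub>v (n + 1) + M *\<^sub>v b"
      unfolding w using mult_add_distrib_mat_vec[OF proj_carrier mult_mat_vec_carrier[OF K(1) ab(1)] mult_mat_vec_carrier[OF LM ab(2)]]
        KE(2)[OF ab(1)] LME(2)[OF ab(2)] by simp
    then have "proj i *\<^sub>v w = M *\<^sub>v b" using mult_mat_vec_carrier[OF M ab(2)] by simp
    then have "proj i *\<^sub>v w \<in> img M" using imgI[OF M ab(2)] by simp
    moreover have "w \<in> std_sub (2 * n) (n + i)" unfolding w
      using lin_subD(3)[OF std_sub_lin] KE(1)[OF ab(1)] LME(1)[OF ab(2)] by blast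
    ultimately show "w \<in> {w \<in> std_sub (2 * n) (n + i). proj i *\<^sub>v w \<in> img M}" by blast
  next
    fix w assume w: "w \<in> {w \<in> std_sub (2 * n) (n + i). proj i *\<^sub>v w \<in> img M}"
    then have "proj i *\<^sub>v w \<in> img M" by blast
    then obtain b where b: "b \<in> carrier_vec d" "proj i *\<^sub>v w = M *\<^sub>v b" by (rule imgE[OF _ M])
    let ?u = "(lift i * M) *\<^sub>v b"
    have wc: "w \<in> carrier_vec (2 * n)" and uc: "?u \<in> carrier_vec (2 * n)"
      using w std_sub_carrier mult_mat_vec_carrier[OF LM b(1)] by blast+
    have "proj i *\<^sub>v (w - ?u) = M *\<^sub>v b - M *\<^sub>v b"
      using mult_minus_distrib_mat_vec[OF proj_carrier wc uc] b(2) LME(2)[OF b(1)] by simp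
    then have "proj i *\<^sub>v (w - ?u) = 0\<^sub>v (n + 1)" using mult_mat_vec_carrier[OF M b(1)] by simp
    moreover have "w - ?u \<in> std_sub (2 * n) (n + i)" by (rule lin_sub_minus[OF std_sub_lin]) (use w LME(1)[OF b(1)] in auto)
    ultimately have "w - ?u \<in> img K" unfolding K(2) using proj_kernel[OF i] by blast
    then obtain a where a: "a \<in> carrier_vec (i - 1)" "w - ?u = K *\<^sub>v a" by (rule imgE[OF _ K(1)])
    have "w = (w - ?u) + ?u" by (rule minus_add_vec[OF wc uc, symmetric])
    then have "w = join_cols K (lift i * M) *\<^sub>v (a @\<^sub>v b)" unfolding a(2) J(2)[OF a(1) b(1)] by simp
    then show "w \<in> img (join_cols K (lift i * M))" using imgI[OF Jc append_carrier_vec[OF a(1) b(1)]] by simp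
  qed
qed

lemma zeta_morphism: "variety_morphism (ambV n) (SpFl m) (ambW n) (schubert_iota n (sigma n)) zeta"
proof (rule variety_morphismI)
  show "SpFl m \<subseteq> points (ambV n)" by (auto simp: SpFl_eq deg_flags_def)
  show "schubert_iota n (sigma n) \<subseteq> points (ambW n)" using flags_W_points by (auto simp: schubert_iota_eq)
  show "zeta x \<in> schubert_iota n (sigma n)" if "x \<in> SpFl m" for x using zeta_bij that by (auto simp: bij_betw_def)
  fix x0 assume "x0 \<in> SpFl m"
  then have x0: "x0 \<in> points (ambV n)" by (auto simp: SpFl_eq deg_flags_def)
  have facV: "factors (ambV n) = n" "vdim (ambV n) = n + 1" "subdim (ambV n) = (\<lambda>i. i)" by (auto simp: ambV_def)
  have facW: "factors (ambW n) = n" "vdim (ambW n) = 2 * n" by (auto simp: ambW_def)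
  obtain U M where U: "openin (zariski (ambV n)) U" "x0 \<in> U"
    "\<And>i. i \<in> {1..n} \<Longrightarrow> ratmat (ambV n) U (n + 1) i (M i)"
    "\<And>i x. i \<in> {1..n} \<Longrightarrow> x \<in> U \<Longrightarrow> img (M i x) = x i"
    using local_frames[OF x0] unfolding facV by metis
  have "\<forall>i. \<exists>K. i \<in> {1..n} \<longrightarrow> K \<in> carrier_mat (2 * n) (i - 1) \<and> img K = std_sub (2 * n) (i - 1)"
  proof
    fix i
    show "\<exists>K. i \<in> {1..n} \<longrightarrow> K \<in> carrier_mat (2 * n) (i - 1) \<and> img K = std_sub (2 * n) (i - 1)"
    proof (cases "i \<in> {1..n}")
      case True
      then have "i - 1 \<le> 2 * n" by auto
      from Gr_frame[OF std_sub_Gr[OF this]] show ?thesis by metis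
    qed blast
  qed
  then obtain K where K: "\<And>i. i \<in> {1..n} \<Longrightarrow> K i \<in> carrier_mat (2 * n) (i - 1) \<and> img (K i) = std_sub (2 * n) (i - 1)"
    by metis
  have "ratmat (ambV n) (U \<inter> SpFl m) (2 * n) (i - 1 + i) (\<lambda>x. join_cols (K i) (lift i * M i x)) \<and>
    (\<forall>x\<in>U \<inter> SpFl m. img (join_cols (K i) (lift i * M i x)) = zeta x i)" if i: "i \<in> {1..n}" for i
  proof
    show "ratmat (ambV n) (U \<inter> SpFl m) (2 * n) (i - 1 + i) (\<lambda>x. join_cols (K i) (lift i * M i x))"
      by (rule ratmat_subset[of _ U], intro ratmat_join ratmat_const ratmat_mult[OF ratmat_const[OF lift_mat_carrier]] U(3) i)
        (use K[OF i] in auto)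
    show "\<forall>x\<in>U \<inter> SpFl m. img (join_cols (K i) (lift i * M i x)) = zeta x i"
    proof
      fix x assume x: "x \<in> U \<inter> SpFl m"
      have "M i x \<in> carrier_mat (n + 1) i" using U(3)[OF i] x by (simp add: ratmat_def)
      from zeta_frame[OF i _ _ this] K[OF i] U(4)[OF i] x
      show "img (join_cols (K i) (lift i * M i x)) = zeta x i" using i by (simp add: zeta_def)
    qed
  qed
  then show "\<exists>U M c. openin (zariski (ambV n)) U \<and> x0 \<in> U \<and> (\<forall>i\<in>{1..factors (ambW n)}.
      ratmat (ambV n) (U \<inter> SpFl m) (vdim (ambW n)) (c i) (M i) \<and> (\<forall>x\<in>U \<inter> SpFl m. img (M i x) = zeta x i))"
    unfolding facW using U(1,2)
    by (intro exI[of _ U] exI[of _ "\<lambda>i x. join_cols (K i) (lift i * M i x)"] exI[of _ "\<lambda>i. i - 1 + i"]) blast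
qed

lemma zeta_inv_morphism:
  "variety_morphism (ambW n) (schubert_iota n (sigma n)) (ambV n) (SpFl m) (inv_into (SpFl m) zeta)"
proof (rule variety_morphismI)
  let ?Y = "schubert_iota n (sigma n)" and ?h = "inv_into (SpFl m) zeta"
  show "SpFl m \<subseteq> points (ambV n)" by (auto simp: SpFl_eq deg_flags_def)
  show "?Y \<subseteq> points (ambW n)" using flags_W_points by (auto simp: schubert_iota_eq)
  show "?h y \<in> SpFl m" if "y \<in> ?Y" for y using zeta_bij that by (metis bij_betw_def inv_into_into)
  have h: "?h y = zeta_inv y" if y: "y \<in> ?Y" for y
  proof -
    have "?h y \<in> SpFl m" "zeta (?h y) = y" using zeta_bij y by (metis bij_betw_def inv_into_into, metis bij_betw_def f_inv_into_f)
    then show ?thesis using zeta_inv_zeta[of "?h y"] by (simp add: SpFl_eq)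
  qed
  fix y0 assume "y0 \<in> ?Y"
  then have y0: "y0 \<in> points (ambW n)" using flags_W_points by (auto simp: schubert_iota_eq)
  have facV: "factors (ambV n) = n" "vdim (ambV n) = n + 1" by (auto simp: ambV_def)
  have facW: "factors (ambW n) = n" "vdim (ambW n) = 2 * n" "subdim (ambW n) = (\<lambda>i. 2 * i - 1)" by (auto simp: ambW_def)
  obtain U M where U: "openin (zariski (ambW n)) U" "y0 \<in> U"
    "\<And>i. i \<in> {1..n} \<Longrightarrow> ratmat (ambW n) U (2 * n) (2 * i - 1) (M i)"
    "\<And>i x. i \<in> {1..n} \<Longrightarrow> x \<in> U \<Longrightarrow> img (M i x) = x i"
    using local_frames[OF y0] unfolding facW by metis
  have "ratmat (ambW n) (U \<inter> ?Y) (n + 1) (2 * i - 1) (\<lambda>y. proj i * M i y) \<and>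
    (\<forall>y\<in>U \<inter> ?Y. img (proj i * M i y) = ?h y i)" if i: "i \<in> {1..n}" for i
  proof
    show "ratmat (ambW n) (U \<inter> ?Y) (n + 1) (2 * i - 1) (\<lambda>y. proj i * M i y)"
      by (rule ratmat_subset[of _ U], intro ratmat_mult[OF ratmat_const[OF proj_carrier]] U(3) i) auto
    show "\<forall>y\<in>U \<inter> ?Y. img (proj i * M i y) = ?h y i"
    proof
      fix y assume y: "y \<in> U \<inter> ?Y"
      have "M i y \<in> carrier_mat (2 * n) (2 * i - 1)" using U(3)[OF i] y by (simp add: ratmat_def)
      from img_image[OF proj_carrier this] show "img (proj i * M i y) = ?h y i"
        using h U(4)[OF i] y i by (simp add: zeta_inv_def)
    qed
  qed
  then show "\<exists>U M c. openin (zariski (ambW n)) U \<and> y0 \<in> U \<and> (\<forall>i\<in>{1..factors (ambV n)}.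
      ratmat (ambW n) (U \<inter> ?Y) (vdim (ambV n)) (c i) (M i) \<and> (\<forall>x\<in>U \<inter> ?Y. img (M i x) = ?h x i))"
    unfolding facV using U(1,2)
    by (intro exI[of _ U] exI[of _ "\<lambda>i x. proj i * M i x"] exI[of _ "\<lambda>i. 2 * i - 1"]) blast
qed

text \<open>The torus acts on the \<open>i\<close>-th copy of \<open>V\<close> through the diagonal entries at the positions of the \<open>i\<close>-th window, and diagonal matrices commute with the signs.\<close>

lemma zeta_equivariant:
  assumes t: "t \<in> torus_SL n" and x: "x \<in> deg_flags n"
  shows "zeta (torus_act_V n t x) = torus_act_W n t (zeta x)"
proof
  fix i
  show "zeta (torus_act_V n t x) i = torus_act_W n t (zeta x) i"
  proof (cases "i \<in> {1..n}")
    case False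
    then show ?thesis by (simp add: zeta_def torus_act_W_def act_def del: atLeastAtMost_iff)
  next
    case i: True
    let ?N = "2 * n"
    have tc: "t \<in> carrier_mat ?N ?N" and td: "diagonal_mat t" and t1: "det t = 1"
      using t by (auto simp: torus_SL_def SL_def)
    have "upper_triangular t" using td tc by (auto simp: diagonal_mat_def upper_triangular_def)
    then have "prod_list (diag_mat t) = 1" using det_upper_triangular tc t1 by metis
    then have "0 \<notin> set (diag_mat t)" by (metis prod_list_zero_iff zero_neq_one)
    then have tnz: "t $$ (r, r) \<noteq> 0" if "r < ?N" for r using that tc by (force simp: diag_mat_def)
    have tw: "(t *\<^sub>v w) $ r = t $$ (r, r) * w $ r" if r: "r < ?N" and w: "w \<in> carrier_vec ?N" for r w
    proof -
      have "row t r = t $$ (r, r) \<cdot>\<^sub>v unit_vec ?N r"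
        using r tc td by (intro eq_vecI) (auto simp: diagonal_mat_def)
      then show ?thesis using r w tc smult_scalar_prod_distrib[OF unit_vec_carrier w, of "t $$ (r, r)" r] by simp
    qed
    let ?D = "torus_mat_V n t i"
    have Dc: "?D \<in> carrier_mat (n + 1) (n + 1)" by (simp add: torus_mat_V_def)
    have Dv: "(?D *\<^sub>v v) $ k = t $$ (pos i k, pos i k) * v $ k" if k: "k < n + 1" and v: "v \<in> carrier_vec (n + 1)" for k v
    proof -
      have "row ?D k = t $$ (pos i k, pos i k) \<cdot>\<^sub>v unit_vec (n + 1) k"
        using k by (intro eq_vecI) (auto simp: torus_mat_V_def mat_diag_def pos_def Let_def)
      then show ?thesis using k v Dc smult_scalar_prod_distrib[OF unit_vec_carrier v, of "t $$ (pos i k, pos i k)" k] by simp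
    qed
    have tcw: "t *\<^sub>v w \<in> carrier_vec ?N" if "w \<in> carrier_vec ?N" for w using tc that by simp
    have pw: "proj i *\<^sub>v w \<in> carrier_vec (n + 1)" if "w \<in> carrier_vec ?N" for w
      by (rule mult_mat_vec_carrier[OF proj_carrier that])
    have comm: "proj i *\<^sub>v (t *\<^sub>v w) = ?D *\<^sub>v (proj i *\<^sub>v w)" if w: "w \<in> carrier_vec ?N" for w
    proof (rule eq_vecI)
      fix k assume "k < dim_vec (?D *\<^sub>v (proj i *\<^sub>v w))"
      then have k: "k < n + 1" using Dc by simp
      have p: "pos i k < ?N" using pos_less[OF i k] by simp
      show "(proj i *\<^sub>v (t *\<^sub>v w)) $ k = (?D *\<^sub>v (proj i *\<^sub>v w)) $ k"
        unfolding proj_index[OF i tcw[OF w] k] Dv[OF k pw[OF w]] proj_index[OF i w k] tw[OF p w] by simp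
    qed (use Dc proj_carrier in \<open>simp add: proj_def\<close>)
    have Dinj: "u = v" if "u \<in> carrier_vec (n + 1)" "v \<in> carrier_vec (n + 1)" "?D *\<^sub>v u = ?D *\<^sub>v v" for u v
    proof (rule eq_vecI)
      fix k assume "k < dim_vec v"
      then have k: "k < n + 1" using that by simp
      have "pos i k < ?N" using pos_less[OF i k] by simp
      then show "u $ k = v $ k" using Dv[OF k that(1)] Dv[OF k that(2)] that(3) tnz by simp
    qed (use that in simp)
    have L: "zeta (torus_act_V n t x) i = {w \<in> std_sub ?N (n + i). proj i *\<^sub>v w \<in> (\<lambda>v. ?D *\<^sub>v v) ` x i}"
      using i by (simp add: zeta_def torus_act_V_def act_def)
    have R: "torus_act_W n t (zeta x) i = (\<lambda>w. t *\<^sub>v w) ` {w \<in> std_sub ?N (n + i). proj i *\<^sub>v w \<in> x i}"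
      using i by (simp add: zeta_def torus_act_W_def act_def)
    show ?thesis unfolding L R
    proof (intro equalityI subsetI)
      fix w assume "w \<in> {w \<in> std_sub ?N (n + i). proj i *\<^sub>v w \<in> (\<lambda>v. ?D *\<^sub>v v) ` x i}"
      then obtain v where w: "w \<in> std_sub ?N (n + i)" and v: "v \<in> x i" "proj i *\<^sub>v w = ?D *\<^sub>v v" by blast
      define w' where "w' = vec ?N (\<lambda>r. w $ r / t $$ (r, r))"
      have wc: "w \<in> carrier_vec ?N" and wc': "w' \<in> carrier_vec ?N" using w by (auto simp: std_sub_def w'_def)
      have tw': "t *\<^sub>v w' = w"
        using tw[OF _ wc'] tnz wc tc by (intro eq_vecI) (auto simp: w'_def)
      have w'E: "w' \<in> std_sub ?N (n + i)" using w by (auto simp: std_sub_def w'_def)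
      have vc: "v \<in> carrier_vec (n + 1)" using v(1) Gr_carrier[OF deg_flags_Gr[OF x i]] by blast
      have "?D *\<^sub>v (proj i *\<^sub>v w') = ?D *\<^sub>v v" using comm[OF wc'] tw' v(2) by simp
      then have "proj i *\<^sub>v w' = v" by (rule Dinj[OF pw[OF wc'] vc])
      then show "w \<in> (\<lambda>w. t *\<^sub>v w) ` {w \<in> std_sub ?N (n + i). proj i *\<^sub>v w \<in> x i}"
        using w'E v(1) tw' by (intro image_eqI[of _ _ w']) auto
    next
      fix w assume "w \<in> (\<lambda>w. t *\<^sub>v w) ` {w \<in> std_sub ?N (n + i). proj i *\<^sub>v w \<in> x i}"
      then obtain w' where w': "w' \<in> std_sub ?N (n + i)" "proj i *\<^sub>v w' \<in> x i" "w = t *\<^sub>v w'" by blast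
      have wc': "w' \<in> carrier_vec ?N" using w' by (simp add: std_sub_def)
      have "w \<in> std_sub ?N (n + i)" using w' tw[OF _ wc'] tcw[OF wc'] by (simp add: std_sub_def)
      moreover have "proj i *\<^sub>v w \<in> (\<lambda>v. ?D *\<^sub>v v) ` x i" using comm[OF wc'] w' by simp
      ultimately show "w \<in> {w \<in> std_sub ?N (n + i). proj i *\<^sub>v w \<in> (\<lambda>v. ?D *\<^sub>v v) ` x i}" by blast
    qed
  qed
qed

end

section \<open>Isotropic flags and the symplectic group\<close>

lemma bform_E_mult:
  assumes A: "A \<in> carrier_mat (2 * n) (2 * n)" and v: "v \<in> carrier_vec (2 * n)" and w: "w \<in> carrier_vec (2 * n)"
  shows "bform (E_mat n) (A *\<^sub>v v) (A *\<^sub>v w) = v \<bullet> ((transpose_mat A * E_mat n * A) *\<^sub>v w)"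
proof -
  note E = E_mat_carrier[of n]
  have Aw: "A *\<^sub>v w \<in> carrier_vec (2 * n)" and Av: "A *\<^sub>v v \<in> carrier_vec (2 * n)" using A v w by auto
  have EAw: "E_mat n *\<^sub>v (A *\<^sub>v w) \<in> carrier_vec (2 * n)" using E Aw by simp
  have At: "transpose_mat A \<in> carrier_mat (2 * n) (2 * n)" using A by simp
  have AtE: "transpose_mat A * E_mat n \<in> carrier_mat (2 * n) (2 * n)" using At E by simp
  have "bform (E_mat n) (A *\<^sub>v v) (A *\<^sub>v w) = (E_mat n *\<^sub>v (A *\<^sub>v w)) \<bullet> (A *\<^sub>v v)"
    unfolding bform_def by (rule comm_scalar_prod[OF Av EAw])
  also have "\<dots> = (transpose_mat A *\<^sub>v (E_mat n *\<^sub>v (A *\<^sub>v w))) \<bullet> v"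
    by (rule transpose_vec_mult_scalar[OF A v EAw, symmetric])
  also have "\<dots> = v \<bullet> (transpose_mat A *\<^sub>v (E_mat n *\<^sub>v (A *\<^sub>v w)))"
    by (rule comm_scalar_prod[OF mult_mat_vec_carrier[OF At EAw] v])
  also have "transpose_mat A *\<^sub>v (E_mat n *\<^sub>v (A *\<^sub>v w)) = (transpose_mat A * E_mat n * A) *\<^sub>v w"
    unfolding assoc_mult_mat_vec[OF AtE A w] assoc_mult_mat_vec[OF At E Aw] ..
  finally show ?thesis .
qed

lemma isometry_matrix:
  assumes A: "A \<in> carrier_mat (2 * n) (2 * n)"
    and iso: "\<And>v w. v \<in> carrier_vec (2 * n) \<Longrightarrow> w \<in> carrier_vec (2 * n) \<Longrightarrow>
      bform (E_mat n) (A *\<^sub>v v) (A *\<^sub>v w) = bform (E_mat n) v w"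
  shows "transpose_mat A * E_mat n * A = E_mat n"
proof (rule eq_matI)
  note E = E_mat_carrier[of n]
  have C: "transpose_mat A * E_mat n * A \<in> carrier_mat (2 * n) (2 * n)" using A E by auto
  fix i j assume "i < dim_row (E_mat n)" "j < dim_col (E_mat n)"
  then have ij: "i < 2 * n" "j < 2 * n" using E by auto
  have entry: "unit_vec (2 * n) i \<bullet> (M *\<^sub>v unit_vec (2 * n) j) = M $$ (i, j)" if M: "M \<in> carrier_mat (2 * n) (2 * n)" for M :: "complex mat"
    unfolding mult_unit_vec[OF M ij(2)] using ij M by simp
  have "unit_vec (2 * n) i \<bullet> ((transpose_mat A * E_mat n * A) *\<^sub>v unit_vec (2 * n) j) = unit_vec (2 * n) i \<bullet> (E_mat n *\<^sub>v unit_vec (2 * n) j)"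
    using bform_E_mult[OF A unit_vec_carrier unit_vec_carrier, of i j] iso[OF unit_vec_carrier unit_vec_carrier, of i j] by (simp add: bform_def)
  then show "(transpose_mat A * E_mat n * A) $$ (i, j) = E_mat n $$ (i, j)" unfolding entry[OF C] entry[OF E] .
qed (use A E_mat_carrier[of n] in auto)

text \<open>The group is defined by \<open>A E A\<^sup>T = E\<close>, whereas preserving the form means \<open>A\<^sup>T E A = E\<close>. They agree since \<open>E\<close> inverts to \<open>-E\<close>.\<close>

lemma Sp_if_isometry:
  assumes A: "A \<in> carrier_mat (2 * n) (2 * n)" and d: "det A = 1" and AEA: "transpose_mat A * E_mat n * A = E_mat n"
  shows "A \<in> Sp n"
proof -
  let ?N = "2 * n" and ?E = "E_mat n"
  note E = E_mat_carrier[of n]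
  have mE: "- ?E \<in> carrier_mat ?N ?N" using E by simp
  have EE: "(- ?E) * ?E = 1\<^sub>m ?N" using E_mat_inverse mat_mult_left_right_inverse[OF E mE] by simp
  have At: "transpose_mat A \<in> carrier_mat ?N ?N" using A by simp
  let ?B = "(- ?E) * (transpose_mat A * ?E)"
  have B: "?B \<in> carrier_mat ?N ?N" using mE At E by auto
  have "?B * A = (- ?E) * (transpose_mat A * ?E * A)"
    using assoc_mult_mat[OF mE mult_carrier_mat[OF At E] A] by simp
  then have "?B * A = 1\<^sub>m ?N" using AEA EE by simp
  then have AB: "A * ?B = 1\<^sub>m ?N" using mat_mult_left_right_inverse[OF B A] by simp
  have Bs: "?B = (- ?E) * transpose_mat A * ?E" using assoc_mult_mat[OF mE At E] by simp
  have "A * (- ?E) * transpose_mat A * ?E = A * ?B"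
    unfolding Bs using assoc_mult_mat[OF A mult_carrier_mat[OF mE At] E] assoc_mult_mat[OF A mE At] by simp
  then have 1: "A * (- ?E) * transpose_mat A * ?E = 1\<^sub>m ?N" using AB by simp
  have X: "A * (- ?E) * transpose_mat A \<in> carrier_mat ?N ?N" using A mE At by auto
  have "A * (- ?E) * transpose_mat A = A * (- ?E) * transpose_mat A * (?E * (- ?E))"
    unfolding E_mat_inverse by (rule right_mult_one_mat[OF X, symmetric])
  also have "\<dots> = - ?E" using assoc_mult_mat[OF X E mE] 1 mE by simp
  finally have "A * (- ?E) * transpose_mat A = - ?E" .
  moreover have "A * (- ?E) * transpose_mat A = - (A * ?E * transpose_mat A)"
    using A E At by simp
  ultimately have "A * ?E * transpose_mat A = ?E" by (metis uminus_uminus_mat)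
  then show ?thesis using A d by (simp add: Sp_iff SL_def)
qed

lemma Sp_isometry:
  assumes A: "A \<in> Sp n" and v: "v \<in> carrier_vec (2 * n)" and w: "w \<in> carrier_vec (2 * n)"
  shows "bform (E_mat n) (A *\<^sub>v v) (A *\<^sub>v w) = bform (E_mat n) v w"
proof -
  let ?N = "2 * n" and ?E = "E_mat n"
  note E = E_mat_carrier[of n] and Ac = Sp_carrier[OF A]
  have At: "transpose_mat A \<in> carrier_mat ?N ?N" using Ac by simp
  have mE: "- ?E \<in> carrier_mat ?N ?N" using E by simp
  have EE: "(- ?E) * ?E = 1\<^sub>m ?N" using E_mat_inverse mat_mult_left_right_inverse[OF E mE] by simp
  have AEA: "A * ?E * transpose_mat A = ?E" using A by (simp add: Sp_iff)
  let ?C = "?E * transpose_mat A * (- ?E)"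
  have C: "?C \<in> carrier_mat ?N ?N" using E At mE by auto
  have "A * ?C = A * ?E * transpose_mat A * (- ?E)"
    using assoc_mult_mat[OF Ac mult_carrier_mat[OF E At] mE] assoc_mult_mat[OF Ac E At] by simp
  then have "A * ?C = 1\<^sub>m ?N" using AEA E_mat_inverse by simp
  then have CA: "?C * A = 1\<^sub>m ?N" using mat_mult_left_right_inverse[OF Ac C] by simp
  have "(- ?E) * (?C * A) = - ?E" using CA mE by simp
  moreover have "(- ?E) * (?C * A) = transpose_mat A * (- ?E) * A"
  proof -
    have "(- ?E) * (?C * A) = (- ?E) * ?C * A" by (rule assoc_mult_mat[OF mE C Ac, symmetric])
    also have "(- ?E) * ?C = (- ?E) * (?E * transpose_mat A) * (- ?E)"
      by (rule assoc_mult_mat[OF mE mult_carrier_mat[OF E At] mE, symmetric])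
    also have "(- ?E) * (?E * transpose_mat A) = transpose_mat A"
      using assoc_mult_mat[OF mE E At] EE At by simp
    finally show ?thesis .
  qed
  ultimately have "transpose_mat A * (- ?E) * A = - ?E" by simp
  moreover have "transpose_mat A * (- ?E) * A = - (transpose_mat A * ?E * A)" using Ac E At by simp
  ultimately have "transpose_mat A * ?E * A = ?E" by (metis uminus_uminus_mat)
  then show ?thesis using bform_E_mult[OF Ac v w] by (simp add: bform_def)
qed

context window
begin

abbreviation omega :: "complex vec \<Rightarrow> complex vec \<Rightarrow> complex" where
  "omega \<equiv> bform (E_mat n)"

lemma omega_unit:
  assumes v: "v \<in> carrier_vec (2 * n)" and q: "q < 2 * n"
  shows "omega v (unit_vec (2 * n) q) = (if q < n then - 1 else 1) * v $ (2 * n - 1 - q)"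
proof -
  let ?r = "2 * n - 1 - q"
  have r: "?r < 2 * n" using q by auto
  have "col (E_mat n) q = (if ?r < n then 1 else - 1) \<cdot>\<^sub>v unit_vec (2 * n) ?r"
  proof (rule eq_vecI)
    fix p assume "p < dim_vec ((if ?r < n then 1 else - 1) \<cdot>\<^sub>v unit_vec (2 * n) ?r :: complex vec)"
    then have p: "p < 2 * n" by simp
    have "col (E_mat n) q $ p = row (E_mat n) p $ q" using p q E_mat_carrier[of n] by simp
    also have "\<dots> = ((if ?r < n then 1 else - 1) \<cdot>\<^sub>v unit_vec (2 * n) ?r) $ p"
      unfolding E_mat_row[OF p] using p q by auto
    finally show "col (E_mat n) q $ p = ((if ?r < n then 1 else - 1) \<cdot>\<^sub>v unit_vec (2 * n) ?r) $ p" .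
  qed (use E_mat_carrier[of n] in auto)
  then have "omega v (unit_vec (2 * n) q) = (if ?r < n then 1 else - 1) * v $ ?r"
    unfolding bform_def mult_unit_vec[OF E_mat_carrier q]
    using v r by (simp add: scalar_prod_smult_distrib[OF v unit_vec_carrier])
  also have "(if ?r < n then 1 else - 1) = (if q < n then - 1 else 1 :: complex)" using q by auto
  finally show ?thesis .
qed

lemma omega_linear:
  assumes "u \<in> carrier_vec (2 * n)" "v \<in> carrier_vec (2 * n)" "w \<in> carrier_vec (2 * n)"
  shows "omega (u + v) w = omega u w + omega v w" "omega (c \<cdot>\<^sub>v u) w = c * omega u w"
    "omega u (v + w) = omega u v + omega u w" "omega u (c \<cdot>\<^sub>v v) = c * omega u v"
proof -
  note E = E_mat_carrier[of n]
  have Ec: "E_mat n *\<^sub>v w \<in> carrier_vec (2 * n)" "E_mat n *\<^sub>v v \<in> carrier_vec (2 * n)"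
    using mult_mat_vec_carrier[OF E] assms by blast+
  show "omega (u + v) w = omega u w + omega v w" unfolding bform_def
    by (rule add_scalar_prod_distrib[OF assms(1,2) Ec(1)])
  show "omega (c \<cdot>\<^sub>v u) w = c * omega u w" unfolding bform_def
    by (rule smult_scalar_prod_distrib[OF assms(1) Ec(1)])
  show "omega u (v + w) = omega u v + omega u w" unfolding bform_def mult_add_distrib_mat_vec[OF E assms(2,3)]
    by (rule scalar_prod_add_distrib[OF assms(1) Ec(2,1)])
  show "omega u (c \<cdot>\<^sub>v v) = c * omega u v" unfolding bform_def mult_mat_vec[OF E assms(2)]
    by (rule scalar_prod_smult_distrib[OF assms(1) Ec(2)])
qed

lemma omega_skew:
  assumes v: "v \<in> carrier_vec (2 * n)" and w: "w \<in> carrier_vec (2 * n)"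
  shows "omega v w = - omega w v"
proof -
  note E = E_mat_carrier[of n]
  have Et: "transpose_mat (E_mat n) = - E_mat n"
    by (rule eq_matI) (auto simp: E_mat_def J_mat_def)
  have Ew: "E_mat n *\<^sub>v w \<in> carrier_vec (2 * n)" and Ev: "E_mat n *\<^sub>v v \<in> carrier_vec (2 * n)" using E v w by auto
  have "omega v w = (transpose_mat (E_mat n) *\<^sub>v v) \<bullet> w"
    unfolding bform_def by (rule transpose_vec_mult_scalar[OF E w v, symmetric])
  also have "\<dots> = (- (E_mat n *\<^sub>v v)) \<bullet> w" unfolding Et using uminus_mult_mat_vec[of v "E_mat n"] v E by simp
  also have "\<dots> = - ((E_mat n *\<^sub>v v) \<bullet> w)"
  proof -
    have "- x = (-1) \<cdot>\<^sub>v x" for x :: "complex vec" by (intro eq_vecI) auto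
    then show ?thesis using smult_scalar_prod_distrib[OF Ev w, of "-1"] by simp
  qed
  also have "(E_mat n *\<^sub>v v) \<bullet> w = omega w v" unfolding bform_def by (rule comm_scalar_prod[OF Ev w])
  finally show ?thesis .
qed

text \<open>That the determinant is \<open>1\<close> needs an argument: an isometry has determinant \<open>1\<close> or \<open>-1\<close>, and a transvection is the square of the one with half the parameter.\<close>

lemma transvection:
  assumes u: "u \<in> carrier_vec (2 * n)"
  shows "\<exists>A\<in>Sp n. \<forall>v\<in>carrier_vec (2 * n). A *\<^sub>v v = v + (s * omega u v) \<cdot>\<^sub>v u"
proof -
  let ?N = "2 * n"
  note E = E_mat_carrier[of n]
  define l where "l = transpose_mat (E_mat n) *\<^sub>v u"
  have Et: "transpose_mat (E_mat n) \<in> carrier_mat ?N ?N" using E by simp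
  have l: "l \<in> carrier_vec ?N" unfolding l_def by (rule mult_mat_vec_carrier[OF Et u])
  have lv: "l \<bullet> v = omega u v" if "v \<in> carrier_vec ?N" for v
    unfolding l_def bform_def by (rule transpose_vec_mult_scalar[OF E that u])
  define T where "T r = rank1 u l r" for r
  have Tc: "T r \<in> carrier_mat ?N ?N" for r unfolding T_def by (rule rank1_mult(1)[OF u l u])
  have Tv: "T r *\<^sub>v v = v + (r * omega u v) \<cdot>\<^sub>v u" if "v \<in> carrier_vec ?N" for r v
    unfolding T_def rank1_mult(2)[OF u l that] lv[OF that] ..
  have uu: "omega u u = 0" using omega_skew[OF u u] by simp
  have iso: "omega (T r *\<^sub>v v) (T r *\<^sub>v w) = omega v w" if v: "v \<in> carrier_vec ?N" and w: "w \<in> carrier_vec ?N" for r v w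
  proof -
    have c: "(r * omega u v) \<cdot>\<^sub>v u \<in> carrier_vec ?N" "(r * omega u w) \<cdot>\<^sub>v u \<in> carrier_vec ?N"
      "w + (r * omega u w) \<cdot>\<^sub>v u \<in> carrier_vec ?N" using u w by auto
    have "omega (T r *\<^sub>v v) (T r *\<^sub>v w) = omega v w + (r * omega u w) * omega v u + (r * omega u v) * omega u w"
      unfolding Tv[OF v] Tv[OF w] omega_linear(1)[OF v c(1,3)] omega_linear(3)[OF v w c(2)]
        omega_linear(4)[OF v u u] omega_linear(2)[OF u u c(3)] omega_linear(3)[OF u w c(2)] omega_linear(4)[OF u u u] uu by simp
    also have "omega v u = - omega u v" by (rule omega_skew[OF v u])
    finally show ?thesis by simp
  qed
  have mat: "transpose_mat (T r) * E_mat n * T r = E_mat n" for r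
    by (rule isometry_matrix[OF Tc]) (rule iso)
  have d2: "det (T r) * det (T r) = 1" for r
  proof -
    have "det (- E_mat n) * det (E_mat n) = 1"
      using det_mult[of "- E_mat n" ?N "E_mat n"] E E_mat_inverse mat_mult_left_right_inverse[OF E, of "- E_mat n"] by simp
    then have nz: "det (E_mat n) \<noteq> 0" by auto
    have Tt: "transpose_mat (T r) \<in> carrier_mat ?N ?N" using Tc by simp
    have "det (transpose_mat (T r) * E_mat n * T r) = det (T r) * det (E_mat n) * det (T r)"
      using det_mult[OF mult_carrier_mat[OF Tt E] Tc] det_mult[OF Tt E] det_transpose[OF Tc] by simp
    then have "det (T r) * det (T r) * det (E_mat n) = det (E_mat n)" unfolding mat by (simp add: mult.assoc mult.commute)
    then show ?thesis using nz by simp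
  qed
  have "T s = T (s / 2) * T (s / 2)"
  proof (rule mat_col_eqI)
    fix j assume "j < dim_col (T (s / 2) * T (s / 2))"
    then have j: "j < ?N" using Tc[of "s / 2"] by simp
    let ?e = "unit_vec ?N j :: complex vec"
    let ?a = "(s / 2 * omega u ?e) \<cdot>\<^sub>v u"
    have a: "?a \<in> carrier_vec ?N" using u by simp
    have ea: "?e + ?a \<in> carrier_vec ?N" using a by simp
    have om: "omega u (?e + ?a) = omega u ?e"
      unfolding omega_linear(3)[OF u unit_vec_carrier a] omega_linear(4)[OF u u u] uu by simp
    have "T (s / 2) *\<^sub>v (T (s / 2) *\<^sub>v ?e) = ?e + ?a + ?a"
      unfolding Tv[OF unit_vec_carrier] Tv[OF ea] om ..
    also have "\<dots> = T s *\<^sub>v ?e" unfolding Tv[OF unit_vec_carrier] using u by (intro eq_vecI) (auto simp: field_simps)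
    finally have "T s *\<^sub>v ?e = T (s / 2) *\<^sub>v (T (s / 2) *\<^sub>v ?e)" by simp
    also have "\<dots> = (T (s / 2) * T (s / 2)) *\<^sub>v ?e" by (rule assoc_mult_mat_vec[OF Tc Tc unit_vec_carrier, symmetric])
    finally show "col (T s) j = col (T (s / 2) * T (s / 2)) j"
      unfolding mult_unit_vec[OF Tc j] mult_unit_vec[OF mult_carrier_mat[OF Tc Tc] j] .
  next
    show "dim_row (T s) = dim_row (T (s / 2) * T (s / 2))" "dim_col (T s) = dim_col (T (s / 2) * T (s / 2))"
      using carrier_matD[OF Tc[of s]] carrier_matD[OF Tc[of "s / 2"]] by simp_all
  qed
  then have "det (T s) = 1" using det_mult[OF Tc Tc, of "s / 2" "s / 2"] d2 by simp
  then have "T s \<in> Sp n" by (rule Sp_if_isometry[OF Tc _ mat])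
  then show ?thesis using Tv by blast
qed

text \<open>The transvection along \<open>b - a\<close> with parameter \<open>1 / b\<^sub>W[b, a]\<close> does it; the first \<open>k\<close> basis vectors are fixed because they are orthogonal to \<open>E\<^sub>2\<^sub>n\<^sub>-\<^sub>k\<close>, which contains \<open>b - a\<close>.\<close>

lemma transvection_move:
  assumes k: "k \<le> n" and a: "a \<in> std_sub (2 * n) (2 * n - k)" and b: "b \<in> std_sub (2 * n) (2 * n - k)"
    and nz: "omega b a \<noteq> 0"
  shows "\<exists>A\<in>Sp n. A *\<^sub>v a = b \<and> (\<forall>j<k. A *\<^sub>v unit_vec (2 * n) j = unit_vec (2 * n) j)"
proof -
  let ?N = "2 * n" and ?u = "b - a"
  have c: "a \<in> carrier_vec ?N" "b \<in> carrier_vec ?N" using a b by (auto simp: std_sub_def)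
  have u: "?u \<in> std_sub ?N (?N - k)" by (rule lin_sub_minus[OF std_sub_lin b a])
  then have uc: "?u \<in> carrier_vec ?N" by (simp add: std_sub_def)
  obtain A where A: "A \<in> Sp n" "\<forall>v\<in>carrier_vec ?N. A *\<^sub>v v = v + (1 / omega b a * omega ?u v) \<cdot>\<^sub>v ?u"
    using transvection[OF uc] by blast
  have aa: "omega a a = 0" using omega_skew[OF c(1) c(1)] by simp
  have "?u = b + (-1) \<cdot>\<^sub>v a" using c by (intro eq_vecI) auto
  then have "omega ?u a = omega b a"
    using omega_linear(1)[OF c(2) _ c(1), of "(-1) \<cdot>\<^sub>v a"] omega_linear(2)[OF c(1) c(1) c(1), of "-1"] aa c by simp
  then have "A *\<^sub>v a = a + 1 \<cdot>\<^sub>v ?u" using A(2) c nz by simp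
  also have "\<dots> = b" using c by (intro eq_vecI) auto
  finally have "A *\<^sub>v a = b" .
  moreover have "A *\<^sub>v unit_vec ?N j = unit_vec ?N j" if j: "j < k" for j
  proof -
    have jn: "j < ?N" "?N - k \<le> ?N - 1 - j" "?N - 1 - j < ?N" using j k by auto
    have "?u $ (?N - 1 - j) = 0" by (rule std_subD[OF u jn(2,3)])
    then have "omega ?u (unit_vec ?N j) = 0" unfolding omega_unit[OF uc jn(1)] by simp
    then have "A *\<^sub>v unit_vec ?N j = unit_vec ?N j + 0 \<cdot>\<^sub>v ?u" using A(2) unit_vec_carrier[of ?N j] by simp
    then show ?thesis using zero_smult[OF uc] by simp
  qed
  ultimately show ?thesis using A(1) by blast
qed

text \<open>A single transvection moves \<open>v\<close> to the target only if the two are not orthogonal. It always works to go through a vector \<open>z\<close> that is orthogonal to neither: a basis vector dual to a nonzero coordinate of \<open>v\<close>, the basis vector dual to the target, or their sum.\<close>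

lemma Sp_move:
  assumes k: "k < n" and v: "v \<in> std_sub (2 * n) (2 * n - k)" "v \<notin> std_sub (2 * n) k"
  shows "\<exists>A\<in>Sp n. A *\<^sub>v v = unit_vec (2 * n) k \<and> (\<forall>j<k. A *\<^sub>v unit_vec (2 * n) j = unit_vec (2 * n) j)"
proof -
  let ?N = "2 * n" and ?e = "\<lambda>j. unit_vec (2 * n) j :: complex vec" and ?F = "std_sub (2 * n) (2 * n - k)"
  have vc: "v \<in> carrier_vec ?N" using v(1) by (simp add: std_sub_def)
  have eF: "?e j \<in> ?F" if "j < ?N - k" for j using that by (auto simp: std_sub_def)
  have ek: "?e k \<in> ?F" using k by (intro eF) auto
  obtain p where p: "k \<le> p" "p < ?N" "v $ p \<noteq> 0" using v(2) vc by (auto simp: std_sub_def)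
  have pk: "p < ?N - k" using std_subD[OF v(1), of p] p by (meson not_le)
  let ?z1 = "?e (?N - 1 - p)" and ?z2 = "?e (?N - 1 - k)"
  have q: "?N - 1 - p < ?N" "?N - 1 - k < ?N" "?N - 1 - p < ?N - k" "?N - 1 - k < ?N - k"
    "?N - 1 - (?N - 1 - p) = p" "\<not> ?N - 1 - k < n" using p pk k by linarith+
  have zF: "?z1 \<in> ?F" "?z2 \<in> ?F" using eF q(3,4) by blast+
  have zc: "?z1 \<in> carrier_vec ?N" "?z2 \<in> carrier_vec ?N" by simp_all
  have v1: "omega v ?z1 \<noteq> 0" unfolding omega_unit[OF vc q(1)] q(5) using p(3) by simp
  have kN: "k < ?N" using k by simp
  have e2: "omega ?z2 (?e k) \<noteq> 0" unfolding omega_unit[OF zc(2) kN] using q(2) k by simp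
  obtain z where z: "z \<in> ?F" "omega v z \<noteq> 0" "omega z (?e k) \<noteq> 0"
  proof -
    consider "omega ?z1 (?e k) \<noteq> 0" | "omega v ?z2 \<noteq> 0" | "omega ?z1 (?e k) = 0" "omega v ?z2 = 0" by blast
    then show thesis
    proof cases
      case 1 then show thesis using that[OF zF(1) v1] by blast
    next
      case 2 then show thesis using that[OF zF(2) _ e2] by blast
    next
      case 3
      have "omega v (?z1 + ?z2) \<noteq> 0" unfolding omega_linear(3)[OF vc zc] using 3 v1 by simp
      moreover have "omega (?z1 + ?z2) (?e k) \<noteq> 0" unfolding omega_linear(1)[OF zc unit_vec_carrier] using 3 e2 by simp
      ultimately show thesis using that lin_subD(3)[OF std_sub_lin zF] by blast
    qed
  qed
  have zc': "z \<in> carrier_vec ?N" using z(1) by (simp add: std_sub_def)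
  have "omega z v \<noteq> 0" "omega (?e k) z \<noteq> 0" using z(2,3) omega_skew[OF zc' vc] omega_skew[OF unit_vec_carrier zc', of k] by auto
  then obtain A B where A: "A \<in> Sp n" "A *\<^sub>v v = z" "\<forall>j<k. A *\<^sub>v ?e j = ?e j"
    and B: "B \<in> Sp n" "B *\<^sub>v z = ?e k" "\<forall>j<k. B *\<^sub>v ?e j = ?e j"
    using transvection_move[OF less_imp_le[OF k] v(1) z(1)] transvection_move[OF less_imp_le[OF k] z(1) ek] by blast
  note m = assoc_mult_mat_vec[OF Sp_carrier[OF B(1)] Sp_carrier[OF A(1)]]
  have "(B * A) *\<^sub>v v = ?e k" unfolding m[OF vc] A(2) B(2) ..
  moreover have "(B * A) *\<^sub>v ?e j = ?e j" if "j < k" for j unfolding m[OF unit_vec_carrier] using A(3) B(3) that by simp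
  ultimately show ?thesis using Sp_mult[OF B(1) A(1)] by blast
qed

text \<open>Basis vectors are moved into place one at a time. For \<open>e\<^sub>k\<^sub>+\<^sub>1\<close> take a vector outside \<open>E\<^sub>k\<close> in the first member of dimension above \<open>k\<close>; isotropy of this member, which contains \<open>E\<^sub>k\<close>, puts the vector into \<open>E\<^sub>2\<^sub>n\<^sub>-\<^sub>k\<close>, as \<open>Sp_move\<close> requires.\<close>

lemma isotropic_flag_to_standard:
  assumes Gr: "\<And>i. i \<in> {1..n} \<Longrightarrow> y i \<in> Gr (2 * i - 1) (2 * n)"
    and mono: "\<And>i j. 1 \<le> i \<Longrightarrow> i \<le> j \<Longrightarrow> j \<le> n \<Longrightarrow> y i \<subseteq> y j"
    and orth: "\<And>i u v. i \<in> {1..n} \<Longrightarrow> u \<in> y i \<Longrightarrow> v \<in> y (n + 1 - i) \<Longrightarrow> omega u v = 0"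
    and k: "k \<le> n"
  shows "\<exists>A\<in>Sp n. \<forall>i\<in>{1..n}. std_sub (2 * n) (min k (2 * i - 1)) \<subseteq> (\<lambda>v. A *\<^sub>v v) ` y i"
  using k
proof (induction k)
  case 0
  have "\<exists>A. A \<in> Sp n"
  proof -
    have "\<exists>A\<in>Sp n. \<forall>v\<in>carrier_vec (2 * n). A *\<^sub>v v = v + (0 * omega (0\<^sub>v (2 * n)) v) \<cdot>\<^sub>v 0\<^sub>v (2 * n)"
      by (rule transvection) simp
    then show ?thesis by blast
  qed
  then obtain A where A: "A \<in> Sp n" by blast
  have "std_sub (2 * n) 0 \<subseteq> (\<lambda>v. A *\<^sub>v v) ` y i" if i: "i \<in> {1..n}" for i
    unfolding std_sub_subset_iff[OF lin_sub_image[OF Gr_lin_sub[OF Gr[OF i]] Sp_carrier[OF A]] le0] by simp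
  then show ?case using A by (intro bexI[of _ A]) simp_all
next
  case (Suc k)
  let ?N = "2 * n" and ?e = "\<lambda>j. unit_vec (2 * n) j :: complex vec"
  obtain A where A: "A \<in> Sp n" "\<forall>i\<in>{1..n}. std_sub ?N (min k (2 * i - 1)) \<subseteq> (\<lambda>v. A *\<^sub>v v) ` y i"
    using Suc by auto
  note Ac = Sp_carrier[OF A(1)]
  have Ad: "det A = 1" using A(1) by (simp add: Sp_def SL_def)
  define W where "W i = (\<lambda>v. A *\<^sub>v v) ` y i" for i
  have WGr: "W i \<in> Gr (2 * i - 1) ?N" if i: "i \<in> {1..n}" for i
    unfolding W_def by (rule Gr_inj_image[OF Gr[OF i] Ac]) (use unit_det_inj[OF Ac Ad] Gr_carrier[OF Gr[OF i]] in blast)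
  have WE: "?e j \<in> W i" if "i \<in> {1..n}" "j < k" "j < 2 * i - 1" for i j
  proof -
    have "?e j \<in> std_sub ?N (min k (2 * i - 1))" using that by (auto simp: std_sub_def)
    then show ?thesis using A(2) that(1) by (auto simp: W_def)
  qed
  have Worth: "omega u v = 0" if i: "i \<in> {1..n}" and u: "u \<in> W i" and v: "v \<in> W (n + 1 - i)" for i u v
  proof -
    have j: "n + 1 - i \<in> {1..n}" using i by auto
    obtain a b where ab: "a \<in> y i" "u = A *\<^sub>v a" "b \<in> y (n + 1 - i)" "v = A *\<^sub>v b" using u v by (auto simp: W_def)
    have "a \<in> carrier_vec ?N" "b \<in> carrier_vec ?N" using ab Gr_carrier[OF Gr[OF i]] Gr_carrier[OF Gr[OF j]] by blast+
    then show ?thesis unfolding ab(2,4) using Sp_isometry[OF A(1)] orth[OF i ab(1,3)] by simp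
  qed
  have Wmono: "W i \<subseteq> W j" if "1 \<le> i" "i \<le> j" "j \<le> n" for i j using mono[OF that] by (auto simp: W_def)
  \<comment> \<open>The least index with \<open>k < 2 * i - 1\<close>.\<close>
  define i where "i = (k + 1) div 2 + 1"
  have i: "i \<in> {1..n}" "k < 2 * i - 1" "i \<le> n + 1 - i" "n + 1 - i \<le> n"
  proof -
    obtain q r where q: "q = (k + 1) div 2" "k + 1 = 2 * q + r" "r < 2"
      by (metis mod_less_divisor mult_div_mod_eq pos2)
    \<comment> \<open>\<open>n\<close> is odd, so \<open>2 * q \<le> n\<close> is strict\<close>
    have "2 * q + 1 \<le> n" using Suc.prems mn q(2) by presburger
    then show "i \<in> {1..n}" "k < 2 * i - 1" "i \<le> n + 1 - i" "n + 1 - i \<le> n"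
      unfolding i_def q(1)[symmetric] using Suc.prems mn q(2,3) by auto
  qed
  have "\<not> W i \<subseteq> std_sub ?N k"
  proof
    assume sub: "W i \<subseteq> std_sub ?N k"
    have "k \<le> ?N" using Suc.prems by simp
    from Gr_mono(1)[OF WGr[OF i(1)] std_sub_Gr[OF this] sub] show False using i(2) by simp
  qed
  then obtain v where v: "v \<in> W i" "v \<notin> std_sub ?N k" by blast
  have vc: "v \<in> carrier_vec ?N" using v(1) Gr_carrier[OF WGr[OF i(1)]] by blast
  have "v \<in> std_sub ?N (?N - k)"
  proof -
    have "v $ r = 0" if r: "r < ?N" "?N - k \<le> r" for r
    proof -
      let ?j = "?N - 1 - r"
      have j: "?j < k" "?j < ?N" "?N - 1 - ?j = r" using r by auto
      have "?e ?j \<in> W i" using WE[OF i(1) j(1)] j(1) i(2) by simp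
      moreover have "W i \<subseteq> W (n + 1 - i)" using Wmono i by auto
      ultimately have "omega v (?e ?j) = 0" using Worth[OF i(1) v(1)] by blast
      then show ?thesis unfolding omega_unit[OF vc j(2)] j(3) by (simp split: if_splits)
    qed
    then show ?thesis using vc by (simp add: std_sub_def)
  qed
  moreover have "k < n" using Suc.prems by simp
  ultimately obtain B where B: "B \<in> Sp n" "B *\<^sub>v v = ?e k" "\<forall>j<k. B *\<^sub>v ?e j = ?e j" using Sp_move v(2) by blast
  note Bc = Sp_carrier[OF B(1)]
  have BA: "(\<lambda>v. (B * A) *\<^sub>v v) ` y j = (\<lambda>v. B *\<^sub>v v) ` W j" if j: "j \<in> {1..n}" for j
  proof -
    have "(B * A) *\<^sub>v u = B *\<^sub>v (A *\<^sub>v u)" if "u \<in> y j" for u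
      by (rule assoc_mult_mat_vec[OF Bc Ac]) (use Gr_carrier[OF Gr[OF j]] that in blast)
    then show ?thesis by (simp add: W_def image_image)
  qed
  have "std_sub ?N (min (Suc k) (2 * j - 1)) \<subseteq> (\<lambda>v. B *\<^sub>v v) ` W j" if j: "j \<in> {1..n}" for j
  proof -
    have le: "min (Suc k) (2 * j - 1) \<le> ?N" using Suc.prems by simp
    show ?thesis
      unfolding std_sub_subset_iff[OF lin_sub_image[OF Gr_lin_sub[OF WGr[OF j]] Bc] le]
    proof (intro allI impI)
      fix r assume r: "r < min (Suc k) (2 * j - 1)"
      show "?e r \<in> (\<lambda>v. B *\<^sub>v v) ` W j"
      proof (cases "r < k")
        case True
        then have "?e r \<in> W j" "B *\<^sub>v ?e r = ?e r" using WE[OF j] r B(3) by auto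
        then show ?thesis by (metis imageI)
      next
        case False
        then have rk: "r = k" "k < 2 * j - 1" using r by auto
        then have "i \<le> j" unfolding i_def by linarith
        then have "v \<in> W j" using Wmono[of i j] v(1) i(1) j by auto
        then show ?thesis unfolding rk(1) using B(2) by (metis imageI)
      qed
    qed
  qed
  then show ?case using Sp_mult[OF B(1) A(1)] BA by (intro bexI[of _ "B * A"]) (simp_all del: atLeastAtMost_iff)
qed

text \<open>Once the members up to \<open>W\<^sub>m\<close> are standard, so are the others, which are their orthogonals.\<close>

lemma schubert_iota_subset_Sp_mod_Q: "schubert_iota n (sigma n) \<subseteq> Sp_mod_Q n"
proof
  let ?N = "2 * n"
  fix y assume "y \<in> schubert_iota n (sigma n)"
  then have y: "y \<in> flags_W" and fixed: "iota n (E_mat n) y = y" by (auto simp: schubert_iota_eq)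
  have yp: "y \<in> points (ambW n)" using y flags_W_points by blast
  have orth: "omega u v = 0" if "i \<in> {1..n}" "u \<in> y i" "v \<in> y (n + 1 - i)" for i u v
    using iota_W_iff[OF yp] fixed that by blast
  note Gr = flags_W_D(1)[OF y]
  obtain A where A: "A \<in> Sp n" "\<forall>i\<in>{1..n}. std_sub ?N (min n (2 * i - 1)) \<subseteq> (\<lambda>v. A *\<^sub>v v) ` y i"
    using isotropic_flag_to_standard[of y n] Gr flags_W_mono[OF y] orth by blast
  note Ac = Sp_carrier[OF A(1)]
  have Ad: "det A = 1" using A(1) by (simp add: Sp_def SL_def)
  define W where "W i = (\<lambda>v. A *\<^sub>v v) ` y i" for i
  have WGr: "W i \<in> Gr (2 * i - 1) ?N" if i: "i \<in> {1..n}" for i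
    unfolding W_def by (rule Gr_inj_image[OF Gr[OF i] Ac]) (use unit_det_inj[OF Ac Ad] Gr_carrier[OF Gr[OF i]] in blast)
  have low: "W i = std_sub ?N (2 * i - 1)" if i: "i \<in> {1..n}" "i \<le> m" for i
  proof -
    have "min n (2 * i - 1) = 2 * i - 1" using i(2) mn by auto
    then have "std_sub ?N (2 * i - 1) \<subseteq> W i" using bspec[OF A(2) i(1)] by (simp only: W_def)
    moreover have "2 * i - 1 \<le> ?N" using i(1) by auto
    ultimately show ?thesis using Gr_mono(2)[OF std_sub_Gr WGr[OF i(1)]] by blast
  qed
  have W: "W i = std_sub ?N (2 * i - 1)" if i: "i \<in> {1..n}" for i
  proof (cases "i \<le> m")
    case True then show ?thesis using low i by blast
  next
    case False
    let ?j = "n + 1 - i"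
    have j: "?j \<in> {1..n}" "?j \<le> m" using False i mn by auto
    have "W i \<subseteq> std_sub ?N (2 * i - 1)"
    proof
      fix v assume v: "v \<in> W i"
      have vc: "v \<in> carrier_vec ?N" using Gr_carrier[OF WGr[OF i]] v by blast
      have "v $ r = 0" if r: "r < ?N" "2 * i - 1 \<le> r" for r
      proof -
        let ?q = "?N - 1 - r"
        have q: "?q < ?N" "?N - 1 - ?q = r" "?q < 2 * ?j - 1" using r i by auto
        have "unit_vec ?N ?q \<in> W ?j" unfolding low[OF j] using q by (auto simp: std_sub_def)
        then obtain b where b: "b \<in> y ?j" "unit_vec ?N ?q = A *\<^sub>v b" by (auto simp: W_def)
        obtain a where a: "a \<in> y i" "v = A *\<^sub>v a" using v by (auto simp: W_def)
        have "a \<in> carrier_vec ?N" "b \<in> carrier_vec ?N" using a b Gr_carrier[OF Gr[OF i]] Gr_carrier[OF Gr[OF j(1)]] by blast+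
        then have "omega v (unit_vec ?N ?q) = 0" unfolding a(2) b(2) using Sp_isometry[OF A(1)] orth[OF i a(1) b(1)] by simp
        then show ?thesis unfolding omega_unit[OF vc q(1)] q(2) by (simp split: if_splits)
      qed
      then show "v \<in> std_sub ?N (2 * i - 1)" using vc by (simp add: std_sub_def)
    qed
    moreover have "2 * i - 1 \<le> ?N" using i by auto
    ultimately show ?thesis using Gr_mono(2)[OF WGr[OF i] std_sub_Gr] by blast
  qed
  obtain X where X: "X \<in> Sp n" "A * X = 1\<^sub>m ?N" "X * A = 1\<^sub>m ?N" using Sp_inverse[OF A(1)] .
  have "act n (\<lambda>_. A) y = coord_flag n id"
  proof
    fix i
    show "act n (\<lambda>_. A) y i = coord_flag n id i"
    proof (cases "i \<in> {1..n}")
      case True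
      have "act n (\<lambda>_. A) y i = W i" using True by (simp add: act_def W_def)
      then show ?thesis using W[OF True] coord_flag_id[OF True] by simp
    next
      case False
      then show ?thesis by (simp only: act_def coord_flag_def restrict_apply if_False)
    qed
  qed
  then have "act n (\<lambda>_. X) (coord_flag n id) = act n (\<lambda>_. X * A) y"
    using act_mult[OF Sp_carrier[OF X(1)] Ac, of n y] flags_W_D(3)[OF y] by metis
  also have "\<dots> = y"
  proof
    fix i
    show "act n (\<lambda>_. X * A) y i = y i"
    proof (cases "i \<in> {1..n}")
      case True
      have "(\<lambda>v. 1\<^sub>m ?N *\<^sub>v v) ` y i = (\<lambda>v. v) ` y i" by (rule image_cong) (use flags_W_D(3)[OF y True] in auto)
      then show ?thesis using True unfolding X(3) by (simp add: act_def)
    next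
      case False
      have "y i = undefined" using yp False by (auto simp: points_def ambW_def PiE_def extensional_def)
      then show ?thesis using False by (simp add: act_def del: atLeastAtMost_iff)
    qed
  qed
  finally show "y \<in> Sp_mod_Q n" using X(1) unfolding Sp_mod_Q_def by (metis imageI)
qed

end

theorem theorem4p1:
  fixes m n :: nat
  assumes "1 \<le> m" and "n = 2 * m - 1"
  shows "schubert_iota n (sigma n) \<subseteq> Sp_mod_Q n \<and>
    (\<exists>\<zeta>. variety_isomorphism (ambV n) (SpFl m) (ambW n) (schubert_iota n (sigma n)) \<zeta> \<and>
      (\<forall>t\<in>torus_Sp n. \<forall>x\<in>SpFl m.
        \<zeta> (torus_act_V n t x) = torus_act_W n t (\<zeta> x)))"
proof -
  interpret window m n using assms by unfold_locales
  have "variety_isomorphism (ambV n) (SpFl m) (ambW n) (schubert_iota n (sigma n)) zeta"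
    unfolding variety_isomorphism_def
    using closed_SpFl closed_schubert_iota zeta_bij zeta_morphism zeta_inv_morphism by blast
  moreover have "zeta (torus_act_V n t x) = torus_act_W n t (zeta x)" if "t \<in> torus_Sp n" "x \<in> SpFl m" for t x
    using zeta_equivariant that by (simp add: torus_Sp_def SpFl_eq)
  ultimately show ?thesis using schubert_iota_subset_Sp_mod_Q by blast
qed

end
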